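(* Let $q_{1},q_{2},q_{3}\in[2,\infty)$ satisfy $\frac12\le\sum_{i=1}^{3}\frac{1}{q_i}\le\frac32$. Then there exists a positive constant $C=C(q_{1},q_{2},q_{3})$ such that for all $u\in L^2(\mathbb{R}^3)$ with $\nabla u\in L^2(\mathbb{R}^3)$, $$\|u\|_{L^{\overrightarrow{q}}(\mathbb{R}^3)}\le C\,\|\nabla u\|_{L^{2}(\mathbb{R}^{3})}^{\frac32-\sum_{i=1}^{3}\frac{1}{q_i}}\,\|u\|_{L^{2}(\mathbb{R}^{3})}^{\sum_{i=1}^{3}\frac{1}{q_i}-\frac12},$$ where $\overrightarrow{q}=(q_1,q_2,q_3)$.
   Context: For $\overrightarrow{q}=(q_1,q_2,q_3)\in[1,\infty]^3$, the anisotropic (mixed) Lebesgue norm is $$\|f\|_{L^{\overrightarrow{q}}(\mathbb{R}^3)}=\Big\|\big\|\|f\|_{L^{q_1}_{x_1}(\mathbb{R})}\big\|_{L^{q_2}_{x_2}(\mathbb{R})}\Big\|_{L^{q_3}_{x_3}(\mathbb{R})},$$ i.e. the $L^{q_1}$ norm in $x_1$ is taken first, then the $L^{q_2}$ norm in $x_2$, then the $L^{q_3}$ norm in $x_3$. *)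

theory Defs
  imports "HOL-Analysis.Analysis"
begin

(* Powers of extended nonnegative reals; used below for positive exponents only. *)
definition ennreal_powr :: "ennreal \<Rightarrow> real \<Rightarrow> ennreal" where
  "ennreal_powr x a = (if x = \<infinity> then \<infinity> else ennreal (enn2real x powr a))"

(* The L^p norm for 1 <= p < infinity. It takes an extended nonnegative function,
   namely the absolute value of the function in question, so that it can be iterated. *)
definition Lp_norm :: "real \<Rightarrow> ('a::euclidean_space \<Rightarrow> ennreal) \<Rightarrow> ennreal" where
  "Lp_norm p f = ennreal_powr (\<integral>\<^sup>+x. ennreal_powr (f x) p \<partial>lebesgue) (1 / p)"

definition mixed_norm :: "real \<Rightarrow> real \<Rightarrow> real \<Rightarrow> (real ^ 3 \<Rightarrow> real) \<Rightarrow> ennreal" where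
  "mixed_norm q1 q2 q3 f =
     Lp_norm q3 (\<lambda>x3::real. Lp_norm q2 (\<lambda>x2::real. Lp_norm q1 (\<lambda>x1::real.
       ennreal \<bar>f (vector [x1, x2, x3])\<bar>)))"

definition in_L2 :: "('a::euclidean_space \<Rightarrow> 'b::euclidean_space) \<Rightarrow> bool" where
  "in_L2 f \<longleftrightarrow> f \<in> borel_measurable lebesgue \<and> Lp_norm 2 (\<lambda>x. ennreal (norm (f x))) < \<infinity>"

(* Real-valued, hence meaningful only for functions satisfying in_L2. *)
definition L2_norm :: "('a::euclidean_space \<Rightarrow> 'b::euclidean_space) \<Rightarrow> real" where
  "L2_norm f = enn2real (Lp_norm 2 (\<lambda>x. ennreal (norm (f x))))"

definition partial :: "'n \<Rightarrow> (real ^ 'n \<Rightarrow> real) \<Rightarrow> real ^ 'n \<Rightarrow> real" where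
  "partial i f x = frechet_derivative f (at x) (axis i 1)"

(* k times continuously differentiable *)
primrec C_k :: "nat \<Rightarrow> (real ^ 'n \<Rightarrow> real) \<Rightarrow> bool" where
  "C_k 0 f \<longleftrightarrow> continuous_on UNIV f"
| "C_k (Suc k) f \<longleftrightarrow> f differentiable_on UNIV \<and> (\<forall>i. C_k k (partial i f))"

definition test_function :: "(real ^ 'n \<Rightarrow> real) \<Rightarrow> bool" where
  "test_function \<phi> \<longleftrightarrow> (\<forall>k. C_k k \<phi>) \<and> compact (closure {x. \<phi> x \<noteq> 0})"

(* Distributional gradient, represented by a locally integrable vector field;
   it is determined only up to null sets, hence a relation. *)
definition has_weak_gradient :: "(real ^ 'n \<Rightarrow> real) \<Rightarrow> (real ^ 'n \<Rightarrow> real ^ 'n) \<Rightarrow> bool" where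
  "has_weak_gradient u g \<longleftrightarrow>
     (\<forall>K. compact K \<longrightarrow> u absolutely_integrable_on K \<and> g absolutely_integrable_on K) \<and>
     (\<forall>\<phi> i. test_function \<phi> \<longrightarrow>
        (\<integral>x. u x * partial i \<phi> x \<partial>lebesgue) = - (\<integral>x. g x $ i * \<phi> x \<partial>lebesgue))"

end

theory Submission
  imports Defs
begin

text \<open>
  Put \<open>b\<^sub>i = 1/2 - 1/q\<^sub>i\<close> and \<open>\<theta> = b\<^sub>1 + b\<^sub>2 + b\<^sub>3\<close>, so that \<open>0 \<le> b\<^sub>i < 1/2\<close>, \<open>0 \<le> \<theta> \<le> 1\<close>, and the claim is
  \<open>\<parallel>u\<parallel>\<^sub>q \<le> C \<parallel>g\<parallel>\<^sub>2 powr \<theta> * \<parallel>u\<parallel>\<^sub>2 powr (1 - \<theta>)\<close> for the weak gradient \<open>g\<close> of \<open>u\<close>.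

  The function \<open>|u|\<close> is dominated by potentials whose kernels factor over the three coordinates. For almost
  every \<open>x\<close> and every scale \<open>R > 0\<close>, up to a constant factor,
  \<open>|u(x)| \<le> R^(-3) \<integral> |u(y)| dy + \<integral> |g(y)| |x - y|^(-2) dy\<close>, both integrals over the ball \<open>|x - y| < R\<close>. Since
  \<open>|x\<^sub>i - y\<^sub>i| \<le> |x - y|\<close>, the kernel \<open>|x - y|^(-2)\<close> is at most the product of the powers
  \<open>|x\<^sub>i - y\<^sub>i|^(-c\<^sub>i)\<close> for any \<open>c\<^sub>i \<ge> 0\<close> with sum 2. On the line, convolution with \<open>|t|^(-c)\<close> cut off at \<open>|t| < R\<close>
  maps \<open>L\<^sup>2\<close> to \<open>L\<^sup>q\<close>, \<open>1/q = 1/2 - b\<close>, with norm of order \<open>R powr (1 - b - c)\<close> for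
  \<open>0 \<le> c \<le> 1 - b\<close> and \<open>c < 1\<close>: this is the
  Hardy-Littlewood-Sobolev inequality if \<open>q > 2\<close>, and integrability of the kernel if \<open>q = 2\<close>
  (\<open>truncated_riesz_conv_bounded\<close>). Minkowski's integral inequality (\<open>Lp_norm_nn_integral_le\<close>) allows these bounds to be
  applied in one variable after the other (\<open>mixed_Lp_conv3_le\<close>). With \<open>c\<^sub>i = 2 (1 - b\<^sub>i) / (3 - \<theta>)\<close> the outcome is
  \<open>\<parallel>u\<parallel>\<^sub>q \<le> C (R powr (-\<theta>) * \<parallel>u\<parallel>\<^sub>2 + R powr (1 - \<theta>) * \<parallel>g\<parallel>\<^sub>2)\<close> for all \<open>R > 0\<close> (\<open>mixed_norm_two_scale\<close>), and the choice
  \<open>R = \<parallel>u\<parallel>\<^sub>2 / \<parallel>g\<parallel>\<^sub>2\<close> balances the two terms.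

  The pointwise bound comes from mollification. For a smooth bump \<open>\<eta>\<close> the derivative in \<open>s\<close> of the mollifier
  \<open>s^(-3) \<eta>((y - x)/s)\<close> is the divergence of a test vector field, so the definition of the weak gradient expresses
  the change of the mollified function between two scales \<open>\<delta> < R\<close> through \<open>g\<close>; integrating the resulting kernel over \<open>s\<close>
  gives \<open>|x - y|^(-2)\<close>, uniformly in \<open>\<delta>\<close> (\<open>mollification_bound\<close>). The mollifications converge weakly to a multiple of \<open>u\<close>
  as \<open>\<delta>\<close> tends to 0, and a bound that is uniform in \<open>\<delta>\<close> survives almost everywhere (\<open>mollification_bound_imp_AE\<close>).
\<close>

section \<open>Lebesgue norms of extended nonnegative functions and Minkowski's inequality\<close>

lemma ennreal_powr_ennreal: "0 \<le> r \<Longrightarrow> ennreal_powr (ennreal r) a = ennreal (r powr a)"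
  by (simp add: ennreal_powr_def)

lemma ennreal_powr_top [simp]: "ennreal_powr top a = top"
  by (simp add: ennreal_powr_def)

lemma ennreal_powr_0 [simp]: "ennreal_powr 0 a = 0"
  by (simp add: ennreal_powr_def)

lemma ennreal_powr_eq_0_iff [simp]: "ennreal_powr x a = 0 \<longleftrightarrow> x = 0"
  by (cases x) (auto simp: ennreal_powr_ennreal)

lemma ennreal_powr_eq_top_iff [simp]: "ennreal_powr x a = top \<longleftrightarrow> x = top"
  by (cases x) (auto simp: ennreal_powr_ennreal)

lemma ennreal_powr_mono: "0 \<le> a \<Longrightarrow> x \<le> y \<Longrightarrow> ennreal_powr x a \<le> ennreal_powr y a"
  by (cases x; cases y) (auto simp: ennreal_powr_ennreal top_unique intro!: ennreal_leI powr_mono2)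

lemma ennreal_powr_mult: "ennreal_powr (x * y) a = ennreal_powr x a * ennreal_powr y a"
  by (cases x; cases y)
    (auto simp: ennreal_powr_ennreal ennreal_mult[symmetric] powr_mult ennreal_mult_eq_top_iff
      ennreal_top_mult ennreal_mult_top)

lemma ennreal_powr_powr: "ennreal_powr (ennreal_powr x a) b = ennreal_powr x (a * b)"
  by (cases x) (auto simp: ennreal_powr_ennreal powr_powr)

lemma ennreal_powr_one [simp]: "ennreal_powr x 1 = x"
  by (cases x) (auto simp: ennreal_powr_ennreal)

lemma ennreal_powr_add: "ennreal_powr x (a + b) = ennreal_powr x a * ennreal_powr x b"
  by (cases x) (auto simp: ennreal_powr_ennreal powr_add ennreal_mult)

lemma ennreal_powr_two: "ennreal_powr x 2 = x * x"
  using ennreal_powr_add[of x 1 1] by simp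

lemma ennreal_powr_cancel: "a \<noteq> 0 \<Longrightarrow> ennreal_powr (ennreal_powr x a) (1 / a) = x"
  "a \<noteq> 0 \<Longrightarrow> ennreal_powr (ennreal_powr x (1 / a)) a = x"
  by (simp_all add: ennreal_powr_powr)

lemma borel_measurable_ennreal_powr [measurable]:
  "(\<lambda>x. ennreal_powr x a) \<in> borel_measurable borel"
  unfolding ennreal_powr_def by measurable

text \<open>
  The nonnegative integral over a measure agrees with that over its completion even for non-measurable integrands,
  so Lebesgue norms can be computed with Borel measure.
\<close>
lemma Lp_norm_lborel:
  "Lp_norm p f = ennreal_powr (\<integral>\<^sup>+x. ennreal_powr (f x) p \<partial>lborel) (1 / p)"
  by (simp add: Lp_norm_def nn_integral_completion)

lemma Lp_norm_powr: "p \<noteq> 0 \<Longrightarrow> ennreal_powr (Lp_norm p f) p = (\<integral>\<^sup>+x. ennreal_powr (f x) p \<partial>lborel)"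
  by (simp add: Lp_norm_lborel ennreal_powr_cancel)

lemma Lp_norm_mono_AE:
  assumes "0 < p" and "AE x in lborel. f x \<le> g x"
  shows "Lp_norm p f \<le> Lp_norm p g"
  unfolding Lp_norm_lborel
proof (intro ennreal_powr_mono nn_integral_mono_AE)
  show "AE x in lborel. ennreal_powr (f x) p \<le> ennreal_powr (g x) p"
    using assms(2) by eventually_elim (use assms(1) in \<open>simp add: ennreal_powr_mono\<close>)
qed (use assms in auto)

lemma Lp_norm_mono: "0 < p \<Longrightarrow> (\<And>x. f x \<le> g x) \<Longrightarrow> Lp_norm p f \<le> Lp_norm p g"
  by (rule Lp_norm_mono_AE) auto

lemma Lp_norm_cong_AE:
  assumes "AE x in lborel. f x = g x"
  shows "Lp_norm p f = Lp_norm p g"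
proof -
  have "(\<integral>\<^sup>+x. ennreal_powr (f x) p \<partial>lborel) = (\<integral>\<^sup>+x. ennreal_powr (g x) p \<partial>lborel)"
    using assms by (intro nn_integral_cong_AE) auto
  then show ?thesis by (simp add: Lp_norm_lborel)
qed

lemma Lp_norm_cmult:
  assumes "p \<noteq> 0" and [measurable]: "f \<in> borel_measurable borel"
  shows "Lp_norm p (\<lambda>x. c * f x) = c * Lp_norm p f"
  using assms(1)
  by (simp add: Lp_norm_lborel ennreal_powr_mult nn_integral_cmult ennreal_powr_cancel)

lemma Lp_norm_eq_0_iff:
  assumes [measurable]: "f \<in> borel_measurable borel"
  shows "Lp_norm p f = 0 \<longleftrightarrow> (AE x in lborel. f x = 0)"
  by (simp add: Lp_norm_lborel nn_integral_0_iff_AE)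

lemma borel_measurable_Lp_norm [measurable (raw)]:
  fixes F :: "'b \<Rightarrow> 'a::euclidean_space \<Rightarrow> ennreal"
  assumes [measurable]: "case_prod F \<in> borel_measurable (N \<Otimes>\<^sub>M borel)"
  shows "(\<lambda>y. Lp_norm p (F y)) \<in> borel_measurable N"
proof -
  have [measurable]: "case_prod F \<in> borel_measurable (N \<Otimes>\<^sub>M lborel)"
    using assms by (simp cong: measurable_cong_sets)
  show ?thesis
    unfolding Lp_norm_lborel by measurable
qed

text \<open>
  The graph of the convex function \<open>t \<mapsto> t powr p\<close> lies above its tangent at \<open>l\<close>; this is that inequality at
  \<open>t = a / w\<close>, multiplied by the weight \<open>w\<close>. Integrated, it yields Jensen's inequality for the measure with density \<open>w\<close>.
\<close>
lemma powr_tangent_le: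
  fixes a w l p :: real
  assumes "0 \<le> a" "0 < w" "0 < l" "1 \<le> p"
  shows "p * l powr (p - 1) * a \<le> a powr p * w powr (1 - p) + (p - 1) * l powr p * w"
proof (cases "a = 0")
  case True
  then show ?thesis using assms by simp
next
  case False
  define x where "x = a / w / l - 1"
  have x: "-1 < x" "a = l * (1 + x) * w" using False assms by (auto simp: x_def field_simps)
  have bern: "1 + p * x \<le> (1 + x) powr p"
  proof -
    have "p * ((1+x) - 1) \<le> (1 + x) powr p - 1 powr p"
    proof (rule convex_on_imp_above_tangent[where A="{0<..}"])
      show "convex_on {0<..} (\<lambda>x. x powr p)"
        by (rule powr_convex) (use assms in auto)
      show "((\<lambda>x. x powr p) has_real_derivative p) (at 1 within {0<..})"
        by (auto intro!: derivative_eq_intros)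
    qed (use x in \<open>auto simp: interior_open connected_Ioi\<close>)
    then show ?thesis by simp
  qed
  have "p * l powr (p - 1) * a - (p - 1) * l powr p * w = l powr p * w * (1 + p * x)"
    using assms x(2) by (simp add: powr_diff field_simps)
  also have "\<dots> \<le> l powr p * w * (1 + x) powr p"
    using bern assms by (intro mult_left_mono) auto
  also have "\<dots> = a powr p * w powr (1 - p)"
    using x assms by (simp add: powr_mult powr_diff)
  finally show ?thesis by simp
qed

text \<open>
  Minkowski's integral inequality. Let \<open>\<phi>(y)\<close> be the norm of \<open>F(\<cdot>, y)\<close>, \<open>\<Phi>\<close> its integral and \<open>G(x) = \<integral> F(x, y) dy\<close>. Jensen's
  inequality for the measure \<open>\<phi> dy\<close> and the function \<open>F / \<phi>\<close> says
  \<open>G(x)^p \<le> \<Phi>^(p - 1) \<integral> F(x, y)^p \<phi>(y)^(1 - p) dy\<close>; integrating over \<open>x\<close> turns the right-hand side into \<open>\<Phi>^p\<close>. The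
  argument is pointwise in \<open>x\<close> and allows \<open>G(x)\<close> to be infinite.
\<close>
lemma Lp_norm_nn_integral_le:
  fixes F :: "'a::euclidean_space \<Rightarrow> 'b \<Rightarrow> ennreal"
  assumes N: "sigma_finite_measure N"
    and F: "case_prod F \<in> borel_measurable (borel \<Otimes>\<^sub>M N)"
    and p: "1 \<le> p"
  shows "Lp_norm p (\<lambda>x. \<integral>\<^sup>+y. F x y \<partial>N) \<le> (\<integral>\<^sup>+y. Lp_norm p (\<lambda>x. F x y) \<partial>N)"
proof -
  interpret sigma_finite_measure N by fact
  interpret P: pair_sigma_finite "lborel :: 'a measure" N by standard
  have [measurable]: "case_prod F \<in> borel_measurable (lborel \<Otimes>\<^sub>M N)"
    using F by (simp cong: measurable_cong_sets)
  note F [measurable]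
  define \<phi> where "\<phi> y = Lp_norm p (\<lambda>x. F x y)" for y
  have [measurable]: "\<phi> \<in> borel_measurable N"
    unfolding \<phi>_def by measurable
  define \<Phi> where "\<Phi> = (\<integral>\<^sup>+y. \<phi> y \<partial>N)"
  define w where "w y = (if \<phi> y = 0 \<or> \<phi> y = top then 0 else ennreal (enn2real (\<phi> y) powr (1 - p)))" for y
  have [measurable]: "w \<in> borel_measurable N"
    unfolding w_def by measurable
  define G where "G x = (\<integral>\<^sup>+y. F x y \<partial>N)" for x
  have [measurable]: "G \<in> borel_measurable borel"
    unfolding G_def by measurable
  define W where "W x = (\<integral>\<^sup>+y. ennreal_powr (F x y) p * w y \<partial>N)" for x
  have [measurable]: "W \<in> borel_measurable borel"
    unfolding W_def by measurable
  have \<phi>p: "(\<integral>\<^sup>+x. ennreal_powr (F x y) p \<partial>lborel) = ennreal_powr (\<phi> y) p" for y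
    using p by (simp add: \<phi>_def Lp_norm_powr)
  show ?thesis
  proof (cases "\<Phi> = top")
    case True
    then show ?thesis by (simp add: \<Phi>_def \<phi>_def)
  next
    case fin: False
    \<comment> \<open>Where \<open>\<phi>\<close> vanishes the quotient \<open>F / \<phi>\<close> is meaningless, but there \<open>F\<close> vanishes as well.\<close>
    have "AE y in N. \<phi> y \<noteq> top"
      using nn_integral_PInf_AE[of \<phi> N] fin by (simp add: \<Phi>_def)
    moreover have zero: "AE x in lborel. AE y in N. \<phi> y = 0 \<longrightarrow> F x y = 0"
    proof -
      have "AE y in N. AE x in lborel. \<phi> y = 0 \<longrightarrow> F x y = 0"
        by (rule AE_I2) (auto simp: \<phi>_def Lp_norm_eq_0_iff)
      then show ?thesis
        by (subst P.AE_commute) measurable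
    qed
    ultimately have good: "AE x in lborel. AE y in N. \<phi> y \<noteq> top \<and> (\<phi> y = 0 \<longrightarrow> F x y = 0)"
      by auto
    obtain r where r: "\<Phi> = ennreal r" "0 \<le> r" using fin by (cases \<Phi>) auto
    have W: "(\<integral>\<^sup>+x. W x \<partial>lborel) \<le> \<Phi>"
    proof -
      have "(\<integral>\<^sup>+x. W x \<partial>lborel) = (\<integral>\<^sup>+y. \<integral>\<^sup>+x. ennreal_powr (F x y) p * w y \<partial>lborel \<partial>N)"
        unfolding W_def by (subst P.Fubini') simp_all
      also have "\<dots> = (\<integral>\<^sup>+y. ennreal_powr (\<phi> y) p * w y \<partial>N)"
        by (intro nn_integral_cong) (subst nn_integral_multc, simp_all add: \<phi>p)
      also have "\<dots> \<le> \<Phi>"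
        unfolding \<Phi>_def
      proof (intro nn_integral_mono)
        fix y
        show "ennreal_powr (\<phi> y) p * w y \<le> \<phi> y"
        proof (cases "\<phi> y")
          case (real s)
          then show ?thesis
            by (cases "s = 0")
               (auto simp: w_def ennreal_powr_ennreal ennreal_mult[symmetric] powr_add[symmetric])
        qed simp
      qed
      finally show ?thesis .
    qed
    have key: "AE x in lborel. ennreal_powr (G x) p \<le> ennreal (r powr (p - 1)) * W x"
      using good
    proof eventually_elim
      case (elim x)
      have tan: "ennreal (p * l powr (p - 1)) * G x \<le> W x + ennreal ((p - 1) * l powr p) * \<Phi>"
        if "0 < l" for l
      proof -
        have "ennreal (p * l powr (p - 1)) * G x = (\<integral>\<^sup>+y. ennreal (p * l powr (p - 1)) * F x y \<partial>N)"
          unfolding G_def by (subst nn_integral_cmult) auto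
        also have "\<dots> \<le> (\<integral>\<^sup>+y. ennreal_powr (F x y) p * w y + ennreal ((p - 1) * l powr p) * \<phi> y \<partial>N)"
          using elim
        proof (intro nn_integral_mono_AE, eventually_elim)
          case (elim y)
          show ?case
          proof (cases "\<phi> y = 0")
            case True
            then show ?thesis using elim by simp
          next
            case False
            then obtain s where s: "\<phi> y = ennreal s" "0 < s"
              using elim by (cases "\<phi> y") (auto simp: less_le)
            then have w: "w y = ennreal (s powr (1 - p))" by (simp add: w_def)
            show ?thesis
            proof (cases "F x y")
              case (real a)
              have "p * l powr (p - 1) * a \<le> a powr p * s powr (1 - p) + (p - 1) * l powr p * s"
                using real s that p by (intro powr_tangent_le) auto
              then show ?thesis
                using real s w that p
                by (simp add: ennreal_powr_ennreal ennreal_mult[symmetric] ennreal_plus[symmetric]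
                    del: ennreal_plus)
            next
              case top
              then show ?thesis using w s by (simp add: ennreal_top_mult)
            qed
          qed
        qed
        also have "\<dots> = W x + ennreal ((p - 1) * l powr p) * \<Phi>"
          unfolding W_def \<Phi>_def by (subst nn_integral_add) (auto simp: nn_integral_cmult)
        finally show ?thesis .
      qed
      have Gle: "G x = 0" if "r = 0"
      proof -
        have "AE y in N. \<phi> y = 0"
          using that r nn_integral_0_iff_AE[of \<phi> N] by (simp add: \<Phi>_def)
        then have "AE y in N. F x y = 0" using elim by eventually_elim auto
        then show ?thesis unfolding G_def by (subst nn_integral_0_iff_AE) auto
      qed
      \<comment> \<open>The tangent point \<open>G(x) / \<Phi>\<close> is optimal; any positive one shows that \<open>W\<close> is infinite where \<open>G\<close> is.\<close>
      show ?case
      proof (cases "G x")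
        case (real g)
        show ?thesis
        proof (cases "g = 0")
          case True
          then show ?thesis using real by simp
        next
          case False
          with real Gle r have rg: "0 < r" "0 < g" by (auto simp: less_le)
          show ?thesis
          proof (cases "W x")
            case top
            then show ?thesis using rg by (simp add: ennreal_mult_top)
          next
            case W: (real v)
            have "ennreal (p * (g/r) powr (p - 1) * g) \<le> ennreal (v + (p - 1) * (g/r) powr p * r)"
              using tan[of "g/r"] rg real r W p
              by (simp add: ennreal_mult[symmetric] ennreal_plus[symmetric] del: ennreal_plus)
            then have "p * (g/r) powr (p - 1) * g \<le> v + (p - 1) * (g/r) powr p * r"
              using W p rg by (subst (asm) ennreal_le_iff) auto
            moreover have "p * (g/r) powr (p - 1) * g = p * (g powr p * r powr (1 - p))"
              using rg by (simp add: powr_divide powr_diff)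
            moreover have "(g/r) powr p * r = g powr p * r powr (1 - p)"
              using rg by (simp add: powr_divide powr_diff)
            ultimately have "g powr p * r powr (1 - p) \<le> v"
              by (simp only: left_diff_distrib mult.assoc)
            then have "r powr (p - 1) * (g powr p * r powr (1 - p)) \<le> r powr (p - 1) * v"
              by (intro mult_left_mono) auto
            moreover have "r powr (p - 1) * (g powr p * r powr (1 - p)) = g powr p"
              using rg by (simp add: powr_diff)
            ultimately show ?thesis
              using real W rg by (simp add: ennreal_powr_ennreal ennreal_mult[symmetric])
          qed
        qed
      next
        case top
        have "ennreal (p - 1) * ennreal r \<noteq> top" by (simp add: ennreal_mult_eq_top_iff)
        moreover have "top \<le> W x + ennreal (p - 1) * ennreal r"
          using tan[of 1] top r p by (simp add: ennreal_mult_top)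
        ultimately have "W x = top"
          by (simp add: top_unique)
        moreover have "r \<noteq> 0" using Gle top by auto
        ultimately show ?thesis using r by (simp add: ennreal_mult_top)
      qed
    qed
    have "(\<integral>\<^sup>+x. ennreal_powr (G x) p \<partial>lborel) \<le> ennreal (r powr (p - 1)) * \<Phi>"
    proof -
      have "(\<integral>\<^sup>+x. ennreal_powr (G x) p \<partial>lborel) \<le> (\<integral>\<^sup>+x. ennreal (r powr (p - 1)) * W x \<partial>lborel)"
        by (rule nn_integral_mono_AE[OF key])
      also have "\<dots> \<le> ennreal (r powr (p - 1)) * \<Phi>"
        by (simp add: nn_integral_cmult W mult_left_mono)
      finally show ?thesis .
    qed
    also have "\<dots> = ennreal_powr \<Phi> p"
      using r p by (cases "r = 0") (auto simp: ennreal_powr_ennreal ennreal_mult[symmetric] powr_diff)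
    finally have "Lp_norm p G \<le> ennreal_powr (ennreal_powr \<Phi> p) (1 / p)"
      unfolding Lp_norm_lborel using p by (intro ennreal_powr_mono) auto
    then show ?thesis
      using p by (simp add: ennreal_powr_cancel G_def[abs_def] \<Phi>_def \<phi>_def)
  qed
qed

text \<open>
  A sum of two functions is an integral over a two-point space.
\<close>
lemma Lp_norm_add_le:
  fixes f g :: "'a::euclidean_space \<Rightarrow> ennreal"
  assumes [measurable]: "f \<in> borel_measurable borel" "g \<in> borel_measurable borel" and "1 \<le> p"
  shows "Lp_norm p (\<lambda>x. f x + g x) \<le> Lp_norm p f + Lp_norm p g"
proof -
  have "case_prod (\<lambda>x b. if b then f x else g x) \<in> borel_measurable (borel \<Otimes>\<^sub>M count_space (UNIV :: bool set))"
    by measurable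
  from Lp_norm_nn_integral_le[OF _ this \<open>1 \<le> p\<close>] show ?thesis
    by (simp add: nn_integral_count_space_finite UNIV_bool add.commute sigma_finite_measure_count_space_finite)
qed

section \<open>The Hardy-Littlewood-Sobolev inequality on the line\<close>

lemma nn_integral_lborel_shift:
  fixes f :: "'a::euclidean_space \<Rightarrow> ennreal"
  assumes [measurable]: "f \<in> borel_measurable borel"
  shows "(\<integral>\<^sup>+x. f (x + y) \<partial>lborel) = (\<integral>\<^sup>+x. f x \<partial>lborel)"
proof -
  have "(\<integral>\<^sup>+x. f x \<partial>lborel) = (\<integral>\<^sup>+x. f x \<partial>distr lborel borel ((+) y))"
    by (simp add: lborel_distr_plus)
  also have "\<dots> = (\<integral>\<^sup>+x. f (x + y) \<partial>lborel)"
    by (simp add: nn_integral_distr add.commute)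
  finally show ?thesis by simp
qed

lemma nn_integral_lborel_uminus:
  fixes f :: "real \<Rightarrow> ennreal"
  assumes [measurable]: "f \<in> borel_measurable borel"
  shows "(\<integral>\<^sup>+x. f (- x) \<partial>lborel) = (\<integral>\<^sup>+x. f x \<partial>lborel)"
  using nn_integral_real_affine[OF assms, of "-1" 0] by simp

lemma nn_integral_lborel_reflect:
  fixes f :: "real \<Rightarrow> ennreal"
  assumes [measurable]: "f \<in> borel_measurable borel"
  shows "(\<integral>\<^sup>+y. f (x - y) \<partial>lborel) = (\<integral>\<^sup>+y. f y \<partial>lborel)"
  using nn_integral_real_affine[OF assms, of "-1" x] by simp

lemma nn_integral_lborel_even:
  fixes h :: "real \<Rightarrow> ennreal"
  assumes [measurable]: "h \<in> borel_measurable borel"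
  shows "(\<integral>\<^sup>+t. h \<bar>t\<bar> \<partial>lborel) = 2 * (\<integral>\<^sup>+t. h t * indicator {0<..} t \<partial>lborel)"
proof -
  have "(\<integral>\<^sup>+t. h \<bar>t\<bar> \<partial>lborel)
      = (\<integral>\<^sup>+t. h t * indicator {0<..} t + h (-t) * indicator {0<..} (-t) \<partial>lborel)"
    using AE_lborel_singleton[of "0::real"]
    by (intro nn_integral_cong_AE, eventually_elim) (auto simp: indicator_def abs_if)
  also have "\<dots> = (\<integral>\<^sup>+t. h t * indicator {0<..} t \<partial>lborel) + (\<integral>\<^sup>+t. h (-t) * indicator {0<..} (-t) \<partial>lborel)"
    by (rule nn_integral_add) auto
  also have "(\<integral>\<^sup>+t. h (-t) * indicator {0<..} (-t) \<partial>lborel) = (\<integral>\<^sup>+t. h t * indicator {0<..} t \<partial>lborel)"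
    by (rule nn_integral_lborel_uminus[of "\<lambda>t. h t * indicator {0<..} t"]) auto
  finally show ?thesis by (simp add: mult_2)
qed

lemma two_times_ennreal: "2 * ennreal x = ennreal (2 * x)"
  by (metis ennreal_mult' ennreal_numeral zero_le_numeral)

text \<open>
  The value at the origin matters because products of these kernels have to dominate \<open>|x - y|^(-2)\<close> also where
  \<open>x\<close> and \<open>y\<close> share a coordinate, and \<open>0 powr (- c)\<close> is \<open>0\<close>.
\<close>
definition riesz_kernel :: "real \<Rightarrow> real \<Rightarrow> ennreal" where
  "riesz_kernel c t = (if t = 0 then top else ennreal (\<bar>t\<bar> powr (- c)))"

lemma borel_measurable_riesz_kernel [measurable]: "riesz_kernel c \<in> borel_measurable borel"
  unfolding riesz_kernel_def[abs_def] by measurable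

lemma nn_integral_riesz_kernel_near:
  assumes "c < 1" "0 < r"
  shows "(\<integral>\<^sup>+t. riesz_kernel c t * indicator {-r<..<r} t \<partial>lborel) = ennreal (2 * r powr (1 - c) / (1 - c))"
proof -
  have "(\<integral>\<^sup>+t. riesz_kernel c t * indicator {-r<..<r} t \<partial>lborel)
      = (\<integral>\<^sup>+t. ennreal (\<bar>t\<bar> powr (- c)) * indicator {..<r} \<bar>t\<bar> \<partial>lborel)"
    using AE_lborel_singleton[of "0::real"]
    by (intro nn_integral_cong_AE, eventually_elim) (auto simp: indicator_def riesz_kernel_def)
  also have "\<dots> = 2 * (\<integral>\<^sup>+t. ennreal (t powr (- c)) * indicator {..<r} t * indicator {0<..} t \<partial>lborel)"
    by (subst nn_integral_lborel_even[of "\<lambda>t. ennreal (t powr (- c)) * indicator {..<r} t"]) auto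
  also have "(\<integral>\<^sup>+t. ennreal (t powr (- c)) * indicator {..<r} t * indicator {0<..} t \<partial>lborel)
      = (\<integral>\<^sup>+t. ennreal (if t \<in> {0..r} then t powr (- c) else 0) \<partial>lborel)"
    using AE_lborel_singleton[of "0::real"] AE_lborel_singleton[of r]
    by (intro nn_integral_cong_AE, eventually_elim) (auto simp: indicator_def)
  also have "\<dots> = ennreal (r powr (-c + 1) / (-c + 1))"
  proof (rule nn_integral_has_integral_lborel)
    show "((\<lambda>t. if t \<in> {0..r} then t powr (- c) else 0) has_integral r powr (- c + 1) / (- c + 1)) UNIV"
      using has_integral_powr_from_0[of "-c" r] assms by (subst has_integral_restrict_UNIV) auto
  qed auto
  also have "2 * \<dots> = ennreal (2 * (r powr (1 - c) / (1 - c)))"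
    by (simp add: two_times_ennreal)
  finally show ?thesis by simp
qed

lemma nn_integral_riesz_kernel_far:
  assumes "1 < c" "0 < r"
  shows "(\<integral>\<^sup>+t. ennreal (\<bar>t\<bar> powr (- c)) * indicator {r..} \<bar>t\<bar> \<partial>lborel) = ennreal (2 * r powr (1 - c) / (c - 1))"
proof -
  have "(\<integral>\<^sup>+t. ennreal (\<bar>t\<bar> powr (- c)) * indicator {r..} \<bar>t\<bar> \<partial>lborel)
      = 2 * (\<integral>\<^sup>+t. ennreal (t powr (- c)) * indicator {r..} t * indicator {0<..} t \<partial>lborel)"
    by (subst nn_integral_lborel_even[of "\<lambda>t. ennreal (t powr (- c)) * indicator {r..} t"]) auto
  also have "(\<integral>\<^sup>+t. ennreal (t powr (- c)) * indicator {r..} t * indicator {0<..} t \<partial>lborel)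
      = (\<integral>\<^sup>+t. ennreal (if t \<in> {r..} then t powr (- c) else 0) \<partial>lborel)"
    using assms by (intro nn_integral_cong) (auto simp: indicator_def)
  also have "\<dots> = ennreal (- (r powr (-c + 1)) / (-c + 1))"
  proof (rule nn_integral_has_integral_lborel)
    show "((\<lambda>t. if t \<in> {r..} then t powr (- c) else 0) has_integral - (r powr (- c + 1)) / (- c + 1)) UNIV"
      using has_integral_powr_to_inf[of "-c" r] assms by (subst has_integral_restrict_UNIV) auto
  qed auto
  also have "- (r powr (-c + 1)) / (-c + 1) = r powr (1 - c) / (c - 1)"
    using assms by (simp add: field_simps)
  also have "2 * ennreal (r powr (1 - c) / (c - 1)) = ennreal (2 * (r powr (1 - c) / (c - 1)))"
    by (simp add: two_times_ennreal)
  finally show ?thesis by simp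
qed

text \<open>
  Layer-cake representation of the square; the inequality holds for infinite \<open>h\<close> by truncation.
\<close>
lemma square_le_layers:
  "h * h \<le> (\<integral>\<^sup>+s. ennreal (2 * s) * (if 0 < s \<and> ennreal s < h then 1 else 0) \<partial>lborel)"
proof -
  have *: "ennreal (a\<^sup>2) \<le> (\<integral>\<^sup>+s. ennreal (2 * s) * (if 0 < s \<and> ennreal s < h then 1 else 0) \<partial>lborel)"
    if a: "0 \<le> a" "ennreal a \<le> h" for a
  proof -
    have "(\<integral>\<^sup>+s. ennreal (2 * s) * indicator {0..a} s \<partial>lborel) = ennreal (a\<^sup>2 - 0\<^sup>2)"
      using a by (intro nn_integral_FTC_Icc) (auto intro!: derivative_eq_intros)
    moreover have "(\<integral>\<^sup>+s. ennreal (2 * s) * indicator {0..a} s \<partial>lborel)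
      \<le> (\<integral>\<^sup>+s. ennreal (2 * s) * (if 0 < s \<and> ennreal s < h then 1 else 0) \<partial>lborel)"
      using AE_lborel_singleton[of "0::real"] AE_lborel_singleton[of a]
    proof (intro nn_integral_mono_AE, eventually_elim)
      case (elim s)
      show ?case
      proof (cases "s \<in> {0..a}")
        case True
        then have "0 < s" "ennreal s < ennreal a"
          using elim by (auto intro!: ennreal_lessI)
        then show ?thesis using a(2) by (auto simp: indicator_def)
      qed simp
    qed
    ultimately show ?thesis by simp
  qed
  show ?thesis
  proof (cases h)
    case (real r)
    then show ?thesis using *[of r] by (simp add: ennreal_mult[symmetric] power2_eq_square)
  next
    case top
    have "ennreal (real n) \<le> (\<integral>\<^sup>+s. ennreal (2 * s) * (if 0 < s \<and> ennreal s < h then 1 else 0) \<partial>lborel)" for n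
    proof -
      have "real n \<le> (real n)\<^sup>2"
        by (cases n) (auto simp: power2_eq_square)
      then have "ennreal (real n) \<le> ennreal ((real n)\<^sup>2)" by (rule ennreal_leI)
      also note *[of "real n"]
      finally show ?thesis using top by simp
    qed
    then have "(\<integral>\<^sup>+s. ennreal (2 * s) * (if 0 < s \<and> ennreal s < h then 1 else 0) \<partial>lborel) = top" (is "?I = top")
    proof (cases ?I)
      case (real r)
      obtain n where "r < real n" using reals_Archimedean2 by blast
      then show ?thesis using real \<open>\<And>n. ennreal (real n) \<le> ?I\<close>[of n] by simp
    qed simp
    then show ?thesis by simp
  qed
qed

text \<open>
  A direct proof of the strong-type bound. Let \<open>F\<close> be the potential of \<open>f\<close> and \<open>\<integral> f\<^sup>2 \<le> 1\<close>. To estimate the set where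
  \<open>F > t\<close>, write \<open>t = s powr (2/q)\<close>, split the kernel at the distance \<open>r\<close> proportional to \<open>s^(-2)\<close>, and split \<open>f\<close> at the height
  \<open>d s\<close>. The far part of the kernel contributes at most \<open>t/3\<close> by Cauchy-Schwarz; the near part contributes at most \<open>t/3\<close>
  from the values of \<open>f\<close> below \<open>d s\<close>, as the kernel is locally integrable. So the near potential of the values above \<open>d s\<close>
  exceeds \<open>t/3\<close>, and Markov's inequality bounds the measure of the set by \<open>1/(d s)\<close> times the integral of \<open>f\<close> over
  \<open>f > d s\<close>. The height is linear in \<open>s\<close>; hence integrating this bound against \<open>2 s ds\<close> produces \<open>\<integral> f\<^sup>2\<close> on the
  right and \<open>\<integral> F\<^sup>q\<close> on the left.
\<close>
lemma hardy_littlewood_sobolev_normalized: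
  assumes c: "1/2 < c" "c < 1"
  shows "\<exists>C>0. \<forall>f \<in> borel_measurable borel. (\<integral>\<^sup>+y. f y * f y \<partial>lborel) \<le> 1 \<longrightarrow>
    Lp_norm (1 / (c - 1/2)) (\<lambda>x. \<integral>\<^sup>+y. riesz_kernel c (x - y) * f y \<partial>lborel) \<le> ennreal C"
proof -
  define \<beta> where "\<beta> = 2 * c - 1"
  have \<beta>: "0 < \<beta>" "\<beta> < 1" using c by (auto simp: \<beta>_def)
  define q where "q = 1 / (c - 1/2)"
  have q: "0 < q" "q = 2 / \<beta>" using c by (auto simp: q_def \<beta>_def field_simps)
  \<comment> \<open>\<open>K\<close> makes the far contribution equal to \<open>t/3\<close>, and then \<open>d\<close> makes the low near contribution equal to \<open>t/3\<close>.\<close>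
  define K where "K = (18 / \<beta>) powr (1 / \<beta>)"
  have K: "0 < K" using \<beta> by (simp add: K_def)
  define d where "d = (1 - c) / (6 * K powr (1 - c))"
  have d: "0 < d" using c K by (simp add: d_def)
  define C where "C = (2 / d\<^sup>2) powr (1 / q)"
  show ?thesis
  proof (intro exI[of _ C] conjI ballI impI)
    show "0 < C" using d by (simp add: C_def)
    fix f :: "real \<Rightarrow> ennreal"
    assume f [measurable]: "f \<in> borel_measurable borel" and f1: "(\<integral>\<^sup>+y. f y * f y \<partial>lborel) \<le> 1"
    define F where "F x = (\<integral>\<^sup>+y. riesz_kernel c (x - y) * f y \<partial>lborel)" for x
    have [measurable]: "F \<in> borel_measurable borel"
      unfolding F_def by measurable
    define f' where "f' s y = (if ennreal (d * s) < f y then f y else 0)" for s y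
    have [measurable]: "f' s \<in> borel_measurable borel" for s
      unfolding f'_def by measurable
    have weak: "emeasure lborel {x. ennreal s < ennreal_powr (F x) (q / 2)}
        \<le> ennreal (1 / (d * s)) * (\<integral>\<^sup>+y. f' s y \<partial>lborel)" if s: "0 < s" for s
    proof -
      define t where "t = s powr \<beta>"
      define r where "r = K * s powr (-2)"
      have tr: "0 < t" "0 < r" using s K by (auto simp: t_def r_def)
      define near where "near u = riesz_kernel c u * indicator {-r<..<r} u" for u
      have [measurable]: "near \<in> borel_measurable borel"
        unfolding near_def by measurable
      define far where "far u = ennreal (\<bar>u\<bar> powr (- c)) * indicator {r..} \<bar>u\<bar>" for u
      have [measurable]: "far \<in> borel_measurable borel"
        unfolding far_def by measurable
      have near_int: "(\<integral>\<^sup>+u. near u \<partial>lborel) = ennreal (t / (3 * (d * s)))"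
      proof -
        have "r powr (1 - c) = K powr (1 - c) * s powr (\<beta> - 1)"
          using s K by (simp add: r_def powr_mult powr_powr \<beta>_def algebra_simps)
        then have "2 * r powr (1 - c) / (1 - c) = t / (3 * (d * s))"
        proof -
          have alg: "2 * (P * (t / s)) / e = t / (3 * (e / (6 * P) * s))" if "0 < P" "0 < e" for P e :: real
            using that s by (simp add: field_simps)
          have "s powr (\<beta> - 1) = t / s" using s by (simp add: t_def powr_diff)
          then show ?thesis
            using alg[of "K powr (1 - c)" "1 - c"] K c \<open>r powr (1 - c) = _\<close> by (simp only: d_def) simp
        qed
        then show ?thesis
          unfolding near_def using nn_integral_riesz_kernel_near[OF c(2) tr(2)] by simp
      qed
      have far_int: "(\<integral>\<^sup>+u. far u * far u \<partial>lborel) = ennreal ((t / 3)\<^sup>2)"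
      proof -
        have "(\<integral>\<^sup>+u. far u * far u \<partial>lborel) = (\<integral>\<^sup>+u. ennreal (\<bar>u\<bar> powr (- (2 * c))) * indicator {r..} \<bar>u\<bar> \<partial>lborel)"
          by (intro nn_integral_cong)
            (auto simp: far_def indicator_def ennreal_mult[symmetric] powr_add[symmetric])
        also have "\<dots> = ennreal (2 * r powr (1 - 2 * c) / (2 * c - 1))"
          using c tr by (intro nn_integral_riesz_kernel_far) auto
        also have "2 * r powr (1 - 2 * c) / (2 * c - 1) = (t / 3)\<^sup>2"
        proof -
          have "r powr (1 - 2 * c) = K powr (- \<beta>) * s powr (2 * \<beta>)"
            using s K by (simp add: r_def powr_mult powr_powr \<beta>_def algebra_simps)
          also have "K powr (- \<beta>) = \<beta> / 18"
            using \<beta> by (simp add: K_def powr_powr powr_minus)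
          also have "s powr (2 * \<beta>) = t\<^sup>2"
            using s by (simp add: t_def power2_eq_square powr_add[symmetric])
          finally have "r powr (1 - 2 * c) = \<beta> / 18 * t\<^sup>2" .
          then have "2 * r powr (1 - 2 * c) / \<beta> = 2 * (\<beta> / 18 * t\<^sup>2) / \<beta>" by (simp only:)
          also have "\<dots> = (t / 3)\<^sup>2" using \<beta> by (simp add: power2_eq_square)
          finally show ?thesis by (simp add: \<beta>_def)
        qed
        finally show ?thesis .
      qed
      have far_le: "(\<integral>\<^sup>+y. far (x - y) * f y \<partial>lborel) \<le> ennreal (t / 3)" for x
      proof -
        have "(\<integral>\<^sup>+y. far (x - y) * f y \<partial>lborel)\<^sup>2 \<le> (\<integral>\<^sup>+y. (far (x - y))\<^sup>2 \<partial>lborel) * (\<integral>\<^sup>+y. (f y)\<^sup>2 \<partial>lborel)"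
          by (rule Cauchy_Schwarz_nn_integral) auto
        also have "(\<integral>\<^sup>+y. (far (x - y))\<^sup>2 \<partial>lborel) = ennreal ((t / 3)\<^sup>2)"
          using nn_integral_lborel_reflect[of "\<lambda>u. far u * far u" x] far_int
          by (simp add: power2_eq_square)
        also have "\<dots> * (\<integral>\<^sup>+y. (f y)\<^sup>2 \<partial>lborel) \<le> ennreal ((t / 3)\<^sup>2) * 1"
          using f1 by (intro mult_left_mono) (auto simp: power2_eq_square)
        also have "\<dots> = (ennreal (t / 3))\<^sup>2"
          using tr by (simp add: ennreal_power)
        finally have "(\<integral>\<^sup>+y. far (x - y) * f y \<partial>lborel)\<^sup>2 \<le> (ennreal (t / 3))\<^sup>2" .
        then show ?thesis
          using tr by (cases "\<integral>\<^sup>+y. far (x - y) * f y \<partial>lborel")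
            (auto simp: ennreal_power ennreal_top_mult top_power_ennreal top_unique intro: power2_le_imp_le)
      qed
      have low_le: "(\<integral>\<^sup>+y. near (x - y) * min (f y) (ennreal (d * s)) \<partial>lborel) \<le> ennreal (t / 3)" for x
      proof -
        have "(\<integral>\<^sup>+y. near (x - y) * min (f y) (ennreal (d * s)) \<partial>lborel)
            \<le> (\<integral>\<^sup>+y. near (x - y) * ennreal (d * s) \<partial>lborel)"
          by (intro nn_integral_mono mult_left_mono) auto
        also have "\<dots> = ennreal (t / (3 * (d * s))) * ennreal (d * s)"
          by (subst nn_integral_multc) (simp_all add: near_int nn_integral_lborel_reflect[of near])
        also have "\<dots> = ennreal (t / 3)"
          using tr d s by (simp add: ennreal_mult[symmetric])
        finally show ?thesis .
      qed
      define H where "H x = (\<integral>\<^sup>+y. near (x - y) * f' s y \<partial>lborel)" for x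
      have [measurable]: "H \<in> borel_measurable borel"
        unfolding H_def by measurable
      have F_le: "F x \<le> ennreal (t / 3) + ennreal (t / 3) + H x" for x
      proof -
        have "F x \<le> (\<integral>\<^sup>+y. (far (x - y) * f y + near (x - y) * min (f y) (ennreal (d * s)))
                 + near (x - y) * f' s y \<partial>lborel)"
          unfolding F_def
        proof (intro nn_integral_mono)
          fix y
          show "riesz_kernel c (x - y) * f y \<le> (far (x - y) * f y + near (x - y) * min (f y) (ennreal (d * s)))
                 + near (x - y) * f' s y"
          proof (cases "\<bar>x - y\<bar> < r")
            case True
            then have "near (x - y) = riesz_kernel c (x - y)"
              by (auto simp: near_def indicator_def)
            then have "riesz_kernel c (x - y) * f y
                \<le> near (x - y) * min (f y) (ennreal (d * s)) + near (x - y) * f' s y"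
              by (cases "ennreal (d * s) < f y") (simp_all add: f'_def min_def not_less)
            then show ?thesis by (simp add: add.assoc add_increasing)
          next
            case False
            then have "far (x - y) = riesz_kernel c (x - y)"
              using tr by (auto simp: far_def riesz_kernel_def)
            then show ?thesis by (simp add: add.assoc)
          qed
        qed
        also have "\<dots> = (\<integral>\<^sup>+y. far (x - y) * f y \<partial>lborel)
            + (\<integral>\<^sup>+y. near (x - y) * min (f y) (ennreal (d * s)) \<partial>lborel) + H x"
          unfolding H_def by (subst nn_integral_add, simp, simp, subst nn_integral_add) auto
        also have "\<dots> \<le> ennreal (t / 3) + ennreal (t / 3) + H x"
          by (intro add_mono far_le low_le order_refl)
        finally show ?thesis .
      qed
      have H_int: "(\<integral>\<^sup>+x. H x \<partial>lborel) = ennreal (t / (3 * (d * s))) * (\<integral>\<^sup>+y. f' s y \<partial>lborel)"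
      proof -
        have "(\<integral>\<^sup>+x. H x \<partial>lborel) = (\<integral>\<^sup>+y. \<integral>\<^sup>+x. near (x - y) * f' s y \<partial>lborel \<partial>lborel)"
          unfolding H_def by (rule lborel_pair.Fubini') measurable
        also have "\<dots> = (\<integral>\<^sup>+y. ennreal (t / (3 * (d * s))) * f' s y \<partial>lborel)"
          using nn_integral_lborel_shift[of near "- y" for y]
          by (intro nn_integral_cong, subst nn_integral_multc) (simp_all add: near_int)
        also have "\<dots> = ennreal (t / (3 * (d * s))) * (\<integral>\<^sup>+y. f' s y \<partial>lborel)"
          by (rule nn_integral_cmult) simp
        finally show ?thesis .
      qed
      have "emeasure lborel {x. ennreal s < ennreal_powr (F x) (q / 2)}
          \<le> emeasure lborel {x \<in> space lborel. 1 \<le> ennreal (3 / t) * H x}"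
      proof (intro emeasure_mono subsetI CollectI)
        fix x assume "x \<in> {x. ennreal s < ennreal_powr (F x) (q / 2)}"
        then have 1: "ennreal s < ennreal_powr (F x) (q / 2)" by simp
        have "ennreal t < F x"
        proof (rule ccontr)
          assume "\<not> ennreal t < F x"
          then have "ennreal_powr (F x) (q / 2) \<le> ennreal_powr (ennreal t) (q / 2)"
            using q by (intro ennreal_powr_mono) auto
          also have "\<dots> = ennreal s"
            using tr s q \<beta> by (simp add: ennreal_powr_ennreal t_def powr_powr)
          finally show False using 1 by simp
        qed
        then have "ennreal t < ennreal (t / 3) + ennreal (t / 3) + H x"
          using F_le[of x] by (rule less_le_trans)
        then have "ennreal (t / 3) \<le> H x"
          using tr by (cases "H x")
            (auto simp: ennreal_plus[symmetric] ennreal_less_iff simp del: ennreal_plus)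
        then have "ennreal (3 / t) * ennreal (t / 3) \<le> ennreal (3 / t) * H x"
          by (rule mult_left_mono) simp
        then show "x \<in> space lborel \<and> 1 \<le> ennreal (3 / t) * H x"
          using tr by (simp add: ennreal_mult[symmetric])
      qed simp
      also have "\<dots> \<le> ennreal (3 / t) * (\<integral>\<^sup>+x. H x * indicator (space lborel) x \<partial>lborel)"
        using nn_integral_Markov_inequality[of H "space lborel" lborel "ennreal (3 / t)"] by simp
      also have "\<dots> = ennreal (3 / t) * (ennreal (t / (3 * (d * s))) * (\<integral>\<^sup>+y. f' s y \<partial>lborel))"
        by (simp add: H_int)
      also have "\<dots> = ennreal (1 / (d * s)) * (\<integral>\<^sup>+y. f' s y \<partial>lborel)"
        using tr s d by (simp add: mult.assoc[symmetric] ennreal_mult[symmetric])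
      finally show ?thesis .
    qed
    have "(\<integral>\<^sup>+x. ennreal_powr (F x) q \<partial>lborel)
        = (\<integral>\<^sup>+x. ennreal_powr (F x) (q / 2) * ennreal_powr (F x) (q / 2) \<partial>lborel)"
      by (simp add: ennreal_powr_add[symmetric])
    also have "\<dots> \<le> (\<integral>\<^sup>+x. \<integral>\<^sup>+s. ennreal (2 * s) *
        (if 0 < s \<and> ennreal s < ennreal_powr (F x) (q / 2) then 1 else 0) \<partial>lborel \<partial>lborel)"
      by (intro nn_integral_mono square_le_layers)
    also have "\<dots> = (\<integral>\<^sup>+s. \<integral>\<^sup>+x. ennreal (2 * s) *
        (if 0 < s \<and> ennreal s < ennreal_powr (F x) (q / 2) then 1 else 0) \<partial>lborel \<partial>lborel)"
      by (rule lborel_pair.Fubini') measurable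
    also have "\<dots> \<le> (\<integral>\<^sup>+s. \<integral>\<^sup>+y. ennreal (2 / d) * (f' s y * indicator {0<..} s) \<partial>lborel \<partial>lborel)"
    proof (rule nn_integral_mono)
      fix s :: real
      show "(\<integral>\<^sup>+x. ennreal (2 * s) * (if 0 < s \<and> ennreal s < ennreal_powr (F x) (q / 2) then 1 else 0) \<partial>lborel)
        \<le> (\<integral>\<^sup>+y. ennreal (2 / d) * (f' s y * indicator {0<..} s) \<partial>lborel)"
      proof (cases "0 < s")
        case True
        have "(\<integral>\<^sup>+x. ennreal (2 * s) * (if 0 < s \<and> ennreal s < ennreal_powr (F x) (q / 2) then 1 else 0) \<partial>lborel)
          = (\<integral>\<^sup>+x. ennreal (2 * s) * indicator {x. ennreal s < ennreal_powr (F x) (q / 2)} x \<partial>lborel)"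
          using True by (intro nn_integral_cong) (auto simp: indicator_def)
        also have "\<dots> = ennreal (2 * s) * emeasure lborel {x. ennreal s < ennreal_powr (F x) (q / 2)}"
          by (rule nn_integral_cmult_indicator) measurable
        also have "\<dots> \<le> ennreal (2 * s) * (ennreal (1 / (d * s)) * (\<integral>\<^sup>+y. f' s y \<partial>lborel))"
          by (intro mult_left_mono weak True) simp
        also have "\<dots> = ennreal (2 / d) * (\<integral>\<^sup>+y. f' s y \<partial>lborel)"
          using True d by (simp add: mult.assoc[symmetric] ennreal_mult[symmetric])
        also have "\<dots> = (\<integral>\<^sup>+y. ennreal (2 / d) * (f' s y * indicator {0<..} s) \<partial>lborel)"
          using True by (simp add: nn_integral_cmult)
        finally show ?thesis .
      qed simp
    qed
    also have "\<dots> = (\<integral>\<^sup>+y. \<integral>\<^sup>+s. ennreal (2 / d) * (f' s y * indicator {0<..} s) \<partial>lborel \<partial>lborel)"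
      unfolding f'_def by (rule lborel_pair.Fubini') measurable
    also have "\<dots> \<le> (\<integral>\<^sup>+y. ennreal (2 / d\<^sup>2) * (f y * f y) \<partial>lborel)"
    proof (intro nn_integral_mono)
      fix y
      show "(\<integral>\<^sup>+s. ennreal (2 / d) * (f' s y * indicator {0<..} s) \<partial>lborel) \<le> ennreal (2 / d\<^sup>2) * (f y * f y)"
      proof (cases "f y")
        case (real a)
        have "(\<integral>\<^sup>+s. ennreal (2 / d) * (f' s y * indicator {0<..} s) \<partial>lborel)
            = (\<integral>\<^sup>+s. ennreal (2 / d * a) * indicator {0<..<a / d} s \<partial>lborel)"
          using real d
          by (intro nn_integral_cong)
            (auto simp: f'_def indicator_def ennreal_mult[symmetric] ennreal_less_iff field_simps)
        also have "\<dots> = ennreal (2 / d * a) * ennreal (a / d)"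
          using real d by (subst nn_integral_cmult_indicator) auto
        also have "\<dots> = ennreal (2 / d\<^sup>2) * (f y * f y)"
          using real d by (simp add: ennreal_mult[symmetric] power2_eq_square)
        finally show ?thesis by simp
      next
        case top
        then show ?thesis using d by (simp add: ennreal_mult_top)
      qed
    qed
    also have "\<dots> = ennreal (2 / d\<^sup>2) * (\<integral>\<^sup>+y. f y * f y \<partial>lborel)"
      by (rule nn_integral_cmult) simp
    also have "\<dots> \<le> ennreal (2 / d\<^sup>2) * 1"
      by (intro mult_left_mono f1) simp
    finally have "Lp_norm q F \<le> ennreal_powr (ennreal (2 / d\<^sup>2)) (1 / q)"
      unfolding Lp_norm_lborel using q by (intro ennreal_powr_mono) auto
    then show "Lp_norm (1 / (c - 1/2)) (\<lambda>x. \<integral>\<^sup>+y. riesz_kernel c (x - y) * f y \<partial>lborel) \<le> ennreal C"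
      by (simp add: C_def ennreal_powr_ennreal q_def[symmetric] F_def[abs_def])
  qed
qed

definition conv_bounded :: "real \<Rightarrow> (real \<Rightarrow> ennreal) \<Rightarrow> real \<Rightarrow> bool" where
  "conv_bounded q k C \<longleftrightarrow> k \<in> borel_measurable borel \<and> 0 \<le> C \<and>
     (\<forall>f \<in> borel_measurable borel. Lp_norm q (\<lambda>x. \<integral>\<^sup>+y. k (x - y) * f y \<partial>lborel) \<le> ennreal C * Lp_norm 2 f)"

text \<open>
  Both sides are homogeneous of degree one in \<open>f\<close>, so normalizing \<open>f\<close> loses nothing.
\<close>
lemma hardy_littlewood_sobolev:
  assumes c: "1/2 < c" "c < 1"
  shows "\<exists>C>0. conv_bounded (1 / (c - 1/2)) (riesz_kernel c) C"
proof -
  obtain C where C0: "0 < C" and C: "\<forall>f \<in> borel_measurable borel. (\<integral>\<^sup>+y. f y * f y \<partial>lborel) \<le> 1 \<longrightarrow>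
    Lp_norm (1 / (c - 1/2)) (\<lambda>x. \<integral>\<^sup>+y. riesz_kernel c (x - y) * f y \<partial>lborel) \<le> ennreal C"
    using hardy_littlewood_sobolev_normalized[OF c] by (elim exE conjE)
  have "conv_bounded (1 / (c - 1/2)) (riesz_kernel c) C"
    unfolding conv_bounded_def
  proof (intro conjI ballI)
    fix f :: "real \<Rightarrow> ennreal" assume f [measurable]: "f \<in> borel_measurable borel"
    let ?T = "\<lambda>f x. \<integral>\<^sup>+y. riesz_kernel c (x - y) * f y \<partial>lborel"
    show "Lp_norm (1 / (c - 1/2)) (?T f) \<le> ennreal C * Lp_norm 2 f"
    proof (cases "Lp_norm 2 f")
      case (real a)
      show ?thesis
      proof (cases "a = 0")
        case True
        then have "AE y in lborel. f y = 0" using real f by (simp add: Lp_norm_eq_0_iff)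
        then have "?T f x = 0" for x
          by (subst nn_integral_0_iff_AE) auto
        then show ?thesis by (simp add: Lp_norm_lborel)
      next
        case False
        then have a: "0 < a" using real by simp
        define g where "g y = ennreal (1 / a) * f y" for y
        have [measurable]: "g \<in> borel_measurable borel" unfolding g_def by measurable
        have "(\<integral>\<^sup>+y. f y * f y \<partial>lborel) = ennreal (a * a)"
          using Lp_norm_powr[of 2 f] real by (simp add: ennreal_powr_two ennreal_mult)
        moreover have "(\<integral>\<^sup>+y. g y * g y \<partial>lborel) = ennreal (1 / (a * a)) * (\<integral>\<^sup>+y. f y * f y \<partial>lborel)"
        proof -
          have "g y * g y = ennreal (1 / (a * a)) * (f y * f y)" for y
          proof -
            have "g y * g y = (ennreal (1 / a) * ennreal (1 / a)) * (f y * f y)"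
              by (simp add: g_def mult_ac)
            also have "ennreal (1 / a) * ennreal (1 / a) = ennreal (1 / (a * a))"
              using a by (simp add: ennreal_mult[symmetric])
            finally show ?thesis .
          qed
          then show ?thesis by (simp add: nn_integral_cmult)
        qed
        ultimately have "(\<integral>\<^sup>+y. g y * g y \<partial>lborel) \<le> 1"
          using a by (simp add: ennreal_mult[symmetric])
        then have g: "Lp_norm (1 / (c - 1/2)) (?T g) \<le> ennreal C" using C by simp
        have fg: "f y = ennreal a * g y" for y
          using a by (simp add: g_def mult.assoc[symmetric] ennreal_mult[symmetric])
        have "?T f x = ennreal a * ?T g x" for x
          by (subst nn_integral_cmult[symmetric]) (auto simp: fg mult_ac)
        then have "Lp_norm (1 / (c - 1/2)) (?T f) = ennreal a * Lp_norm (1 / (c - 1/2)) (?T g)"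
          using c by (simp add: Lp_norm_cmult)
        also have "\<dots> \<le> ennreal a * ennreal C" by (intro mult_left_mono g) simp
        finally show ?thesis using real by (simp add: mult.commute)
      qed
    next
      case top
      then show ?thesis using C0 by (simp add: ennreal_mult_top)
    qed
  qed (use C0 in auto)
  with C0 show ?thesis by (intro exI conjI)
qed

lemma conv_bounded_mono:
  assumes "conv_bounded q k C" and [measurable]: "k' \<in> borel_measurable borel"
    and le: "\<And>t. k' t \<le> ennreal a * k t" and "0 \<le> a" "0 < q"
  shows "conv_bounded q k' (a * C)"
  unfolding conv_bounded_def
proof (intro conjI ballI)
  have C: "0 \<le> C" and [measurable]: "k \<in> borel_measurable borel"
    using assms(1) by (auto simp: conv_bounded_def)
  show "0 \<le> a * C" using C assms by simp
  fix f :: "real \<Rightarrow> ennreal" assume f [measurable]: "f \<in> borel_measurable borel"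
  have "Lp_norm q (\<lambda>x. \<integral>\<^sup>+y. k' (x - y) * f y \<partial>lborel)
      \<le> Lp_norm q (\<lambda>x. ennreal a * (\<integral>\<^sup>+y. k (x - y) * f y \<partial>lborel))"
  proof (intro Lp_norm_mono)
    fix x
    have "(\<integral>\<^sup>+y. k' (x - y) * f y \<partial>lborel) \<le> (\<integral>\<^sup>+y. ennreal a * k (x - y) * f y \<partial>lborel)"
      by (intro nn_integral_mono mult_right_mono le) simp
    also have "\<dots> = ennreal a * (\<integral>\<^sup>+y. k (x - y) * f y \<partial>lborel)"
      by (simp add: mult.assoc nn_integral_cmult)
    finally show "(\<integral>\<^sup>+y. k' (x - y) * f y \<partial>lborel) \<le> ennreal a * (\<integral>\<^sup>+y. k (x - y) * f y \<partial>lborel)" .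
  qed fact
  also have "\<dots> = ennreal a * Lp_norm q (\<lambda>x. (\<integral>\<^sup>+y. k (x - y) * f y \<partial>lborel))"
    using assms by (intro Lp_norm_cmult) auto
  also have "\<dots> \<le> ennreal a * (ennreal C * Lp_norm 2 f)"
    using assms(1) f by (intro mult_left_mono) (auto simp: conv_bounded_def)
  finally show "Lp_norm q (\<lambda>x. \<integral>\<^sup>+y. k' (x - y) * f y \<partial>lborel) \<le> ennreal (a * C) * Lp_norm 2 f"
    using assms C by (simp add: ennreal_mult mult.assoc)
qed fact

text \<open>
  The \<open>L\<^sup>2\<close> norm is translation invariant, and the convolution is an average of translates.
\<close>
lemma conv_bounded_L1:
  assumes [measurable]: "k \<in> borel_measurable borel" and "(\<integral>\<^sup>+t. k t \<partial>lborel) = ennreal C" "0 \<le> C"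
  shows "conv_bounded 2 k C"
  unfolding conv_bounded_def
proof (intro conjI ballI)
  fix f :: "real \<Rightarrow> ennreal" assume f [measurable]: "f \<in> borel_measurable borel"
  have "(\<integral>\<^sup>+y. k (x - y) * f y \<partial>lborel) = (\<integral>\<^sup>+y. k y * f (x - y) \<partial>lborel)" for x
    using nn_integral_lborel_reflect[of "\<lambda>y. k y * f (x - y)" x] by simp
  then have "Lp_norm 2 (\<lambda>x. \<integral>\<^sup>+y. k (x - y) * f y \<partial>lborel) = Lp_norm 2 (\<lambda>x. \<integral>\<^sup>+y. k y * f (x - y) \<partial>lborel)"
    by simp
  also have "\<dots> \<le> (\<integral>\<^sup>+y. Lp_norm 2 (\<lambda>x. k y * f (x - y)) \<partial>lborel)"
    by (rule Lp_norm_nn_integral_le) (auto simp: lborel.sigma_finite_measure_axioms)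
  also have "\<dots> = (\<integral>\<^sup>+y. k y * Lp_norm 2 f \<partial>lborel)"
  proof (intro nn_integral_cong)
    fix y
    have "Lp_norm 2 (\<lambda>x. k y * f (x - y)) = k y * Lp_norm 2 (\<lambda>x. f (x - y))"
      by (intro Lp_norm_cmult) auto
    also have "Lp_norm 2 (\<lambda>x. f (x - y)) = Lp_norm 2 f"
      using nn_integral_lborel_shift[of "\<lambda>x. ennreal_powr (f x) 2" "-y"] by (simp add: Lp_norm_lborel)
    finally show "Lp_norm 2 (\<lambda>x. k y * f (x - y)) = k y * Lp_norm 2 f" .
  qed
  also have "\<dots> = ennreal C * Lp_norm 2 f"
    using assms by (subst nn_integral_multc) auto
  finally show "Lp_norm 2 (\<lambda>x. \<integral>\<^sup>+y. k (x - y) * f y \<partial>lborel) \<le> ennreal C * Lp_norm 2 f" .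
qed fact+

definition truncated_riesz :: "real \<Rightarrow> real \<Rightarrow> real \<Rightarrow> ennreal" where
  "truncated_riesz c R t = riesz_kernel c t * indicator {-R<..<R} t"

lemma borel_measurable_truncated_riesz [measurable]: "truncated_riesz c R \<in> borel_measurable borel"
  unfolding truncated_riesz_def[abs_def] by measurable

text \<open>
  The exponent of \<open>R\<close> is dictated by scaling. If \<open>q > 2\<close>, then within the cutoff \<open>|t|^(-c)\<close> is at most
  \<open>R powr (e - c) * |t|^(-e)\<close> for the critical exponent \<open>e = 1/2 + 1/q\<close>. If \<open>q = 2\<close>, the critical kernel \<open>1/|t|\<close> is not
  locally integrable, and \<open>c < 1\<close> is what makes the truncated kernel integrable.
\<close>
lemma truncated_riesz_conv_bounded:
  assumes q: "2 \<le> q" and c: "0 \<le> c" "c \<le> 1/2 + 1/q" "c < 1"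
  obtains C where "0 < C" "\<And>R. 0 < R \<Longrightarrow> conv_bounded q (truncated_riesz c R) (C * R powr (1/2 + 1/q - c))"
proof (cases "q = 2")
  case True
  show ?thesis
  proof
    show "0 < 2 / (1 - c)" using c by simp
    fix R :: real assume "0 < R"
    then show "conv_bounded q (truncated_riesz c R) (2 / (1 - c) * R powr (1/2 + 1/q - c))"
      unfolding True using c nn_integral_riesz_kernel_near[of c R]
      by (intro conv_bounded_L1) (auto simp: truncated_riesz_def)
  qed
next
  case False
  define e where "e = 1/2 + 1/q"
  have e: "1/2 < e" "e < 1" "q = 1 / (e - 1/2)" using q False by (auto simp: e_def field_simps)
  obtain C where C: "0 < C" "conv_bounded q (riesz_kernel e) C"
    using hardy_littlewood_sobolev[OF e(1,2)] unfolding e(3)[symmetric] by (elim exE conjE)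
  show ?thesis
  proof
    show "0 < C" by fact
    fix R :: real assume R: "0 < R"
    have "conv_bounded q (truncated_riesz c R) (R powr (e - c) * C)"
    proof (rule conv_bounded_mono[OF C(2)])
      fix t
      show "truncated_riesz c R t \<le> ennreal (R powr (e - c)) * riesz_kernel e t"
      proof (cases "t = 0 \<or> R \<le> \<bar>t\<bar>")
        case True
        then show ?thesis using R
          by (auto simp: truncated_riesz_def riesz_kernel_def indicator_def ennreal_mult_top)
      next
        case False
        have "\<bar>t\<bar> powr (- c) = \<bar>t\<bar> powr (e - c) * \<bar>t\<bar> powr (- e)"
          by (simp add: powr_add[symmetric])
        also have "\<dots> \<le> R powr (e - c) * \<bar>t\<bar> powr (- e)"
          using False c by (intro mult_right_mono powr_mono2) (auto simp: e_def)
        finally show ?thesis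
          using False by (auto simp: truncated_riesz_def riesz_kernel_def indicator_def ennreal_mult[symmetric])
      qed
    qed (use q in auto)
    then show "conv_bounded q (truncated_riesz c R) (C * R powr (1/2 + 1/q - c))"
      by (simp add: e_def mult.commute)
  qed
qed

section \<open>Mixed norms in three variables\<close>

lemma vector_3_eq_axis: "(vector [x1, x2, x3] :: real ^ 3) = x1 *\<^sub>R axis 1 1 + x2 *\<^sub>R axis 2 1 + x3 *\<^sub>R axis 3 1"
  unfolding vec_eq_iff forall_3 by (simp add: axis_def)

lemma borel_measurable_vector_3 [measurable (raw)]:
  fixes f g h :: "'a \<Rightarrow> real"
  assumes [measurable]: "f \<in> borel_measurable M" "g \<in> borel_measurable M" "h \<in> borel_measurable M"
  shows "(\<lambda>x. vector [f x, g x, h x] :: real ^ 3) \<in> borel_measurable M"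
  unfolding vector_3_eq_axis
  by (intro borel_measurable_add borel_measurable_scaleR assms) auto

lemma sigma_finite_lborel_pair: "sigma_finite_measure (lborel \<Otimes>\<^sub>M lborel :: (real \<times> real) measure)"
  by (simp add: lborel_prod sigma_finite_lborel)

text \<open>
  The coordinates are listed with the third one first, because it is the outermost variable of the mixed norm.
\<close>
lemma lborel_vector_3:
  "(lborel :: (real ^ 3) measure) = distr (lborel \<Otimes>\<^sub>M (lborel \<Otimes>\<^sub>M lborel)) borel (\<lambda>(x3, x2, x1). vector [x1, x2, x3])"
proof (rule lborel_eqI)
  fix l u :: "real ^ 3"
  assume le: "\<And>b. b \<in> Basis \<Longrightarrow> l \<bullet> b \<le> u \<bullet> b"
  have le': "l $ i \<le> u $ i" for i
    using le[of "axis i 1"] by (auto simp: Basis_vec_def inner_axis)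
  have pre: "(\<lambda>(x3, x2, x1). vector [x1, x2, x3] :: real ^ 3) -` box l u \<inter> space (lborel \<Otimes>\<^sub>M (lborel \<Otimes>\<^sub>M lborel))
      = {l $ 3<..<u $ 3} \<times> ({l $ 2<..<u $ 2} \<times> {l $ 1<..<u $ 1})"
    by (auto simp: mem_box_cart forall_3 space_pair_measure)
  have "emeasure (distr (lborel \<Otimes>\<^sub>M (lborel \<Otimes>\<^sub>M lborel)) borel (\<lambda>(x3, x2, x1). vector [x1, x2, x3])) (box l u)
      = emeasure (lborel \<Otimes>\<^sub>M (lborel \<Otimes>\<^sub>M lborel)) ({l $ 3<..<u $ 3} \<times> ({l $ 2<..<u $ 2} \<times> {l $ 1<..<u $ 1}))"
    by (subst emeasure_distr) (auto simp: pre)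
  also have "\<dots> = ennreal (u $ 3 - l $ 3) * (ennreal (u $ 2 - l $ 2) * ennreal (u $ 1 - l $ 1))"
    using le'
    by (subst sigma_finite_measure.emeasure_pair_measure_Times[OF sigma_finite_lborel_pair])
      (simp_all add: lborel.emeasure_pair_measure_Times)
  also have "\<dots> = ennreal (\<Prod>b\<in>Basis. (u - l) \<bullet> b)"
  proof -
    have "(\<Prod>b\<in>(Basis::(real^3) set). (u - l) \<bullet> b) = (\<Prod>i\<in>UNIV. (u - l) $ i)"
      by (subst prod.reindex_bij_betw[symmetric, where h="\<lambda>i. axis i (1::real)" and S=UNIV])
        (auto simp: bij_betw_def inj_on_def axis_eq_axis Basis_vec_def inner_axis)
    also have "\<dots> = (u $ 1 - l $ 1) * (u $ 2 - l $ 2) * (u $ 3 - l $ 3)"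
      unfolding UNIV_3 by simp
    also have "\<dots> = (u $ 3 - l $ 3) * ((u $ 2 - l $ 2) * (u $ 1 - l $ 1))"
      by (simp only: mult_ac)
    finally show ?thesis using le' by (simp add: ennreal_mult)
  qed
  finally show "emeasure (distr (lborel \<Otimes>\<^sub>M (lborel \<Otimes>\<^sub>M lborel)) borel (\<lambda>(x3, x2, x1). vector [x1, x2, x3])) (box l u)
    = ennreal (\<Prod>b\<in>Basis. (u - l) \<bullet> b)" .
qed simp

lemma pair_sigma_finite_lborel_3:
  "pair_sigma_finite (lborel :: real measure) (lborel \<Otimes>\<^sub>M lborel :: (real \<times> real) measure)"
  by (simp add: lborel_prod pair_sigma_finite_def sigma_finite_lborel)

lemma nn_integral_vector_3:
  fixes f :: "real ^ 3 \<Rightarrow> ennreal"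
  assumes [measurable]: "f \<in> borel_measurable borel"
  shows "(\<integral>\<^sup>+x. f x \<partial>lborel) = (\<integral>\<^sup>+x3. \<integral>\<^sup>+x2. \<integral>\<^sup>+x1. f (vector [x1, x2, x3]) \<partial>lborel \<partial>lborel \<partial>lborel)"
proof -
  interpret P: pair_sigma_finite "lborel :: real measure" "lborel \<Otimes>\<^sub>M lborel :: (real \<times> real) measure"
    by (rule pair_sigma_finite_lborel_3)
  have "(\<integral>\<^sup>+x. f x \<partial>lborel) = (\<integral>\<^sup>+(x3, x2, x1). f (vector [x1, x2, x3]) \<partial>(lborel \<Otimes>\<^sub>M (lborel \<Otimes>\<^sub>M lborel)))"
    by (subst lborel_vector_3) (simp add: nn_integral_distr split_beta')
  also have "\<dots> = (\<integral>\<^sup>+x3. \<integral>\<^sup>+(x2, x1). f (vector [x1, x2, x3]) \<partial>(lborel \<Otimes>\<^sub>M lborel) \<partial>lborel)"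
    by (subst sigma_finite_measure.nn_integral_fst[OF sigma_finite_lborel_pair, symmetric]) (simp_all add: split_beta')
  also have "\<dots> = (\<integral>\<^sup>+x3. \<integral>\<^sup>+x2. \<integral>\<^sup>+x1. f (vector [x1, x2, x3]) \<partial>lborel \<partial>lborel \<partial>lborel)"
    by (intro nn_integral_cong, subst lborel.nn_integral_fst[symmetric]) (simp_all add: split_beta')
  finally show ?thesis .
qed

text \<open>
  By Fubini's theorem almost all sections of a null set are null sets, so the mixed norm does not distinguish functions that agree almost
  everywhere.
\<close>
lemma AE_vector_3:
  assumes "AE x in (lborel :: (real ^ 3) measure). P x"
  shows "AE x3 in lborel. AE x2 in lborel. AE x1 in lborel. P (vector [x1, x2, x3])"
proof -
  interpret P: pair_sigma_finite "lborel :: real measure" "lborel \<Otimes>\<^sub>M lborel :: (real \<times> real) measure"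
    by (rule pair_sigma_finite_lborel_3)
  have "AE p in lborel \<Otimes>\<^sub>M (lborel \<Otimes>\<^sub>M lborel). P ((\<lambda>(x3, x2, x1). vector [x1, x2, x3]) p)"
    using assms by (subst (asm) lborel_vector_3) (rule AE_distrD, measurable)
  then have "AE x3 in lborel. AE p in lborel \<Otimes>\<^sub>M lborel. P (case p of (x2, x1) \<Rightarrow> vector [x1, x2, x3])"
    by (rule P.AE_pair[THEN eventually_mono]) (simp add: split_beta')
  then show ?thesis
    by (rule eventually_mono) (drule lborel_pair.AE_pair, simp)
qed

definition mixed_Lp :: "real \<Rightarrow> real \<Rightarrow> real \<Rightarrow> (real ^ 3 \<Rightarrow> ennreal) \<Rightarrow> ennreal" where
  "mixed_Lp q1 q2 q3 F =
     Lp_norm q3 (\<lambda>x3. Lp_norm q2 (\<lambda>x2. Lp_norm q1 (\<lambda>x1. F (vector [x1, x2, x3]))))"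

lemma mixed_norm_eq: "mixed_norm q1 q2 q3 u = mixed_Lp q1 q2 q3 (\<lambda>x. ennreal \<bar>u x\<bar>)"
  by (simp add: mixed_norm_def mixed_Lp_def)

lemma mixed_Lp_mono_AE:
  assumes "0 < q1" "0 < q2" "0 < q3" and "AE x in lborel. F x \<le> G x"
  shows "mixed_Lp q1 q2 q3 F \<le> mixed_Lp q1 q2 q3 G"
  unfolding mixed_Lp_def
proof (rule Lp_norm_mono_AE)
  show "AE x3 in lborel. Lp_norm q2 (\<lambda>x2. Lp_norm q1 (\<lambda>x1. F (vector [x1, x2, x3])))
     \<le> Lp_norm q2 (\<lambda>x2. Lp_norm q1 (\<lambda>x1. G (vector [x1, x2, x3])))"
    using AE_vector_3[OF assms(4)]
  proof eventually_elim
    case (elim x3)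
    then have "AE x2 in lborel. Lp_norm q1 (\<lambda>x1. F (vector [x1, x2, x3])) \<le> Lp_norm q1 (\<lambda>x1. G (vector [x1, x2, x3]))"
      by eventually_elim (intro Lp_norm_mono_AE assms)
    then show ?case by (intro Lp_norm_mono_AE assms)
  qed
qed fact

lemma mixed_Lp_cmult:
  assumes "0 < q1" "0 < q2" "0 < q3" and [measurable]: "F \<in> borel_measurable borel"
  shows "mixed_Lp q1 q2 q3 (\<lambda>x. c * F x) = c * mixed_Lp q1 q2 q3 F"
  using assms(1-3) by (simp add: mixed_Lp_def Lp_norm_cmult)

lemma mixed_Lp_add_le:
  assumes q: "1 \<le> q1" "1 \<le> q2" "1 \<le> q3"
    and [measurable]: "F \<in> borel_measurable borel" "G \<in> borel_measurable borel"
  shows "mixed_Lp q1 q2 q3 (\<lambda>x. F x + G x) \<le> mixed_Lp q1 q2 q3 F + mixed_Lp q1 q2 q3 G"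
proof -
  have "mixed_Lp q1 q2 q3 (\<lambda>x. F x + G x)
      \<le> Lp_norm q3 (\<lambda>x3. Lp_norm q2 (\<lambda>x2. Lp_norm q1 (\<lambda>x1. F (vector [x1, x2, x3]))
          + Lp_norm q1 (\<lambda>x1. G (vector [x1, x2, x3]))))"
    unfolding mixed_Lp_def using q by (intro Lp_norm_mono Lp_norm_add_le) auto
  also have "\<dots> \<le> Lp_norm q3 (\<lambda>x3. Lp_norm q2 (\<lambda>x2. Lp_norm q1 (\<lambda>x1. F (vector [x1, x2, x3])))
          + Lp_norm q2 (\<lambda>x2. Lp_norm q1 (\<lambda>x1. G (vector [x1, x2, x3]))))"
    using q by (intro Lp_norm_mono Lp_norm_add_le) auto
  also have "\<dots> \<le> mixed_Lp q1 q2 q3 F + mixed_Lp q1 q2 q3 G"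
    unfolding mixed_Lp_def using q by (intro Lp_norm_add_le) auto
  finally show ?thesis .
qed

lemma mixed_Lp_same:
  assumes "p \<noteq> 0" and [measurable]: "F \<in> borel_measurable borel"
  shows "mixed_Lp p p p F = Lp_norm p F"
proof -
  have "ennreal_powr (Lp_norm p F) p = ennreal_powr (mixed_Lp p p p F) p"
    using assms(1) by (simp add: mixed_Lp_def Lp_norm_powr nn_integral_vector_3)
  then show ?thesis
    by (metis ennreal_powr_cancel(1) assms(1))
qed

lemma Lp_norm_weighted_le:
  fixes F :: "'a::euclidean_space \<Rightarrow> 'b::euclidean_space \<Rightarrow> ennreal"
  assumes [measurable]: "case_prod F \<in> borel_measurable (borel \<Otimes>\<^sub>M borel)" "w \<in> borel_measurable borel"
    and p: "1 \<le> p" and le: "\<And>y. Lp_norm p (\<lambda>x. F x y) \<le> G y"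
  shows "Lp_norm p (\<lambda>x. \<integral>\<^sup>+y. w y * F x y \<partial>lborel) \<le> (\<integral>\<^sup>+y. w y * G y \<partial>lborel)"
proof -
  have "Lp_norm p (\<lambda>x. \<integral>\<^sup>+y. w y * F x y \<partial>lborel) \<le> (\<integral>\<^sup>+y. Lp_norm p (\<lambda>x. w y * F x y) \<partial>lborel)"
    using p by (intro Lp_norm_nn_integral_le sigma_finite_lborel) measurable
  also have "\<dots> = (\<integral>\<^sup>+y. w y * Lp_norm p (\<lambda>x. F x y) \<partial>lborel)"
    using p by (intro nn_integral_cong Lp_norm_cmult) auto
  also have "\<dots> \<le> (\<integral>\<^sup>+y. w y * G y \<partial>lborel)"
    by (intro nn_integral_mono mult_left_mono le) simp
  finally show ?thesis .
qed

definition conv3 :: "(real \<Rightarrow> ennreal) \<Rightarrow> (real \<Rightarrow> ennreal) \<Rightarrow> (real \<Rightarrow> ennreal) \<Rightarrow>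
    (real ^ 3 \<Rightarrow> ennreal) \<Rightarrow> real ^ 3 \<Rightarrow> ennreal" where
  "conv3 k1 k2 k3 f x = (\<integral>\<^sup>+y. k1 (x $ 1 - y $ 1) * k2 (x $ 2 - y $ 2) * k3 (x $ 3 - y $ 3) * f y \<partial>lborel)"

lemma borel_measurable_vec_nth_comp [measurable (raw)]:
  fixes f :: "'a \<Rightarrow> real ^ 'n"
  assumes "f \<in> borel_measurable M"
  shows "(\<lambda>x. f x $ i) \<in> borel_measurable M"
  using borel_measurable_inner[OF assms borel_measurable_const[of "axis i 1"]] by (simp add: inner_axis)

lemma borel_measurable_conv3 [measurable]:
  assumes [measurable]: "k1 \<in> borel_measurable borel" "k2 \<in> borel_measurable borel"
    "k3 \<in> borel_measurable borel" "f \<in> borel_measurable borel"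
  shows "conv3 k1 k2 k3 f \<in> borel_measurable borel"
  unfolding conv3_def[abs_def] by measurable

text \<open>
  Minkowski's inequality moves the norm in \<open>x\<^sub>1\<close> inside the integrals over \<open>y\<^sub>2\<close> and \<open>y\<^sub>3\<close>, where the bound for \<open>k1\<close> replaces it
  by the \<open>L\<^sup>2\<close> norm in \<open>y\<^sub>1\<close>; the same is then done for the second and the third variable. What remains is an iterated
  \<open>L\<^sup>2\<close> norm, which is the full one by Tonelli's theorem.
\<close>
lemma mixed_Lp_conv3_le:
  assumes k: "conv_bounded q1 k1 C1" "conv_bounded q2 k2 C2" "conv_bounded q3 k3 C3"
    and q: "1 \<le> q1" "1 \<le> q2" "1 \<le> q3" and [measurable]: "f \<in> borel_measurable borel"
  shows "mixed_Lp q1 q2 q3 (conv3 k1 k2 k3 f) \<le> ennreal (C1 * C2 * C3) * Lp_norm 2 f"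
proof -
  have [measurable]: "k1 \<in> borel_measurable borel" "k2 \<in> borel_measurable borel" "k3 \<in> borel_measurable borel"
    and C: "0 \<le> C1" "0 \<le> C2" "0 \<le> C3"
    using k by (auto simp: conv_bounded_def)
  define f1 where "f1 y2 y3 = Lp_norm 2 (\<lambda>y1. f (vector [y1, y2, y3]))" for y2 y3
  define f2 where "f2 y3 = Lp_norm 2 (\<lambda>y2. f1 y2 y3)" for y3
  have [measurable]: "case_prod f1 \<in> borel_measurable (borel \<Otimes>\<^sub>M borel)"
    unfolding f1_def by measurable
  have [measurable]: "f2 \<in> borel_measurable borel"
    unfolding f2_def by measurable
  have split: "conv3 k1 k2 k3 f (vector [x1, x2, x3]) =
    (\<integral>\<^sup>+y3. k3 (x3 - y3) * (\<integral>\<^sup>+y2. k2 (x2 - y2) * (\<integral>\<^sup>+y1. k1 (x1 - y1) * f (vector [y1, y2, y3])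
       \<partial>lborel) \<partial>lborel) \<partial>lborel)" for x1 x2 x3
  proof -
    have "conv3 k1 k2 k3 f (vector [x1, x2, x3]) = (\<integral>\<^sup>+y3. \<integral>\<^sup>+y2. \<integral>\<^sup>+y1.
        k3 (x3 - y3) * (k2 (x2 - y2) * (k1 (x1 - y1) * f (vector [y1, y2, y3]))) \<partial>lborel \<partial>lborel \<partial>lborel)"
      unfolding conv3_def by (subst nn_integral_vector_3) (simp_all add: mult_ac)
    then show ?thesis by (simp add: nn_integral_cmult)
  qed
  have "Lp_norm q1 (\<lambda>x1. conv3 k1 k2 k3 f (vector [x1, x2, x3]))
      \<le> (\<integral>\<^sup>+y3. k3 (x3 - y3) * (\<integral>\<^sup>+y2. k2 (x2 - y2) * (ennreal C1 * f1 y2 y3) \<partial>lborel) \<partial>lborel)" for x2 x3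
    unfolding split
  proof (intro Lp_norm_weighted_le q)
    fix y3 y2
    show "Lp_norm q1 (\<lambda>x1. \<integral>\<^sup>+y1. k1 (x1 - y1) * f (vector [y1, y2, y3]) \<partial>lborel) \<le> ennreal C1 * f1 y2 y3"
      using k(1) by (simp add: conv_bounded_def f1_def)
  qed measurable
  then have "mixed_Lp q1 q2 q3 (conv3 k1 k2 k3 f) \<le> Lp_norm q3 (\<lambda>x3. Lp_norm q2 (\<lambda>x2.
      (\<integral>\<^sup>+y3. k3 (x3 - y3) * (\<integral>\<^sup>+y2. k2 (x2 - y2) * (ennreal C1 * f1 y2 y3) \<partial>lborel) \<partial>lborel)))"
    unfolding mixed_Lp_def using q by (intro Lp_norm_mono) auto
  also have "\<dots> \<le> Lp_norm q3 (\<lambda>x3. \<integral>\<^sup>+y3. k3 (x3 - y3) * (ennreal C2 * (ennreal C1 * f2 y3)) \<partial>lborel)"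
  proof (intro Lp_norm_mono Lp_norm_weighted_le q)
    fix y3
    have "Lp_norm q2 (\<lambda>x2. \<integral>\<^sup>+y2. k2 (x2 - y2) * (ennreal C1 * f1 y2 y3) \<partial>lborel)
        \<le> ennreal C2 * Lp_norm 2 (\<lambda>y2. ennreal C1 * f1 y2 y3)"
      using k(2) by (simp add: conv_bounded_def)
    then show "Lp_norm q2 (\<lambda>x2. \<integral>\<^sup>+y2. k2 (x2 - y2) * (ennreal C1 * f1 y2 y3) \<partial>lborel)
        \<le> ennreal C2 * (ennreal C1 * f2 y3)"
      by (simp add: Lp_norm_cmult f2_def)
  qed (use q in \<open>simp, measurable\<close>)
  also have "\<dots> \<le> ennreal C3 * Lp_norm 2 (\<lambda>y3. ennreal C2 * (ennreal C1 * f2 y3))"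
    using k(3) by (simp add: conv_bounded_def)
  also have "\<dots> = ennreal (C1 * C2 * C3) * Lp_norm 2 f2"
    using C by (simp add: Lp_norm_cmult ennreal_mult mult_ac)
  also have "Lp_norm 2 f2 = Lp_norm 2 f"
    by (subst mixed_Lp_same[symmetric]) (simp_all add: mixed_Lp_def f2_def[abs_def] f1_def[abs_def])
  finally show ?thesis .
qed

section \<open>Smooth bump functions\<close>

text \<open>
  All powers are included because differentiation raises \<open>m\<close>.
\<close>
definition flat_exp :: "nat \<Rightarrow> real \<Rightarrow> real" where
  "flat_exp m t = (if 0 < t then exp (- (1 / t)) / t ^ m else 0)"

lemma flat_exp_nonneg: "0 \<le> flat_exp m t"
  by (simp add: flat_exp_def)

lemma flat_exp_nonpos: "t \<le> 0 \<Longrightarrow> flat_exp m t = 0"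
  by (simp add: flat_exp_def)

lemma flat_exp_0_le_1: "flat_exp 0 t \<le> 1"
  by (simp add: flat_exp_def)

text \<open>
  From \<open>exp (1/t) \<ge> (1 / (n t))^n\<close> with \<open>n = m + 2\<close>. Quadratic decay at \<open>0\<close> is what makes the derivative vanish there.
\<close>
lemma flat_exp_le_square: "flat_exp m t \<le> real (m + 2) ^ (m + 2) * t\<^sup>2"
proof (cases "0 < t")
  case True
  let ?n = "m + 2"
  have "(1 / t / real ?n) ^ ?n \<le> (1 + (1 / t) / real ?n) ^ ?n"
    using True by (intro power_mono) auto
  also have "\<dots> \<le> exp (1 / t)"
    using True by (intro exp_ge_one_plus_x_over_n_power_n) (auto intro: order_trans[of _ 0])
  finally have "inverse (exp (1 / t)) \<le> inverse ((1 / t / real ?n) ^ ?n)"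
    using True by (intro le_imp_inverse_le) auto
  also have "inverse ((1 / t / real ?n) ^ ?n) = (real ?n * t) ^ ?n"
    using True by (simp only: power_inverse[symmetric]) (simp add: field_simps)
  finally have "exp (- (1 / t)) / t ^ m \<le> (real ?n * t) ^ ?n / t ^ m"
    using True by (intro divide_right_mono) (auto simp: exp_minus)
  also have "\<dots> = real ?n ^ ?n * t\<^sup>2"
    using True by (simp only: power_mult_distrib power_add[of t]) simp
  finally show ?thesis using True by (simp add: flat_exp_def)
qed (simp add: flat_exp_def)

lemma has_real_derivative_flat_exp:
  "(flat_exp m has_real_derivative flat_exp (m + 2) t - real m * flat_exp (m + 1) t) (at t)"
proof (cases t "0::real" rule: linorder_cases)
  case greater
  have "((\<lambda>t. exp (- (1 / t)) / t ^ m) has_real_derivative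
      ((exp (- (1 / t)) * (1 / t\<^sup>2)) * t ^ m - exp (- (1 / t)) * (real m * t ^ (m - 1))) / (t ^ m * t ^ m)) (at t)"
    using greater by (auto intro!: derivative_eq_intros simp: power2_eq_square)
  also have "((exp (- (1 / t)) * (1 / t\<^sup>2)) * t ^ m - exp (- (1 / t)) * (real m * t ^ (m - 1))) / (t ^ m * t ^ m)
      = flat_exp (m + 2) t - real m * flat_exp (m + 1) t"
    using greater by (cases m) (auto simp: flat_exp_def field_simps power2_eq_square)
  finally have "((\<lambda>t. exp (- (1 / t)) / t ^ m) has_real_derivative
      flat_exp (m + 2) t - real m * flat_exp (m + 1) t) (at t)" .
  then show ?thesis
    by (rule DERIV_cong_ev[THEN iffD1, rotated -1, OF _ refl _ refl])
      (use greater in \<open>auto simp: flat_exp_def eventually_nhds intro!: exI[of _ "{0<..}"]\<close>)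
next
  case less
  have "((\<lambda>t. 0) has_real_derivative flat_exp (m + 2) t - real m * flat_exp (m + 1) t) (at t)"
    using less by (simp add: flat_exp_nonpos)
  then show ?thesis
    by (rule DERIV_cong_ev[THEN iffD1, rotated -1, OF _ refl _ refl])
      (use less in \<open>auto simp: flat_exp_def eventually_nhds intro!: exI[of _ "{..<0}"]\<close>)
next
  case equal
  let ?C = "real (m + 2) ^ (m + 2)"
  have "((\<lambda>h. flat_exp m h / h) \<longlongrightarrow> 0) (at 0)"
  proof (rule Lim_null_comparison)
    show "\<forall>\<^sub>F h in at 0. norm (flat_exp m h / h) \<le> ?C * \<bar>h\<bar>"
    proof (intro always_eventually allI)
      fix h :: real
      have "\<bar>flat_exp m h\<bar> \<le> ?C * \<bar>h\<bar> * \<bar>h\<bar>"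
        using flat_exp_le_square[of m h] flat_exp_nonneg[of m h] by (simp add: power2_eq_square mult.assoc)
      then show "norm (flat_exp m h / h) \<le> ?C * \<bar>h\<bar>"
        by (cases "h = 0") (auto simp: divide_le_eq)
    qed
    show "((\<lambda>h. ?C * \<bar>h\<bar>) \<longlongrightarrow> 0) (at 0)"
      by (auto intro!: tendsto_eq_intros)
  qed
  then show ?thesis
    using equal by (simp add: DERIV_def flat_exp_nonpos)
qed

lemma continuous_on_flat_exp: "continuous_on A (flat_exp m)"
  by (meson DERIV_isCont has_real_derivative_flat_exp continuous_at_imp_continuous_on)

lemma borel_measurable_flat_exp [measurable]: "flat_exp m \<in> borel_measurable borel"
  by (intro borel_measurable_continuous_onI continuous_on_flat_exp)

text \<open>
  For \<open>s > 0\<close> all these functions vanish outside the ball around \<open>a\<close> with radius \<open>s\<close>, and the class is closed under partial derivatives; so its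
  members are test functions. Multiplication by coordinates is included because the inner derivative of
  \<open>(norm (y - a))\<^sup>2\<close> is linear in \<open>y\<close>.
\<close>
inductive_set bump_module :: "real ^ 'n \<Rightarrow> real \<Rightarrow> (real ^ 'n \<Rightarrow> real) set"
  for a :: "real ^ 'n" and s :: real where
  base: "(\<lambda>y. flat_exp m (1 - (norm (y - a))\<^sup>2 / s\<^sup>2)) \<in> bump_module a s"
| coord: "f \<in> bump_module a s \<Longrightarrow> (\<lambda>y. y $ i * f y) \<in> bump_module a s"
| scale: "f \<in> bump_module a s \<Longrightarrow> (\<lambda>y. c * f y) \<in> bump_module a s"
| add: "f \<in> bump_module a s \<Longrightarrow> g \<in> bump_module a s \<Longrightarrow> (\<lambda>y. f y + g y) \<in> bump_module a s"

lemma has_derivative_bump: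
  fixes a :: "real ^ 'n"
  shows "((\<lambda>y. flat_exp m (1 - (norm (y - a))\<^sup>2 / s\<^sup>2)) has_derivative
    (\<lambda>h. \<Sum>i\<in>UNIV. ((flat_exp (m + 2) (1 - (norm (y - a))\<^sup>2 / s\<^sup>2)
        - real m * flat_exp (m + 1) (1 - (norm (y - a))\<^sup>2 / s\<^sup>2)) * (- (2 * (y $ i - a $ i) / s\<^sup>2))) * h $ i)) (at y)"
proof -
  have "((\<lambda>y. 1 - (norm (y - a))\<^sup>2 / s\<^sup>2) has_derivative (\<lambda>h. - (2 * ((y - a) \<bullet> h) / s\<^sup>2))) (at y)"
    unfolding power2_norm_eq_inner divide_inverse
    by (auto intro!: derivative_eq_intros simp: inner_commute algebra_simps)
  from has_derivative_compose[OF this has_real_derivative_flat_exp[unfolded has_field_derivative_def]]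
  moreover have "e * (- (2 * ((y - a) \<bullet> h) / s\<^sup>2)) = (\<Sum>i\<in>UNIV. (e * (- (2 * (y $ i - a $ i) / s\<^sup>2))) * h $ i)" for e h
  proof -
    have "(\<Sum>i\<in>UNIV. (e * (- (2 * (y $ i - a $ i) / s\<^sup>2))) * h $ i)
        = (\<Sum>i\<in>UNIV. (e * (- (2 / s\<^sup>2))) * ((y $ i - a $ i) * h $ i))"
      by (intro sum.cong) auto
    also have "\<dots> = (e * (- (2 / s\<^sup>2))) * ((y - a) \<bullet> h)"
      by (simp only: sum_distrib_left[symmetric] inner_vec_def inner_real_def vector_minus_component)
    finally show ?thesis by simp
  qed
  ultimately show ?thesis by (simp only:)
qed

lemma bump_module_derivative:
  fixes f :: "real ^ 'n \<Rightarrow> real"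
  assumes "f \<in> bump_module a s"
  shows "\<exists>g. (\<forall>i. g i \<in> bump_module a s) \<and>
    (\<forall>y. (f has_derivative (\<lambda>h. \<Sum>i\<in>UNIV. g i y * h $ i)) (at y))"
  using assms
proof induction
  case (base m)
  define d where "d y = flat_exp (m + 2) (1 - (norm (y - a))\<^sup>2 / s\<^sup>2)
        - real m * flat_exp (m + 1) (1 - (norm (y - a))\<^sup>2 / s\<^sup>2)" for y
  have d: "d \<in> bump_module a s"
    using bump_module.add[OF bump_module.base[of "m + 2" a s]
        bump_module.scale[OF bump_module.base[of "m + 1" a s], of "- real m"]]
    by (simp add: d_def[abs_def])
  show ?case
  proof (intro exI[of _ "\<lambda>i y. y $ i * (- (2 / s\<^sup>2) * d y) + (2 * a $ i / s\<^sup>2) * d y"] conjI allI)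
    fix y
    show "((\<lambda>y. flat_exp m (1 - (norm (y - a))\<^sup>2 / s\<^sup>2)) has_derivative
      (\<lambda>h. \<Sum>i\<in>UNIV. (y $ i * (- (2 / s\<^sup>2) * d y) + 2 * a $ i / s\<^sup>2 * d y) * h $ i)) (at y)"
      using has_derivative_bump[of m a s y]
    proof (rule has_derivative_eq_rhs, intro ext sum.cong refl)
      fix h :: "real ^ 'n" and i
      have "(d y * (- (2 * (y $ i - a $ i) / s\<^sup>2))) * h $ i =
          (y $ i * (- (2 / s\<^sup>2) * d y) + 2 * a $ i / s\<^sup>2 * d y) * h $ i"
        by (simp add: algebra_simps diff_divide_distrib)
      then show "(flat_exp (m + 2) (1 - (norm (y - a))\<^sup>2 / s\<^sup>2) - real m * flat_exp (m + 1) (1 - (norm (y - a))\<^sup>2 / s\<^sup>2)) *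
          (- (2 * (y $ i - a $ i) / s\<^sup>2)) * h $ i = (y $ i * (- (2 / s\<^sup>2) * d y) + 2 * a $ i / s\<^sup>2 * d y) * h $ i"
        by (simp add: d_def)
    qed
  qed (intro bump_module.intros d)
next
  case (coord f j)
  then obtain g where g: "\<And>i. g i \<in> bump_module a s"
    "\<And>y. (f has_derivative (\<lambda>h. \<Sum>i\<in>UNIV. g i y * h $ i)) (at y)" by blast
  have "(\<lambda>y. y $ j * g i y + (if i = j then 1 else 0) * f y) \<in> bump_module a s" for i
    by (intro bump_module.intros g coord)
  moreover have "((\<lambda>y. y $ j * f y) has_derivative
      (\<lambda>h. \<Sum>i\<in>UNIV. (y $ j * g i y + (if i = j then 1 else 0) * f y) * h $ i)) (at y)" for y
  proof -
    have "((\<lambda>y. y $ j * f y) has_derivative (\<lambda>h. y $ j * (\<Sum>i\<in>UNIV. g i y * h $ i) + h $ j * f y)) (at y)"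
      by (intro has_derivative_mult g bounded_linear_imp_has_derivative bounded_linear_vec_nth)
    then show ?thesis
    proof (rule has_derivative_eq_rhs, intro ext)
      fix h :: "real ^ 'n"
      have "(\<Sum>i\<in>UNIV. (if i = j then 1 else 0) * f y * h $ i) = (\<Sum>i\<in>UNIV. if i = j then f y * h $ i else 0)"
        by (intro sum.cong) auto
      also have "\<dots> = h $ j * f y" by (simp add: mult.commute)
      finally show "y $ j * (\<Sum>i\<in>UNIV. g i y * h $ i) + h $ j * f y
        = (\<Sum>i\<in>UNIV. (y $ j * g i y + (if i = j then 1 else 0) * f y) * h $ i)"
        by (simp only: distrib_right sum.distrib sum_distrib_left mult.assoc)
    qed
  qed
  ultimately show ?case
    by (intro exI[of _ "\<lambda>i y. y $ j * g i y + (if i = j then 1 else 0) * f y"] conjI allI)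
next
  case (scale f c)
  then obtain g where g: "\<And>i. g i \<in> bump_module a s"
    "\<And>y. (f has_derivative (\<lambda>h. \<Sum>i\<in>UNIV. g i y * h $ i)) (at y)" by blast
  have "((\<lambda>y. c * f y) has_derivative (\<lambda>h. \<Sum>i\<in>UNIV. (c * g i y) * h $ i)) (at y)" for y
    using has_derivative_mult_right[OF g(2)[of y], of c] by (simp add: sum_distrib_left mult.assoc)
  then show ?case using g(1)
    by (intro exI[of _ "\<lambda>i y. c * g i y"] conjI allI bump_module.scale)
next
  case (add f1 f2)
  then obtain g1 g2 where g: "\<And>i. g1 i \<in> bump_module a s" "\<And>i. g2 i \<in> bump_module a s"
    "\<And>y. (f1 has_derivative (\<lambda>h. \<Sum>i\<in>UNIV. g1 i y * h $ i)) (at y)"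
    "\<And>y. (f2 has_derivative (\<lambda>h. \<Sum>i\<in>UNIV. g2 i y * h $ i)) (at y)" by blast
  have "((\<lambda>y. f1 y + f2 y) has_derivative (\<lambda>h. \<Sum>i\<in>UNIV. (g1 i y + g2 i y) * h $ i)) (at y)" for y
    using has_derivative_add[OF g(3)[of y] g(4)[of y]] by (simp add: sum.distrib distrib_right)
  then show ?case using g(1,2)
    by (intro exI[of _ "\<lambda>i y. g1 i y + g2 i y"] conjI allI bump_module.add)
qed

lemma partial_eq:
  fixes f :: "real ^ 'n \<Rightarrow> real"
  assumes "(f has_derivative (\<lambda>h. \<Sum>i\<in>UNIV. c i * h $ i)) (at y)"
  shows "partial i f y = c i"
proof -
  have "partial i f y = (\<Sum>j\<in>UNIV. c j * axis i 1 $ j)"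
    unfolding partial_def frechet_derivative_at[OF assms, symmetric] ..
  also have "\<dots> = (\<Sum>j\<in>UNIV. if j = i then c j else 0)"
    by (intro sum.cong) (auto simp: axis_def)
  finally show ?thesis by simp
qed

text \<open>
  A class of differentiable functions that contains the partial derivatives of its members consists of smooth functions.
\<close>
lemma bump_module_C_k: "f \<in> bump_module a s \<Longrightarrow> C_k k f"
proof (induction k arbitrary: f)
  case 0
  then obtain g where "\<And>y. (f has_derivative (\<lambda>h. \<Sum>i\<in>UNIV. g i y * h $ i)) (at y)"
    using bump_module_derivative by blast
  then show ?case by (auto intro!: continuous_at_imp_continuous_on has_derivative_continuous)
next
  case (Suc k)
  then obtain g where g: "\<And>i. g i \<in> bump_module a s"
    "\<And>y. (f has_derivative (\<lambda>h. \<Sum>i\<in>UNIV. g i y * h $ i)) (at y)"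
    using bump_module_derivative by blast
  have "partial i f = g i" for i
    using partial_eq[OF g(2)] by (simp add: fun_eq_iff)
  then show ?case
    using g Suc.IH by (auto simp: differentiable_on_def differentiable_def intro: has_derivative_at_withinI)
qed

lemma bump_module_support:
  assumes "f \<in> bump_module a s" "0 < s" "s \<le> norm (y - a)"
  shows "f y = 0"
  using assms(1)
proof induction
  case (base m)
  have "s\<^sup>2 \<le> (norm (y - a))\<^sup>2" using assms by (intro power_mono) auto
  then show ?case using assms by (intro flat_exp_nonpos) (simp add: field_simps)
qed auto

lemma bump_module_test_function:
  assumes "f \<in> bump_module a s" "0 < s"
  shows "test_function f"
proof -
  have "{x. f x \<noteq> 0} \<subseteq> cball a s"
    using bump_module_support[OF assms] by (force simp: dist_norm norm_minus_commute)
  then have "bounded {x. f x \<noteq> 0}" by (rule bounded_subset[rotated]) simp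
  then show ?thesis
    using bump_module_C_k[OF assms(1)] by (simp add: test_function_def compact_closure)
qed

section \<open>The pointwise bound for mollifications\<close>

lemma norm_integral_le_nn_integral:
  fixes f :: "'a \<Rightarrow> 'b::{banach, second_countable_topology}"
  shows "ennreal (norm (\<integral>x. f x \<partial>M)) \<le> (\<integral>\<^sup>+x. ennreal (norm (f x)) \<partial>M)"
  by (cases "integrable M f") (auto simp: integral_norm_bound_ennreal not_integrable_integral_eq)

lemma integrable_lborel_mult:
  fixes f :: "'a::euclidean_space \<Rightarrow> real" and g :: "'b::euclidean_space \<Rightarrow> real"
  assumes f: "integrable lborel f" and g: "integrable lborel g"
  shows "integrable (lborel \<Otimes>\<^sub>M lborel) (\<lambda>(x, y). f x * g y)"
proof (rule integrableI_bounded)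
  have [measurable]: "f \<in> borel_measurable borel" "g \<in> borel_measurable borel"
    using f g by (auto dest: borel_measurable_integrable)
  have [measurable]: "f \<in> borel_measurable lborel" "g \<in> borel_measurable lborel"
    by simp_all
  show "(\<lambda>(x, y). f x * g y) \<in> borel_measurable (lborel \<Otimes>\<^sub>M lborel)"
    by measurable
  have "(\<integral>\<^sup>+p. ennreal (norm (case p of (x, y) \<Rightarrow> f x * g y)) \<partial>(lborel \<Otimes>\<^sub>M lborel))
    = (\<integral>\<^sup>+x. \<integral>\<^sup>+y. ennreal \<bar>f x\<bar> * ennreal \<bar>g y\<bar> \<partial>lborel \<partial>lborel)"
    by (subst lborel.nn_integral_fst[symmetric]) (simp_all add: split_beta' abs_mult ennreal_mult)
  also have "\<dots> = (\<integral>\<^sup>+x. ennreal \<bar>f x\<bar> \<partial>lborel) * (\<integral>\<^sup>+y. ennreal \<bar>g y\<bar> \<partial>lborel)"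
    by (simp add: nn_integral_cmult nn_integral_multc)
  also have "\<dots> < \<infinity>"
    using f g by (simp add: integrable_iff_bounded ennreal_mult_less_top)
  finally show "(\<integral>\<^sup>+p. ennreal (norm (case p of (x, y) \<Rightarrow> f x * g y)) \<partial>(lborel \<Otimes>\<^sub>M lborel)) < \<infinity>" .
qed

lemma integrable_indicator_ball: "integrable lborel (indicator (ball a r) :: 'a::euclidean_space \<Rightarrow> real)"
  by (rule integrable_real_indicator[OF _ emeasure_lborel_ball_finite]) simp

lemma bump_module_bounded:
  fixes f :: "real ^ 'n \<Rightarrow> real"
  assumes "f \<in> bump_module a s" "0 < s"
  shows "\<exists>B. \<forall>y. \<bar>f y\<bar> \<le> B * indicator (ball a s) y"
proof -
  have "continuous_on UNIV f" using bump_module_C_k[OF assms(1), of 0] by simp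
  then have "compact (f ` cball a s)"
    by (intro compact_continuous_image) (auto intro: continuous_on_subset)
  then obtain B where B: "\<forall>z \<in> f ` cball a s. norm z \<le> B"
    using compact_imp_bounded bounded_iff by blast
  have "\<bar>f y\<bar> \<le> B * indicator (ball a s) y" for y
    using B bump_module_support[OF assms, of y]
    by (cases "y \<in> ball a s") (auto simp: dist_norm norm_minus_commute)
  then show ?thesis by blast
qed

lemma bump_module_measurable:
  fixes f :: "real ^ 'n \<Rightarrow> real"
  assumes "f \<in> bump_module a s"
  shows "f \<in> borel_measurable borel"
  using bump_module_C_k[OF assms, of 0] by (simp add: borel_measurable_continuous_onI)

text \<open>
  Bounded functions supported in a ball may be paired with locally integrable ones.
\<close>
lemma integrable_bump_module:
  fixes f :: "real ^ 'n \<Rightarrow> real"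
  assumes f: "f \<in> bump_module a s" "0 < s" and [measurable]: "u \<in> borel_measurable borel"
    and u: "integrable lborel (\<lambda>y. indicator (ball a s) y *\<^sub>R u y)"
  shows "integrable lborel (\<lambda>y. f y *\<^sub>R (u y :: 'b::euclidean_space))"
proof -
  note [measurable] = bump_module_measurable[OF f(1)]
  obtain B where B: "\<And>y. \<bar>f y\<bar> \<le> B * indicator (ball a s) y"
    using bump_module_bounded[OF f] by blast
  show ?thesis
  proof (rule Bochner_Integration.integrable_bound)
    show "integrable lborel (\<lambda>y. B *\<^sub>R (indicator (ball a s) y *\<^sub>R u y))"
      by (intro integrable_scaleR_right u)
    have "norm (f y *\<^sub>R u y) \<le> norm (B *\<^sub>R (indicator (ball a s) y *\<^sub>R u y))" for y
      using mult_right_mono[OF B[of y], of "norm (u y)"]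
      by (cases "y \<in> ball a s") (auto intro: order_trans[OF _ mult_right_mono[OF abs_ge_self]])
    then show "AE y in lborel. norm (f y *\<^sub>R u y) \<le> norm (B *\<^sub>R (indicator (ball a s) y *\<^sub>R u y))" by simp
  qed measurable
qed

definition bump :: "real ^ 3 \<Rightarrow> real \<Rightarrow> real ^ 3 \<Rightarrow> real" where
  "bump x s y = flat_exp 0 (1 - (norm (y - x))\<^sup>2 / s\<^sup>2)"

text \<open>
  The divergence in \<open>y\<close> of the vector field \<open>(x - y) * bump x s y\<close>.
\<close>
definition bump_div :: "real ^ 3 \<Rightarrow> real \<Rightarrow> real ^ 3 \<Rightarrow> real" where
  "bump_div x s y = 2 * (norm (y - x))\<^sup>2 / s\<^sup>2 * flat_exp 2 (1 - (norm (y - x))\<^sup>2 / s\<^sup>2) - 3 * bump x s y"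

lemma borel_measurable_bump [measurable (raw)]:
  assumes [measurable]: "f \<in> borel_measurable M" "g \<in> borel_measurable M" "h \<in> borel_measurable M"
  shows "(\<lambda>x. bump (f x) (g x) (h x)) \<in> borel_measurable M"
  unfolding bump_def by measurable

lemma borel_measurable_bump_div [measurable (raw)]:
  assumes [measurable]: "f \<in> borel_measurable M" "g \<in> borel_measurable M" "h \<in> borel_measurable M"
  shows "(\<lambda>x. bump_div (f x) (g x) (h x)) \<in> borel_measurable M"
  unfolding bump_div_def by measurable

lemma bump_in_bump_module: "bump x s \<in> bump_module x s"
  using bump_module.base[of 0 x s] by (simp add: bump_def[abs_def])

lemma bump_bounds: "0 \<le> bump x s y" "bump x s y \<le> 1"
  by (simp_all add: bump_def flat_exp_nonneg flat_exp_0_le_1)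

lemma bump_eq_0: "0 < s \<Longrightarrow> s \<le> norm (y - x) \<Longrightarrow> bump x s y = 0"
  by (rule bump_module_support[OF bump_in_bump_module])

lemma bump_le_indicator: "0 < s \<Longrightarrow> bump x s y \<le> indicator (ball x s) y"
  using bump_bounds[of x s y] bump_eq_0[of s y x]
  by (cases "y \<in> ball x s") (auto simp: dist_norm norm_minus_commute)

text \<open>
  Here \<open>515 = 2 * 256 + 3\<close>, where \<open>256 = 4 ^ 4\<close> bounds \<open>flat_exp 2\<close> on the unit interval.
\<close>
lemma bump_div_bound:
  assumes "0 < s"
  shows "\<bar>bump_div x s y\<bar> \<le> 515 * indicator (ball x s) y"
proof (cases "norm (y - x) < s")
  case True
  define t where "t = (norm (y - x))\<^sup>2 / s\<^sup>2"
  have "(norm (y - x))\<^sup>2 \<le> s\<^sup>2" using True by (intro power_mono) auto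
  then have t: "0 \<le> t" "t \<le> 1" using assms by (auto simp: t_def)
  have "(1 - t)\<^sup>2 \<le> 1\<^sup>2" using t by (intro power_mono) auto
  then have "flat_exp 2 (1 - t) \<le> 256"
    using flat_exp_le_square[of 2 "1 - t"] by simp
  then have "t * flat_exp 2 (1 - t) \<le> 1 * 256"
    using t flat_exp_nonneg by (intro mult_mono) auto
  moreover have "0 \<le> t * flat_exp 2 (1 - t)" using t flat_exp_nonneg by simp
  moreover have "bump_div x s y = 2 * (t * flat_exp 2 (1 - t)) - 3 * bump x s y"
    by (simp add: bump_div_def t_def)
  ultimately show ?thesis
    using True bump_bounds[of x s y] by (simp add: dist_norm norm_minus_commute)
next
  case False
  then have "s\<^sup>2 \<le> (norm (y - x))\<^sup>2" using assms by (intro power_mono) auto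
  then have "flat_exp m (1 - (norm (y - x))\<^sup>2 / s\<^sup>2) = 0" for m
    using assms by (intro flat_exp_nonpos) (simp add: field_simps)
  then have "bump_div x s y = 0" by (simp add: bump_div_def bump_def)
  then show ?thesis by simp
qed

text \<open>
  The rescaled bump \<open>bump x s y / s^3\<close> has constant mass, so its rate of change in \<open>s\<close> is a divergence; the
  conserving flow moves mass radially with velocity \<open>(y - x) / s\<close>.
\<close>
lemma has_real_derivative_bump_scale:
  assumes "0 < s"
  shows "((\<lambda>s. bump x s y / s ^ 3) has_real_derivative bump_div x s y / s ^ 4) (at s)"
proof -
  let ?r = "(norm (y - x))\<^sup>2"
  let ?t = "1 - ?r / s\<^sup>2"
  have "((\<lambda>s. 1 - ?r / s\<^sup>2) has_real_derivative 2 * ?r / s ^ 3) (at s)"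
    using assms by (auto intro!: derivative_eq_intros simp: field_simps power2_eq_square power3_eq_cube)
  from DERIV_chain2[OF has_real_derivative_flat_exp this, of 0]
  have "((\<lambda>s. bump x s y) has_real_derivative flat_exp 2 ?t * (2 * ?r / s ^ 3)) (at s)"
    by (simp add: bump_def numeral_2_eq_2)
  then have "((\<lambda>s. bump x s y / s ^ 3) has_real_derivative
     (flat_exp 2 ?t * (2 * ?r / s ^ 3) * s ^ 3 - bump x s y * (3 * s\<^sup>2)) / (s ^ 3 * s ^ 3)) (at s)"
    using assms by (auto intro!: derivative_eq_intros)
  also have "(flat_exp 2 ?t * (2 * ?r / s ^ 3) * s ^ 3 - bump x s y * (3 * s\<^sup>2)) / (s ^ 3 * s ^ 3)
      = bump_div x s y / s ^ 4"
  proof -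
    have "(f * (2 * r / s ^ 3) * s ^ 3 - b * (3 * s\<^sup>2)) / (s ^ 3 * s ^ 3) = (2 * r / s\<^sup>2 * f - 3 * b) / s ^ 4" for f r b
      using assms by (simp add: field_simps eval_nat_numeral)
    then show ?thesis by (simp add: bump_div_def)
  qed
  finally show ?thesis .
qed

lemma partial_radial_bump:
  "partial i (\<lambda>y. (x $ i - y $ i) * bump x s y) y
    = (x $ i - y $ i)\<^sup>2 * (2 / s\<^sup>2 * flat_exp 2 (1 - (norm (y - x))\<^sup>2 / s\<^sup>2)) - bump x s y"
proof -
  define d where "d j = flat_exp 2 (1 - (norm (y - x))\<^sup>2 / s\<^sup>2) * (- (2 * (y $ j - x $ j) / s\<^sup>2))" for j
  have "(bump x s has_derivative (\<lambda>h. \<Sum>j\<in>UNIV. d j * h $ j)) (at y)"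
    using has_derivative_bump[of 0 x s y] by (simp add: bump_def[abs_def] d_def numeral_2_eq_2)
  moreover have "((\<lambda>y. x $ i - y $ i) has_derivative (\<lambda>h. 0 - h $ i)) (at y)"
    by (intro has_derivative_diff has_derivative_const bounded_linear_imp_has_derivative bounded_linear_vec_nth)
  ultimately have "((\<lambda>y. (x $ i - y $ i) * bump x s y) has_derivative
      (\<lambda>h. (x $ i - y $ i) * (\<Sum>j\<in>UNIV. d j * h $ j) + (0 - h $ i) * bump x s y)) (at y)"
    by (intro has_derivative_mult)
  moreover have "(x $ i - y $ i) * (\<Sum>j\<in>UNIV. d j * h $ j) + (0 - h $ i) * bump x s y
      = (\<Sum>j\<in>UNIV. ((x $ i - y $ i) * d j - (if j = i then bump x s y else 0)) * h $ j)" for h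
  proof -
    have "(\<Sum>j\<in>UNIV. (if j = i then bump x s y else 0) * h $ j) = (\<Sum>j\<in>UNIV. if j = i then bump x s y * h $ j else 0)"
      by (intro sum.cong) auto
    also have "\<dots> = bump x s y * h $ i" by simp
    finally show ?thesis
      by (simp add: left_diff_distrib sum_subtractf sum_distrib_left mult.assoc)
  qed
  ultimately have "((\<lambda>y. (x $ i - y $ i) * bump x s y) has_derivative
      (\<lambda>h. \<Sum>j\<in>UNIV. ((x $ i - y $ i) * d j - (if j = i then bump x s y else 0)) * h $ j)) (at y)"
    by (simp only:)
  from partial_eq[OF this, of i] have "partial i (\<lambda>y. (x $ i - y $ i) * bump x s y) y = (x $ i - y $ i) * d i - bump x s y"
    by simp
  moreover have "(p - q) * (e * (- (2 * (q - p) / S))) = (p - q)\<^sup>2 * (2 / S * e)" for p q e S :: real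
    by (simp add: power2_eq_square diff_divide_distrib add_divide_distrib algebra_simps)
  ultimately show ?thesis by (simp only: d_def)
qed

definition borel_weak_gradient :: "(real ^ 3 \<Rightarrow> real) \<Rightarrow> (real ^ 3 \<Rightarrow> real ^ 3) \<Rightarrow> bool" where
  "borel_weak_gradient u g \<longleftrightarrow> u \<in> borel_measurable borel \<and> g \<in> borel_measurable borel \<and>
     (\<forall>a r. integrable lborel (\<lambda>y. indicator (ball a r) y *\<^sub>R u y)) \<and>
     (\<forall>a r. integrable lborel (\<lambda>y. indicator (ball a r) y *\<^sub>R g y)) \<and>
     (\<forall>\<phi> i. test_function \<phi> \<longrightarrow>
        (\<integral>y. u y * partial i \<phi> y \<partial>lborel) = - (\<integral>y. g y $ i * \<phi> y \<partial>lborel))"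

text \<open>
  The definition of the weak gradient, applied to the three components of the test field \<open>(x - y) * bump x s y\<close>.
\<close>
lemma weak_divergence_bump:
  assumes ug: "borel_weak_gradient u g" and s: "0 < s"
  shows "(\<integral>y. u y * bump_div x s y \<partial>lborel) = - (\<integral>y. bump x s y * (g y \<bullet> (x - y)) \<partial>lborel)"
proof -
  have [measurable]: "u \<in> borel_measurable borel" "g \<in> borel_measurable borel"
    and loc: "\<And>a r. integrable lborel (\<lambda>y. indicator (ball a r) y *\<^sub>R u y)"
      "\<And>a r. integrable lborel (\<lambda>y. indicator (ball a r) y *\<^sub>R g y)"
    and weak: "\<And>\<phi> i. test_function \<phi> \<Longrightarrow> (\<integral>y. u y * partial i \<phi> y \<partial>lborel) = - (\<integral>y. g y $ i * \<phi> y \<partial>lborel)"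
    using ug by (auto simp: borel_weak_gradient_def)
  define \<psi> where "\<psi> i y = (x $ i - y $ i) * bump x s y" for i y
  have \<psi>: "\<psi> i \<in> bump_module x s" for i
  proof -
    have "(\<lambda>y. x $ i * bump x s y + (- 1) * (y $ i * bump x s y)) \<in> bump_module x s"
      by (intro bump_module.intros bump_in_bump_module)
    then show ?thesis by (simp add: \<psi>_def[abs_def] algebra_simps)
  qed
  have d\<psi>: "partial i (\<psi> i) \<in> bump_module x s" for i
  proof -
    obtain h where h: "\<And>j. h j \<in> bump_module x s"
      "\<And>y. (\<psi> i has_derivative (\<lambda>k. \<Sum>j\<in>UNIV. h j y * k $ j)) (at y)"
      using bump_module_derivative[OF \<psi>[of i]] by blast
    have "partial i (\<psi> i) = h i" using partial_eq[OF h(2)] by (simp add: fun_eq_iff)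
    then show ?thesis using h(1) by simp
  qed
  have int1: "integrable lborel (\<lambda>y. u y * partial i (\<psi> i) y)" for i
    using integrable_bump_module[OF d\<psi> s _ loc(1)] by (simp add: mult.commute)
  have int2: "integrable lborel (\<lambda>y. g y $ i * \<psi> i y)" for i
  proof -
    have "integrable lborel (\<lambda>y. (\<psi> i y *\<^sub>R g y) \<bullet> axis i 1)"
      using integrable_bump_module[OF \<psi> s _ loc(2)] by (intro integrable_inner_left) simp
    then show ?thesis by (simp add: inner_axis mult.commute)
  qed
  have "bump_div x s y = (\<Sum>i\<in>UNIV. partial i (\<psi> i) y)" for y
  proof -
    define e where "e = 2 / s\<^sup>2 * flat_exp 2 (1 - (norm (y - x))\<^sup>2 / s\<^sup>2)"
    have "(\<Sum>i\<in>UNIV. partial i (\<psi> i) y) = (\<Sum>i\<in>UNIV. (x $ i - y $ i)\<^sup>2 * e) - 3 * bump x s y"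
      unfolding \<psi>_def[abs_def] partial_radial_bump e_def by (simp add: sum_subtractf)
    also have "(\<Sum>i\<in>UNIV. (x $ i - y $ i)\<^sup>2 * e) = (norm (y - x))\<^sup>2 * e"
      unfolding norm_minus_commute[of y x] power2_norm_eq_inner inner_vec_def sum_distrib_right
      by (simp add: power2_eq_square)
    finally show ?thesis by (simp add: bump_div_def e_def)
  qed
  then have "(\<integral>y. u y * bump_div x s y \<partial>lborel) = (\<integral>y. (\<Sum>i\<in>UNIV. u y * partial i (\<psi> i) y) \<partial>lborel)"
    by (simp add: sum_distrib_left)
  also have "\<dots> = (\<Sum>i\<in>UNIV. \<integral>y. u y * partial i (\<psi> i) y \<partial>lborel)"
    by (intro Bochner_Integration.integral_sum int1)
  also have "\<dots> = (\<Sum>i\<in>UNIV. - (\<integral>y. g y $ i * \<psi> i y \<partial>lborel))"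
    by (intro sum.cong refl weak bump_module_test_function[OF \<psi> s])
  also have "\<dots> = - (\<integral>y. (\<Sum>i\<in>UNIV. g y $ i * \<psi> i y) \<partial>lborel)"
    by (simp only: sum_negf Bochner_Integration.integral_sum[OF int2])
  also have "(\<lambda>y. \<Sum>i\<in>UNIV. g y $ i * \<psi> i y) = (\<lambda>y. bump x s y * (g y \<bullet> (x - y)))"
    by (simp add: fun_eq_iff \<psi>_def inner_vec_def sum_distrib_left mult_ac)
  finally show ?thesis .
qed

text \<open>
  The bump at scale \<open>s\<close> vanishes unless \<open>s > |x - y|\<close>, and \<open>\<integral> |x - y| s^(-4) ds\<close> from \<open>|x - y|\<close> to infinity is
  \<open>|x - y|^(-2) / 3\<close>.
\<close>
lemma nn_integral_bump_scales:
  assumes "0 < \<delta>" "\<delta> \<le> R"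
  shows "(\<integral>\<^sup>+s. indicator {\<delta>..R} s * ennreal (norm (x - y) * bump x s y / s ^ 4) \<partial>lborel)
    \<le> indicator (ball x R) y * ennreal (1 / (norm (x - y))\<^sup>2)"
proof (cases "0 < norm (x - y) \<and> norm (x - y) < R")
  case True
  define r where "r = norm (x - y)"
  have r: "0 < r" "r < R" using True by (auto simp: r_def)
  have "(\<integral>\<^sup>+s. indicator {\<delta>..R} s * ennreal (norm (x - y) * bump x s y / s ^ 4) \<partial>lborel)
      \<le> (\<integral>\<^sup>+s. ennreal (r / s ^ 4) * indicator {r..R} s \<partial>lborel)"
  proof (intro nn_integral_mono)
    fix s :: real
    show "indicator {\<delta>..R} s * ennreal (norm (x - y) * bump x s y / s ^ 4) \<le> ennreal (r / s ^ 4) * indicator {r..R} s"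
    proof (cases "s \<in> {\<delta>..R}")
      case s: True
      show ?thesis
      proof (cases "r \<le> s")
        case True
        have "norm (x - y) * bump x s y / s ^ 4 \<le> r * 1 / s ^ 4"
          using s assms r bump_bounds[of x s y]
          by (intro divide_right_mono mult_mono) (auto simp: r_def)
        then show ?thesis using s True by (auto simp: indicator_def intro: ennreal_leI)
      next
        case False
        then have "bump x s y = 0"
          using s assms by (intro bump_eq_0) (auto simp: r_def norm_minus_commute)
        then show ?thesis by simp
      qed
    qed simp
  qed
  also have "\<dots> = ennreal ((- r / (3 * R ^ 3)) - (- r / (3 * r ^ 3)))"
  proof (rule nn_integral_FTC_Icc)
    fix s assume "s \<in> {r..R}"
    then have "0 < s" using r by auto
    then show "((\<lambda>s. - r / (3 * s ^ 3)) has_real_derivative r / s ^ 4) (at s)"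
      by (auto intro!: derivative_eq_intros simp: field_simps eval_nat_numeral)
  qed (use r in auto)
  also have "\<dots> \<le> ennreal (1 / r\<^sup>2)"
  proof (rule ennreal_leI)
    have "r / (3 * r ^ 3) = (1 / r\<^sup>2) / 3" using r by (simp add: field_simps eval_nat_numeral)
    moreover have "0 \<le> r / (3 * R ^ 3)" "0 \<le> 1 / r\<^sup>2" using r by auto
    ultimately show "(- r / (3 * R ^ 3)) - (- r / (3 * r ^ 3)) \<le> 1 / r\<^sup>2"
    proof -
      have "- X - - Y \<le> a" if "Y = a / 3" "0 \<le> X" "0 \<le> a" for X Y a :: real
        using that by simp
      then show ?thesis
        using \<open>r / (3 * r ^ 3) = (1 / r\<^sup>2) / 3\<close> \<open>0 \<le> r / (3 * R ^ 3)\<close> \<open>0 \<le> 1 / r\<^sup>2\<close>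
        unfolding minus_divide_left[symmetric] .
    qed
  qed
  finally show ?thesis using r by (simp add: r_def dist_norm)
next
  case False
  have zero: "indicator {\<delta>..R} s * ennreal (norm (x - y) * bump x s y / s ^ 4) = 0" for s
  proof (cases "s \<in> {\<delta>..R} \<and> norm (x - y) \<noteq> 0")
    case True
    then have "bump x s y = 0"
      using False assms by (intro bump_eq_0) (auto simp: norm_minus_commute)
    then show ?thesis by simp
  qed (auto simp: indicator_def)
  show ?thesis unfolding zero by simp
qed

text \<open>
  Let \<open>U s\<close> be the mollification at \<open>x\<close> with scale \<open>s\<close>. Its derivative in \<open>s\<close> is the integral of \<open>u\<close> against a divergence,
  hence of \<open>g\<close> against the field \<open>(x - y) * bump x s y / s^4\<close> up to sign. Integrating over the scales from \<open>\<delta>\<close> to \<open>R\<close> bounds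
  \<open>U R - U \<delta>\<close> by the second term, and \<open>U R\<close> itself is an average of \<open>u\<close> and is bounded by the first. The right-hand side does not
  depend on \<open>\<delta>\<close>.
\<close>
lemma mollification_bound:
  assumes ug: "borel_weak_gradient u g" and \<delta>: "0 < \<delta>" "\<delta> \<le> R"
  shows "ennreal \<bar>\<integral>y. u y * (bump x \<delta> y / \<delta> ^ 3) \<partial>lborel\<bar>
    \<le> (\<integral>\<^sup>+y. ennreal (1 / R ^ 3) * (indicator (ball x R) y * ennreal \<bar>u y\<bar>) \<partial>lborel)
      + (\<integral>\<^sup>+y. indicator (ball x R) y * ennreal (1 / (norm (x - y))\<^sup>2) * ennreal (norm (g y)) \<partial>lborel)"
proof -
  have R: "0 < R" using \<delta> by simp
  have [measurable]: "u \<in> borel_measurable borel" "g \<in> borel_measurable borel"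
    and loc: "\<And>a r. integrable lborel (\<lambda>y. indicator (ball a r) y *\<^sub>R u y)"
    using ug by (auto simp: borel_weak_gradient_def)
  have [measurable]: "ball x R \<in> sets borel" by simp
  define U where "U s = (\<integral>y. u y * (bump x s y / s ^ 3) \<partial>lborel)" for s
  define H where "H s y = indicator {\<delta>..R} s * (u y * (bump_div x s y / s ^ 4))" for s y
  have [measurable]: "case_prod H \<in> borel_measurable (borel \<Otimes>\<^sub>M borel)"
    unfolding H_def by measurable
  have [measurable]: "case_prod H \<in> borel_measurable (lborel \<Otimes>\<^sub>M lborel)"
    by (simp cong: measurable_cong_sets)
  have intU: "integrable lborel (\<lambda>y. u y * (bump x s y / s ^ 3))" if "0 < s" for s
  proof -
    have "integrable lborel (\<lambda>y. (bump x s y *\<^sub>R u y) / s ^ 3)"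
      by (intro integrable_divide integrable_bump_module[OF bump_in_bump_module that _ loc]) simp
    then show ?thesis by (simp add: mult.commute)
  qed
  have H_le: "\<bar>H s y\<bar> \<le> indicator {\<delta>..R} s * (515 / \<delta> ^ 4 * \<bar>indicator (ball x R) y * u y\<bar>)" for s y
  proof (cases "s \<in> {\<delta>..R}")
    case True
    have "\<bar>bump_div x s y\<bar> / s ^ 4 \<le> 515 * indicator (ball x s) y / \<delta> ^ 4"
      using bump_div_bound[of s x y] True \<delta> by (intro frac_le power_mono) auto
    also have "\<dots> \<le> 515 / \<delta> ^ 4 * indicator (ball x R) y"
      using True \<delta> by (auto simp: indicator_def)
    finally have "\<bar>u y\<bar> * (\<bar>bump_div x s y\<bar> / s ^ 4) \<le> \<bar>u y\<bar> * (515 / \<delta> ^ 4 * indicator (ball x R) y)"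
      by (rule mult_left_mono) simp
    then show ?thesis using True \<delta> by (simp add: H_def abs_mult mult_ac)
  qed (simp add: H_def)
  have intH: "integrable (lborel \<Otimes>\<^sub>M lborel) (case_prod H)"
  proof (rule Bochner_Integration.integrable_bound)
    have "integrable lborel (\<lambda>y. 515 / \<delta> ^ 4 * \<bar>indicator (ball x R) y * u y\<bar>)"
      using loc[of x R] by (intro integrable_mult_right integrable_abs) simp
    moreover have "integrable lborel (indicator {\<delta>..R} :: real \<Rightarrow> real)"
      by (rule integrable_real_indicator) (use \<delta> in auto)
    ultimately show "integrable (lborel \<Otimes>\<^sub>M lborel)
        (\<lambda>(s, y). indicator {\<delta>..R} s * (515 / \<delta> ^ 4 * \<bar>indicator (ball x R) y * u y\<bar>))"
      by (intro integrable_lborel_mult)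
    show "AE p in lborel \<Otimes>\<^sub>M lborel. norm (case_prod H p)
        \<le> norm (case p of (s, y) \<Rightarrow> indicator {\<delta>..R} s * (515 / \<delta> ^ 4 * \<bar>indicator (ball x R) y * u y\<bar>))"
      using H_le by (intro AE_I2) (auto simp: split_beta' intro: order_trans[OF _ abs_ge_self])
  qed measurable
  have "U R - U \<delta> = (\<integral>y. (\<integral>s. H s y \<partial>lborel) \<partial>lborel)"
  proof -
    have "U R - U \<delta> = (\<integral>y. u y * (bump x R y / R ^ 3) - u y * (bump x \<delta> y / \<delta> ^ 3) \<partial>lborel)"
      unfolding U_def using \<delta> R by (intro Bochner_Integration.integral_diff[symmetric] intU)
    also have "\<dots> = (\<integral>y. (\<integral>s. H s y \<partial>lborel) \<partial>lborel)"
    proof (intro Bochner_Integration.integral_cong refl)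
      fix y
      have "(\<integral>s. bump_div x s y / s ^ 4 * indicator {\<delta>..R} s \<partial>lborel) = bump x R y / R ^ 3 - bump x \<delta> y / \<delta> ^ 3"
      proof (rule integral_FTC_Icc_real)
        fix s assume "\<delta> \<le> s" "s \<le> R"
        then have s: "0 < s" using \<delta> by simp
        show "((\<lambda>s. bump x s y / s ^ 3) has_real_derivative bump_div x s y / s ^ 4) (at s)"
          by (rule has_real_derivative_bump_scale[OF s])
        have "isCont (\<lambda>s. 1 - (norm (y - x))\<^sup>2 / s\<^sup>2) s"
          using s by (intro continuous_intros) auto
        then have "isCont (\<lambda>s. flat_exp m (1 - (norm (y - x))\<^sup>2 / s\<^sup>2)) s" for m
          by (rule isCont_o2) (rule DERIV_isCont[OF has_real_derivative_flat_exp])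
        then show "isCont (\<lambda>s. bump_div x s y / s ^ 4) s"
          unfolding bump_div_def bump_def using s by (intro continuous_intros) auto
      qed (use \<delta> in auto)
      then show "u y * (bump x R y / R ^ 3) - u y * (bump x \<delta> y / \<delta> ^ 3) = (\<integral>s. H s y \<partial>lborel)"
      proof -
        have "(\<integral>s. H s y \<partial>lborel) = (\<integral>s. u y * (bump_div x s y / s ^ 4 * indicator {\<delta>..R} s) \<partial>lborel)"
          by (intro Bochner_Integration.integral_cong refl) (simp add: H_def)
        also have "\<dots> = u y * (\<integral>s. bump_div x s y / s ^ 4 * indicator {\<delta>..R} s \<partial>lborel)"
          by (rule Bochner_Integration.integral_mult_right_zero)
        finally show ?thesis
          using \<open>(\<integral>s. bump_div x s y / s ^ 4 * indicator {\<delta>..R} s \<partial>lborel) = _\<close>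
          by (simp only: right_diff_distrib)
      qed
    qed
    finally show ?thesis .
  qed
  also have "\<dots> = (\<integral>s. (\<integral>y. H s y \<partial>lborel) \<partial>lborel)"
    by (rule lborel_pair.Fubini_integral[OF intH])
  finally have diff: "U R - U \<delta> = (\<integral>s. (\<integral>y. H s y \<partial>lborel) \<partial>lborel)" .
  have inner: "ennreal \<bar>\<integral>y. H s y \<partial>lborel\<bar>
      \<le> (\<integral>\<^sup>+y. (indicator {\<delta>..R} s * ennreal (norm (x - y) * bump x s y / s ^ 4)) * ennreal (norm (g y)) \<partial>lborel)" for s
  proof (cases "s \<in> {\<delta>..R}")
    case True
    then have s: "0 < s" using \<delta> by simp
    have "(\<integral>y. H s y \<partial>lborel) = (\<integral>y. u y * bump_div x s y \<partial>lborel) / s ^ 4"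
      using True by (simp add: H_def)
    also have "\<dots> = - (\<integral>y. bump x s y * (g y \<bullet> (x - y)) / s ^ 4 \<partial>lborel)"
      by (simp add: weak_divergence_bump[OF ug s])
    finally have "ennreal \<bar>\<integral>y. H s y \<partial>lborel\<bar> = ennreal (norm (\<integral>y. bump x s y * (g y \<bullet> (x - y)) / s ^ 4 \<partial>lborel))"
      by simp
    also have "\<dots> \<le> (\<integral>\<^sup>+y. ennreal (norm (bump x s y * (g y \<bullet> (x - y)) / s ^ 4)) \<partial>lborel)"
      by (rule norm_integral_le_nn_integral)
    also have "\<dots> \<le> (\<integral>\<^sup>+y. (indicator {\<delta>..R} s * ennreal (norm (x - y) * bump x s y / s ^ 4)) * ennreal (norm (g y)) \<partial>lborel)"
    proof (intro nn_integral_mono)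
      fix y
      have "norm (bump x s y * (g y \<bullet> (x - y)) / s ^ 4) = bump x s y / s ^ 4 * \<bar>g y \<bullet> (x - y)\<bar>"
        using s bump_bounds[of x s y] by (simp add: abs_mult)
      also have "\<dots> \<le> bump x s y / s ^ 4 * (norm (g y) * norm (x - y))"
        using s bump_bounds[of x s y] by (intro mult_left_mono Cauchy_Schwarz_ineq2) auto
      also have "\<dots> = norm (x - y) * bump x s y / s ^ 4 * norm (g y)" by simp
      finally show "ennreal (norm (bump x s y * (g y \<bullet> (x - y)) / s ^ 4))
        \<le> (indicator {\<delta>..R} s * ennreal (norm (x - y) * bump x s y / s ^ 4)) * ennreal (norm (g y))"
        using True s bump_bounds[of x s y] by (simp add: ennreal_mult[symmetric] ennreal_leI)
    qed
    finally show ?thesis .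
  qed (simp add: H_def)
  have "ennreal \<bar>U R - U \<delta>\<bar> \<le> (\<integral>\<^sup>+s. ennreal \<bar>\<integral>y. H s y \<partial>lborel\<bar> \<partial>lborel)"
    unfolding diff using norm_integral_le_nn_integral[of lborel "\<lambda>s. \<integral>y. H s y \<partial>lborel"] by simp
  also have "\<dots> \<le> (\<integral>\<^sup>+s. \<integral>\<^sup>+y. (indicator {\<delta>..R} s * ennreal (norm (x - y) * bump x s y / s ^ 4)) * ennreal (norm (g y)) \<partial>lborel \<partial>lborel)"
    by (rule nn_integral_mono) (rule inner)
  also have "\<dots> = (\<integral>\<^sup>+y. \<integral>\<^sup>+s. (indicator {\<delta>..R} s * ennreal (norm (x - y) * bump x s y / s ^ 4)) * ennreal (norm (g y)) \<partial>lborel \<partial>lborel)"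
    by (rule lborel_pair.Fubini') measurable
  also have "\<dots> = (\<integral>\<^sup>+y. (\<integral>\<^sup>+s. indicator {\<delta>..R} s * ennreal (norm (x - y) * bump x s y / s ^ 4) \<partial>lborel) * ennreal (norm (g y)) \<partial>lborel)"
    by (intro nn_integral_cong nn_integral_multc) measurable
  also have "\<dots> \<le> (\<integral>\<^sup>+y. indicator (ball x R) y * ennreal (1 / (norm (x - y))\<^sup>2) * ennreal (norm (g y)) \<partial>lborel)"
    by (intro nn_integral_mono mult_right_mono nn_integral_bump_scales \<delta>) simp
  finally have 1: "ennreal \<bar>U R - U \<delta>\<bar> \<le> (\<integral>\<^sup>+y. indicator (ball x R) y * ennreal (1 / (norm (x - y))\<^sup>2) * ennreal (norm (g y)) \<partial>lborel)" .
  have "ennreal \<bar>U R\<bar> \<le> (\<integral>\<^sup>+y. ennreal (norm (u y * (bump x R y / R ^ 3))) \<partial>lborel)"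
    unfolding U_def using norm_integral_le_nn_integral[of lborel "\<lambda>y. u y * (bump x R y / R ^ 3)"] by simp
  also have "\<dots> \<le> (\<integral>\<^sup>+y. ennreal (1 / R ^ 3) * (indicator (ball x R) y * ennreal \<bar>u y\<bar>) \<partial>lborel)"
  proof (intro nn_integral_mono)
    fix y
    have "norm (u y * (bump x R y / R ^ 3)) = (1 / R ^ 3) * (bump x R y * \<bar>u y\<bar>)"
      using R bump_bounds[of x R y] by (simp add: abs_mult)
    also have "\<dots> \<le> (1 / R ^ 3) * (indicator (ball x R) y * \<bar>u y\<bar>)"
      using R by (intro mult_left_mono mult_right_mono bump_le_indicator) auto
    finally have "ennreal (norm (u y * (bump x R y / R ^ 3))) \<le> ennreal ((1 / R ^ 3) * (indicator (ball x R) y * \<bar>u y\<bar>))"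
      by (rule ennreal_leI)
    also have "\<dots> = ennreal (1 / R ^ 3) * (indicator (ball x R) y * ennreal \<bar>u y\<bar>)"
      using R by (simp add: indicator_def ennreal_mult[symmetric])
    finally show "ennreal (norm (u y * (bump x R y / R ^ 3))) \<le> ennreal (1 / R ^ 3) * (indicator (ball x R) y * ennreal \<bar>u y\<bar>)" .
  qed
  finally have 2: "ennreal \<bar>U R\<bar> \<le> (\<integral>\<^sup>+y. ennreal (1 / R ^ 3) * (indicator (ball x R) y * ennreal \<bar>u y\<bar>) \<partial>lborel)" .
  have "ennreal \<bar>U \<delta>\<bar> \<le> ennreal (\<bar>U R\<bar> + \<bar>U R - U \<delta>\<bar>)"
    by (intro ennreal_leI) linarith
  also have "\<dots> = ennreal \<bar>U R\<bar> + ennreal \<bar>U R - U \<delta>\<bar>" by simp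
  also have "\<dots> \<le> (\<integral>\<^sup>+y. ennreal (1 / R ^ 3) * (indicator (ball x R) y * ennreal \<bar>u y\<bar>) \<partial>lborel)
      + (\<integral>\<^sup>+y. indicator (ball x R) y * ennreal (1 / (norm (x - y))\<^sup>2) * ennreal (norm (g y)) \<partial>lborel)"
    by (rule add_mono[OF 2 1])
  finally show ?thesis unfolding U_def .
qed

section \<open>Passing to the limit in the mollification\<close>

definition bump_mass :: real where
  "bump_mass = (\<integral>w. bump 0 1 w \<partial>lborel)"

lemma integrable_bump: "0 < s \<Longrightarrow> integrable lborel (bump x s)"
proof -
  assume s: "0 < s"
  have "integrable lborel (\<lambda>y. bump x s y *\<^sub>R (1::real))"
    using s by (intro integrable_bump_module[OF bump_in_bump_module])
      (simp_all add: integrable_indicator_ball)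
  then show ?thesis by simp
qed

lemma bump_mass_pos: "0 < bump_mass"
proof -
  have "bump_mass \<noteq> 0"
  proof
    assume "bump_mass = 0"
    then have "AE w in lborel. bump 0 1 w = 0"
      unfolding bump_mass_def
      using integral_nonneg_eq_0_iff_AE[OF integrable_bump[of 1 0]] by (simp add: bump_bounds)
    then have "AE w in lebesgue. bump 0 1 w = 0" by (rule AE_completion)
    moreover have "{w \<in> space lebesgue. \<not> bump 0 1 w = 0} = ball 0 1"
    proof -
      have pos: "bump 0 1 w = 0 \<longleftrightarrow> \<not> norm w < 1" for w
        using abs_square_less_1[of "norm w"] by (simp add: bump_def flat_exp_def)
      show ?thesis unfolding pos by (simp add: set_eq_iff)
    qed
    ultimately have "ball (0 :: real ^ 3) 1 \<in> null_sets lebesgue"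
      using AE_iff_null[of lebesgue "\<lambda>w. bump 0 1 w = 0"] by simp
    then have "negligible (ball (0 :: real ^ 3) 1)"
      by (simp only: negligible_iff_null_sets)
    then show False using open_not_negligible[of "ball (0 :: real ^ 3) 1"] by simp
  qed
  moreover have "0 \<le> bump_mass"
    unfolding bump_mass_def by (intro integral_nonneg_AE) (simp add: bump_bounds)
  ultimately show ?thesis by simp
qed

text \<open>
  The substitution \<open>x = y + s w\<close>.
\<close>
lemma integral_against_bump:
  fixes \<eta> :: "real ^ 3 \<Rightarrow> real"
  assumes [measurable]: "\<eta> \<in> borel_measurable borel" and s: "0 < s"
  shows "(\<integral>x. \<eta> x * (bump x s y / s ^ 3) \<partial>lborel) = (\<integral>w. \<eta> (y + s *\<^sub>R w) * bump 0 1 w \<partial>lborel)"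
proof -
  let ?h = "\<lambda>x. \<eta> x * (bump x s y / s ^ 3)"
  have "(\<integral>x. ?h x \<partial>lborel) = (\<integral>x. ?h x \<partial>density (distr lborel borel (\<lambda>w. y + s *\<^sub>R w)) (\<lambda>_. ennreal (\<bar>s\<bar> ^ DIM(real ^ 3))))"
    using lborel_affine[of s y] s by simp
  also have "\<dots> = (\<integral>w. \<bar>s\<bar> ^ DIM(real ^ 3) *\<^sub>R ?h (y + s *\<^sub>R w) \<partial>lborel)"
    by (subst integral_density) (auto simp: integral_distr)
  also have "\<dots> = (\<integral>w. \<eta> (y + s *\<^sub>R w) * bump 0 1 w \<partial>lborel)"
  proof (intro Bochner_Integration.integral_cong refl)
    fix w :: "real ^ 3"
    have "bump (y + s *\<^sub>R w) s y = bump 0 1 w"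
      using s by (simp add: bump_def power_mult_distrib)
    then show "\<bar>s\<bar> ^ DIM(real ^ 3) *\<^sub>R ?h (y + s *\<^sub>R w) = \<eta> (y + s *\<^sub>R w) * bump 0 1 w"
      using s by simp
  qed
  finally show ?thesis .
qed

text \<open>
  Mollification is symmetric: by Fubini's theorem it can be moved from \<open>u\<close> to the function paired with it.
\<close>
lemma integral_mollified:
  fixes \<eta> u :: "real ^ 3 \<Rightarrow> real"
  assumes [measurable]: "\<eta> \<in> borel_measurable borel" "u \<in> borel_measurable borel"
    and loc: "\<And>a r. integrable lborel (\<lambda>y. indicator (ball a r) y *\<^sub>R u y)"
    and \<eta>: "\<And>x. \<bar>\<eta> x\<bar> \<le> indicator (ball 0 \<rho>) x" and s: "0 < s"
  shows "(\<integral>x. \<eta> x * (\<integral>y. u y * (bump x s y / s ^ 3) \<partial>lborel) \<partial>lborel)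
    = (\<integral>y. u y * (\<integral>w. \<eta> (y + s *\<^sub>R w) * bump 0 1 w \<partial>lborel) \<partial>lborel)"
proof -
  define H where "H x y = \<eta> x * (u y * (bump x s y / s ^ 3))" for x y
  have [measurable]: "case_prod H \<in> borel_measurable (borel \<Otimes>\<^sub>M borel)"
    unfolding H_def by measurable
  have meas: "case_prod H \<in> borel_measurable (lborel \<Otimes>\<^sub>M lborel)"
    by (simp cong: measurable_cong_sets)
  have "integrable (lborel \<Otimes>\<^sub>M lborel) (\<lambda>(x, y). (indicator (ball 0 \<rho>) x / s ^ 3) * (indicator (ball 0 (\<rho> + s)) y *\<^sub>R u y))"
    by (intro integrable_lborel_mult loc integrable_divide integrable_indicator_ball)
  then have "integrable (lborel \<Otimes>\<^sub>M lborel) (case_prod H)"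
  proof (rule Bochner_Integration.integrable_bound)
    have "\<bar>H x y\<bar> \<le> \<bar>(indicator (ball 0 \<rho>) x / s ^ 3) * (indicator (ball 0 (\<rho> + s)) y *\<^sub>R u y)\<bar>" for x y
    proof (cases "x \<in> ball 0 \<rho> \<and> norm (y - x) < s")
      case True
      have "norm y \<le> norm x + norm (y - x)" by norm
      then have "y \<in> ball 0 (\<rho> + s)" using True by (simp add: dist_norm)
      have "\<bar>\<eta> x\<bar> * (\<bar>u y\<bar> * (bump x s y / s ^ 3)) \<le> 1 * (\<bar>u y\<bar> * (1 / s ^ 3))"
        using \<eta>[of x] True s bump_bounds[of x s y]
        by (intro mult_mono mult_left_mono divide_right_mono) auto
      then show ?thesis
        using True \<open>y \<in> ball 0 (\<rho> + s)\<close> s bump_bounds[of x s y] by (simp add: H_def abs_mult)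
    next
      case False
      then have "\<eta> x = 0 \<or> bump x s y = 0"
        using \<eta>[of x] bump_eq_0[OF s, of y x] by (cases "x \<in> ball 0 \<rho>") auto
      then show ?thesis by (auto simp: H_def)
    qed
    then show "AE p in lborel \<Otimes>\<^sub>M lborel. norm (case_prod H p)
      \<le> norm (case p of (x, y) \<Rightarrow> (indicator (ball 0 \<rho>) x / s ^ 3) * (indicator (ball 0 (\<rho> + s)) y *\<^sub>R u y))"
      by (simp add: split_beta')
  qed (rule meas)
  then have "(\<integral>y. \<integral>x. H x y \<partial>lborel \<partial>lborel) = (\<integral>x. \<integral>y. H x y \<partial>lborel \<partial>lborel)"
    by (rule lborel_pair.Fubini_integral)
  moreover have "(\<integral>y. H x y \<partial>lborel) = \<eta> x * (\<integral>y. u y * (bump x s y / s ^ 3) \<partial>lborel)" for x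
    unfolding H_def by (rule Bochner_Integration.integral_mult_right_zero)
  moreover have "(\<integral>x. H x y \<partial>lborel) = u y * (\<integral>w. \<eta> (y + s *\<^sub>R w) * bump 0 1 w \<partial>lborel)" for y
  proof -
    have "(\<integral>x. H x y \<partial>lborel) = (\<integral>x. u y * (\<eta> x * (bump x s y / s ^ 3)) \<partial>lborel)"
      by (intro Bochner_Integration.integral_cong refl) (simp add: H_def)
    also have "\<dots> = u y * (\<integral>x. \<eta> x * (bump x s y / s ^ 3) \<partial>lborel)"
      by (rule Bochner_Integration.integral_mult_right_zero)
    finally show ?thesis by (simp only: integral_against_bump[OF assms(1) s])
  qed
  ultimately show ?thesis by simp
qed

text \<open>
  After the mollification has been moved to the continuous function \<open>\<eta>\<close>, it converges pointwise, and dominated convergence applies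
  twice: to the average over \<open>w\<close> and to the integral against \<open>u\<close>.
\<close>
lemma mollified_tendsto:
  fixes \<eta> u :: "real ^ 3 \<Rightarrow> real"
  assumes cont: "continuous_on UNIV \<eta>" and [measurable]: "u \<in> borel_measurable borel"
    and loc: "\<And>a r. integrable lborel (\<lambda>y. indicator (ball a r) y *\<^sub>R u y)"
    and \<eta>: "\<And>x. \<bar>\<eta> x\<bar> \<le> indicator (ball 0 \<rho>) x"
    and s: "\<And>n. 0 < s n" "\<And>n. s n \<le> 1" "s \<longlonglongrightarrow> 0"
  shows "(\<lambda>n. \<integral>y. u y * (\<integral>w. \<eta> (y + s n *\<^sub>R w) * bump 0 1 w \<partial>lborel) \<partial>lborel)
    \<longlonglongrightarrow> (\<integral>y. u y * (bump_mass * \<eta> y) \<partial>lborel)"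
proof -
  have [measurable]: "\<eta> \<in> borel_measurable borel" using cont by (rule borel_measurable_continuous_onI)
  have [measurable]: "u \<in> borel_measurable lborel" "bump 0 1 \<in> borel_measurable lborel" by simp_all
  have \<eta>1: "\<bar>\<eta> x\<bar> \<le> 1" for x
    by (rule order_trans[OF \<eta>]) (simp add: indicator_def)
  define G where "G n y = (\<integral>w. \<eta> (y + s n *\<^sub>R w) * bump 0 1 w \<partial>lborel)" for n y
  have [measurable]: "G n \<in> borel_measurable lborel" for n
    unfolding G_def by measurable
  have G_lim: "(\<lambda>n. G n y) \<longlonglongrightarrow> bump_mass * \<eta> y" for y
  proof -
    have "(\<lambda>n. G n y) \<longlonglongrightarrow> (\<integral>w. \<eta> y * bump 0 1 w \<partial>lborel)"
      unfolding G_def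
    proof (rule integral_dominated_convergence[where w="bump 0 1"])
      show "AE w in lborel. (\<lambda>n. \<eta> (y + s n *\<^sub>R w) * bump 0 1 w) \<longlonglongrightarrow> \<eta> y * bump 0 1 w"
      proof (intro AE_I2 tendsto_mult_right)
        fix w
        have "(\<lambda>n. y + s n *\<^sub>R w) \<longlonglongrightarrow> y + 0 *\<^sub>R w"
          by (intro tendsto_intros s(3))
        then show "(\<lambda>n. \<eta> (y + s n *\<^sub>R w)) \<longlonglongrightarrow> \<eta> y"
          using cont by (intro continuous_on_tendsto_compose[OF cont]) auto
      qed
      show "AE w in lborel. norm (\<eta> (y + s n *\<^sub>R w) * bump 0 1 w) \<le> bump 0 1 w" for n
        using \<eta>1 bump_bounds by (auto simp: abs_mult intro!: mult_left_le_one_le)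
    qed (auto simp: integrable_bump)
    then show ?thesis by (simp add: bump_mass_def mult.commute)
  qed
  have G_bound: "\<bar>G n y\<bar> \<le> bump_mass * indicator (ball 0 (\<rho> + 1)) y" for n y
  proof (cases "y \<in> ball 0 (\<rho> + 1)")
    case True
    have "\<bar>G n y\<bar> \<le> (\<integral>w. \<bar>\<eta> (y + s n *\<^sub>R w) * bump 0 1 w\<bar> \<partial>lborel)"
      unfolding G_def by (rule integral_abs_bound)
    also have "\<dots> \<le> bump_mass"
      unfolding bump_mass_def
    proof (rule integral_mono_AE')
      show "AE w in lborel. \<bar>\<eta> (y + s n *\<^sub>R w) * bump 0 1 w\<bar> \<le> bump 0 1 w"
        using \<eta>1 bump_bounds by (auto simp: abs_mult intro!: mult_left_le_one_le)
    qed (auto simp: integrable_bump bump_bounds)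
    finally show ?thesis using True by simp
  next
    case False
    have zero: "\<eta> (y + s n *\<^sub>R w) * bump 0 1 w = 0" for w
    proof (cases "norm w < 1")
      case True
      have "norm (s n *\<^sub>R w) \<le> 1 * 1"
        using s(1,2)[of n] True unfolding norm_scaleR by (intro mult_mono) auto
      moreover have "norm y \<le> norm (y + s n *\<^sub>R w) + norm (s n *\<^sub>R w)"
        using norm_triangle_ineq4[of "y + s n *\<^sub>R w" "s n *\<^sub>R w"] by simp
      ultimately have "y + s n *\<^sub>R w \<notin> ball 0 \<rho>" using False by simp
      then show ?thesis using \<eta>[of "y + s n *\<^sub>R w"] by simp
    qed (simp add: bump_eq_0)
    show ?thesis
      unfolding G_def zero using bump_mass_pos by simp
  qed
  have "(\<lambda>n. \<integral>y. u y * G n y \<partial>lborel) \<longlonglongrightarrow> (\<integral>y. u y * (bump_mass * \<eta> y) \<partial>lborel)"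
  proof (rule integral_dominated_convergence[where w="\<lambda>y. bump_mass * \<bar>indicator (ball 0 (\<rho> + 1)) y *\<^sub>R u y\<bar>"])
    show "integrable lborel (\<lambda>y. bump_mass * \<bar>indicator (ball 0 (\<rho> + 1)) y *\<^sub>R u y\<bar>)"
      by (intro integrable_mult_right integrable_abs loc)
    show "AE y in lborel. (\<lambda>n. u y * G n y) \<longlonglongrightarrow> u y * (bump_mass * \<eta> y)"
      by (intro AE_I2 tendsto_mult_left G_lim)
    fix n
    have "norm (u y * G n y) \<le> bump_mass * \<bar>indicator (ball 0 (\<rho> + 1)) y *\<^sub>R u y\<bar>" for y
      using mult_left_mono[OF G_bound[of n y], of "\<bar>u y\<bar>"] by (simp add: abs_mult mult_ac)
    then show "AE y in lborel. norm (u y * G n y) \<le> bump_mass * \<bar>indicator (ball 0 (\<rho> + 1)) y *\<^sub>R u y\<bar>"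
      by simp
  qed measurable
  then show ?thesis by (simp add: G_def)
qed

text \<open>
  Inner regularity by closed sets; closed subsets of bounded sets are compact.
\<close>
lemma lborel_inner_compact:
  fixes A :: "'a::euclidean_space set"
  assumes A: "A \<in> sets borel" "bounded A" "0 < emeasure lborel A"
  shows "\<exists>K. compact K \<and> K \<subseteq> A \<and> 0 < emeasure lborel K"
proof -
  have "emeasure lborel A < \<infinity>" using A(2) by (rule emeasure_bounded_finite)
  then obtain a where a: "emeasure lborel A = ennreal a" "0 < a"
    using A(3) by (cases "emeasure lborel A") auto
  have "A \<in> sets lebesgue" using A(1) by (simp add: sets_completionI_sets)
  then obtain T where T: "closed T" "T \<subseteq> A" "emeasure lebesgue (A - T) < ennreal a"
    using a(2) by (rule sets_lebesgue_inner_closed)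
  have [measurable]: "T \<in> sets borel" using T(1) by simp
  have "emeasure lborel T \<noteq> 0"
  proof
    assume "emeasure lborel T = 0"
    have "A - T \<in> sets borel" using A(1) by simp
    then have "emeasure lebesgue (A - T) = emeasure lborel (A - T)" by simp
    moreover have "emeasure lborel A \<le> emeasure lborel (A - T) + emeasure lborel T"
      using emeasure_subadditive[of "A - T" lborel T] T(2) A(1) by (simp add: Un_absorb2)
    ultimately show False using T(3) a \<open>emeasure lborel T = 0\<close> by simp
  qed
  moreover have "compact T"
    using T A(2) bounded_subset compact_eq_bounded_closed by blast
  ultimately show ?thesis using T(2) by (auto simp: zero_less_iff_neq_zero)
qed

text \<open>
  Continuous functions decreasing to the indicator of a compact set extend the tested inequality to integrals over compact sets.
  If the set where \<open>B < u\<close> had positive measure, then so would some compact subset \<open>K\<close> of it, although the integral of \<open>u\<close> over \<open>K\<close> is at most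
  the (finite) integral of \<open>B\<close>.
\<close>
lemma AE_le_of_test:
  fixes u :: "'a::euclidean_space \<Rightarrow> real" and B :: "'a \<Rightarrow> ennreal"
  assumes [measurable]: "u \<in> borel_measurable borel" "B \<in> borel_measurable borel"
    and u: "\<And>r. integrable lborel (\<lambda>y. indicator (ball 0 r) y *\<^sub>R u y)"
    and B: "\<And>r. (\<integral>\<^sup>+y. indicator (ball 0 r) y * B y \<partial>lborel) < \<infinity>"
    and test: "\<And>\<eta> r. continuous_on UNIV \<eta> \<Longrightarrow> (\<And>x. 0 \<le> \<eta> x) \<Longrightarrow> (\<And>x. \<eta> x \<le> indicator (ball 0 r) x) \<Longrightarrow>
      ennreal (\<integral>y. u y * \<eta> y \<partial>lborel) \<le> (\<integral>\<^sup>+y. ennreal (\<eta> y) * B y \<partial>lborel)"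
  shows "AE y in lborel. ennreal (u y) \<le> B y"
proof -
  have cpt: "ennreal (\<integral>y. u y * indicator K y \<partial>lborel) \<le> (\<integral>\<^sup>+y. indicator K y * B y \<partial>lborel)"
    if K: "compact K" "K \<noteq> {}" "K \<subseteq> ball 0 r" for K r
  proof -
    have [measurable]: "K \<in> sets borel" using K(1) by (simp add: borel_compact)
    have [measurable]: "ball 0 (r + 1) \<in> sets (borel :: 'a measure)" by simp
    define \<eta> where "\<eta> n x = max 0 (1 - real (Suc n) * infdist x K)" for n x
    have cont: "continuous_on UNIV (\<eta> n)" for n
      unfolding \<eta>_def by (intro continuous_intros)
    have [measurable]: "\<eta> n \<in> borel_measurable borel" for n
      using cont by (rule borel_measurable_continuous_onI)
    have \<eta>0: "0 \<le> \<eta> n x" for n x by (simp add: \<eta>_def)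
    have supp: "\<eta> n x \<le> indicator (ball 0 (r + 1)) x" for n x
    proof (cases "infdist x K < 1")
      case True
      then obtain k where k: "k \<in> K" "dist x k < 1"
        using infdist_attains_inf[of K x] K compact_imp_closed by metis
      have "norm x \<le> norm k + dist x k" unfolding dist_norm by norm
      then have "x \<in> ball 0 (r + 1)" using k K(3) by (auto simp: dist_norm)
      then show ?thesis using infdist_nonneg[of x K] by (simp add: \<eta>_def)
    next
      case False
      have "1 * 1 \<le> real (Suc n) * infdist x K" using False by (intro mult_mono) auto
      then show ?thesis by (simp add: \<eta>_def)
    qed
    have ev: "\<forall>\<^sub>F n in sequentially. \<eta> n x = indicator K x" for x
    proof (cases "x \<in> K")
      case True
      then show ?thesis by (simp add: \<eta>_def)
    next
      case False
      then have pos: "0 < infdist x K"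
        using K compact_imp_closed in_closed_iff_infdist_zero[of K x] infdist_nonneg[of x K] by force
      obtain N where N: "1 / infdist x K < real N" using reals_Archimedean2 by blast
      have "\<eta> n x = indicator K x" if "N \<le> n" for n
      proof -
        have "1 / infdist x K \<le> real (Suc n)" using N that by simp
        then have "1 \<le> real (Suc n) * infdist x K" using pos by (simp add: field_simps)
        then show ?thesis using False by (simp add: \<eta>_def)
      qed
      then show ?thesis by (auto simp: eventually_sequentially)
    qed
    have "(\<lambda>n. \<integral>y. u y * \<eta> n y \<partial>lborel) \<longlonglongrightarrow> (\<integral>y. u y * indicator K y \<partial>lborel)"
    proof (rule integral_dominated_convergence[where w="\<lambda>y. \<bar>indicator (ball 0 (r + 1)) y *\<^sub>R u y\<bar>"])
      show "integrable lborel (\<lambda>y. \<bar>indicator (ball 0 (r + 1)) y *\<^sub>R u y\<bar>)" by (intro integrable_abs u)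
      show "AE y in lborel. (\<lambda>n. u y * \<eta> n y) \<longlonglongrightarrow> u y * indicator K y"
        using ev by (intro AE_I2 tendsto_mult_left tendsto_eventually)
      fix n
      have "norm (u y * \<eta> n y) \<le> \<bar>indicator (ball 0 (r + 1)) y *\<^sub>R u y\<bar>" for y
        using mult_left_mono[OF supp[of n y], of "\<bar>u y\<bar>"] \<eta>0[of n y] by (simp add: abs_mult mult_ac)
      then show "AE y in lborel. norm (u y * \<eta> n y) \<le> \<bar>indicator (ball 0 (r + 1)) y *\<^sub>R u y\<bar>" by simp
    qed measurable
    then have 1: "(\<lambda>n. ennreal (\<integral>y. u y * \<eta> n y \<partial>lborel)) \<longlonglongrightarrow> ennreal (\<integral>y. u y * indicator K y \<partial>lborel)"
      by (rule tendsto_ennrealI)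
    have 2: "(\<lambda>n. \<integral>\<^sup>+y. ennreal (\<eta> n y) * B y \<partial>lborel) \<longlonglongrightarrow> (\<integral>\<^sup>+y. indicator K y * B y \<partial>lborel)"
    proof (rule nn_integral_dominated_convergence[where w="\<lambda>y. indicator (ball 0 (r + 1)) y * B y"])
      fix n
      show "AE y in lborel. ennreal (\<eta> n y) * B y \<le> indicator (ball 0 (r + 1)) y * B y"
      proof (intro AE_I2 mult_right_mono)
        fix y show "ennreal (\<eta> n y) \<le> indicator (ball 0 (r + 1)) y"
          using supp[of n y] by (cases "y \<in> ball 0 (r + 1)") (simp_all add: ennreal_neg)
      qed simp
      show "AE y in lborel. (\<lambda>n. ennreal (\<eta> n y) * B y) \<longlonglongrightarrow> indicator K y * B y"
      proof (intro AE_I2 tendsto_eventually)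
        fix y
        show "\<forall>\<^sub>F n in sequentially. ennreal (\<eta> n y) * B y = indicator K y * B y"
          using ev[of y] by eventually_elim (simp add: indicator_def)
      qed
    qed (use B in auto)
    show ?thesis
      using 1 2 by (rule LIMSEQ_le) (auto intro!: exI[of _ 0] test cont \<eta>0 supp)
  qed
  have null: "emeasure lborel {y \<in> ball 0 r. B y < ennreal (u y)} = 0" for r
  proof (rule ccontr)
    assume "emeasure lborel {y \<in> ball 0 r. B y < ennreal (u y)} \<noteq> 0"
    then have pos: "0 < emeasure lborel {y \<in> ball 0 r. B y < ennreal (u y)}"
      by (simp only: zero_less_iff_neq_zero) simp
    have bdd: "bounded {y \<in> ball 0 r. B y < ennreal (u y)}"
      by (rule bounded_subset[OF bounded_ball[of 0 r]]) auto
    have meas: "{y \<in> ball 0 r. B y < ennreal (u y)} \<in> sets borel"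
      by measurable
    obtain K where K: "compact K" "K \<subseteq> {y \<in> ball 0 r. B y < ennreal (u y)}" "0 < emeasure lborel K"
      using lborel_inner_compact[OF meas bdd pos] by (elim exE conjE)
    have [measurable]: "K \<in> sets borel" using K(1) by (simp add: borel_compact)
    have Kr: "K \<subseteq> ball 0 r" "K \<noteq> {}" using K by auto
    have upos: "0 \<le> u y" if "y \<in> K" for y
      using K(2) that by (cases "0 \<le> u y") (auto simp: ennreal_neg)
    have intK: "integrable lborel (\<lambda>y. u y * indicator K y)"
    proof (rule Bochner_Integration.integrable_bound[OF u[of r]])
      show "AE y in lborel. norm (u y * indicator K y) \<le> norm (indicator (ball 0 r) y *\<^sub>R u y)"
        by (intro AE_I2) (use Kr in \<open>auto simp: indicator_def\<close>)
    qed measurable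
    have "(\<integral>\<^sup>+y. indicator K y * ennreal (u y) \<partial>lborel) = (\<integral>\<^sup>+y. ennreal (u y * indicator K y) \<partial>lborel)"
      by (intro nn_integral_cong) (simp add: indicator_def)
    also have "\<dots> = ennreal (\<integral>y. u y * indicator K y \<partial>lborel)"
      by (intro nn_integral_eq_integral intK) (auto simp: indicator_def upos)
    also have "\<dots> \<le> (\<integral>\<^sup>+y. indicator K y * B y \<partial>lborel)"
      by (rule cpt[OF K(1) Kr(2,1)])
    finally have le: "(\<integral>\<^sup>+y. indicator K y * ennreal (u y) \<partial>lborel) \<le> (\<integral>\<^sup>+y. indicator K y * B y \<partial>lborel)" .
    have "(\<integral>\<^sup>+y. indicator K y * B y \<partial>lborel) \<le> (\<integral>\<^sup>+y. indicator (ball 0 r) y * B y \<partial>lborel)"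
      using Kr by (intro nn_integral_mono mult_right_mono) (auto simp: indicator_def)
    then have fin: "(\<integral>\<^sup>+y. indicator K y * B y \<partial>lborel) \<noteq> \<infinity>" using B[of r] by auto
    have "(\<integral>\<^sup>+y. indicator K y * ennreal (u y) - indicator K y * B y \<partial>lborel)
        = (\<integral>\<^sup>+y. indicator K y * ennreal (u y) \<partial>lborel) - (\<integral>\<^sup>+y. indicator K y * B y \<partial>lborel)"
    proof (intro nn_integral_diff fin AE_I2)
      fix y
      show "indicator K y * B y \<le> indicator K y * ennreal (u y)"
        using K(2) by (cases "y \<in> K") (auto intro: less_imp_le)
    qed measurable
    also have "\<dots> = 0"
      using le fin by (intro diff_eq_0_ennreal) (auto simp: less_top[symmetric] top_unique)
    finally have "AE y in lborel. indicator K y * ennreal (u y) - indicator K y * B y = 0"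
      by (subst (asm) nn_integral_0_iff_AE) measurable
    then have "AE y in lborel. y \<notin> K"
    proof eventually_elim
      case (elim y)
      show ?case
      proof
        assume y: "y \<in> K"
        then have "B y < ennreal (u y)" using K(2) by auto
        moreover from y elim have "ennreal (u y) - B y = 0" by simp
        ultimately show False using ennreal_minus_eq_0[of "ennreal (u y)" "B y"] by simp
      qed
    qed
    then have "emeasure lborel K = 0"
      by (subst (asm) AE_iff_measurable[of K]) auto
    then show False using K(3) by simp
  qed
  have "AE y in lborel. \<forall>n. \<not> (y \<in> ball 0 (real n) \<and> B y < ennreal (u y))"
    unfolding AE_all_countable
  proof
    fix n
    show "AE y in lborel. \<not> (y \<in> ball 0 (real n) \<and> B y < ennreal (u y))"
      using null[of "real n"] by (subst AE_iff_measurable[OF _ refl]) auto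
  qed
  then show ?thesis
  proof eventually_elim
    case (elim y)
    obtain n where "norm y < real n" using reals_Archimedean2 by blast
    then show ?case using elim[rule_format, of n] by (auto simp: not_less)
  qed
qed

text \<open>
  Pairing the uniform bound with a nonnegative test function and passing to the weak limit gives a tested inequality between
  \<open>bump_mass * u\<close> and \<open>B\<close>; the same holds for \<open>- u\<close>.
\<close>
lemma mollification_bound_imp_AE:
  fixes u :: "real ^ 3 \<Rightarrow> real" and B :: "real ^ 3 \<Rightarrow> ennreal"
  assumes [measurable]: "u \<in> borel_measurable borel" "B \<in> borel_measurable borel"
    and loc: "\<And>a r. integrable lborel (\<lambda>y. indicator (ball a r) y *\<^sub>R u y)"
    and B: "\<And>r. (\<integral>\<^sup>+y. indicator (ball 0 r) y * B y \<partial>lborel) < \<infinity>"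
    and R: "0 < R"
    and bound: "\<And>x s. 0 < s \<Longrightarrow> s \<le> R \<Longrightarrow> ennreal \<bar>\<integral>y. u y * (bump x s y / s ^ 3) \<partial>lborel\<bar> \<le> B x"
  shows "AE x in lborel. ennreal (bump_mass * \<bar>u x\<bar>) \<le> B x"
proof -
  define s where "s n = min 1 R / real (Suc n)" for n
  have s: "0 < s n" "s n \<le> 1" "s n \<le> R" for n
  proof -
    have "min 1 R / real (Suc n) \<le> min 1 R / 1" using R by (intro divide_left_mono) auto
    then show "0 < s n" "s n \<le> 1" "s n \<le> R" using R by (auto simp: s_def)
  qed
  have s_lim: "s \<longlonglongrightarrow> 0"
    unfolding s_def by (rule LIMSEQ_Suc[OF lim_const_over_n])
  have test: "ennreal \<bar>\<integral>y. u y * (bump_mass * \<eta> y) \<partial>lborel\<bar> \<le> (\<integral>\<^sup>+y. ennreal (\<eta> y) * B y \<partial>lborel)"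
    if \<eta>: "continuous_on UNIV \<eta>" "\<And>x. 0 \<le> \<eta> x" "\<And>x. \<eta> x \<le> indicator (ball 0 r) x" for \<eta> r
  proof -
    have [measurable]: "\<eta> \<in> borel_measurable borel" using \<eta>(1) by (rule borel_measurable_continuous_onI)
    have \<eta>': "\<bar>\<eta> x\<bar> \<le> indicator (ball 0 r) x" for x using \<eta>(2,3)[of x] by simp
    have lim: "(\<lambda>n. ennreal \<bar>\<integral>y. u y * (\<integral>w. \<eta> (y + s n *\<^sub>R w) * bump 0 1 w \<partial>lborel) \<partial>lborel\<bar>)
      \<longlonglongrightarrow> ennreal \<bar>\<integral>y. u y * (bump_mass * \<eta> y) \<partial>lborel\<bar>"
      by (intro tendsto_ennrealI tendsto_rabs mollified_tendsto[OF \<eta>(1) _ loc \<eta>' s(1,2) s_lim]) simp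
    have le: "ennreal \<bar>\<integral>y. u y * (\<integral>w. \<eta> (y + s n *\<^sub>R w) * bump 0 1 w \<partial>lborel) \<partial>lborel\<bar>
      \<le> (\<integral>\<^sup>+y. ennreal (\<eta> y) * B y \<partial>lborel)" for n
    proof -
      let ?U = "\<lambda>x. \<integral>y. u y * (bump x (s n) y / s n ^ 3) \<partial>lborel"
      have "ennreal \<bar>\<integral>y. u y * (\<integral>w. \<eta> (y + s n *\<^sub>R w) * bump 0 1 w \<partial>lborel) \<partial>lborel\<bar>
        = ennreal (norm (\<integral>x. \<eta> x * ?U x \<partial>lborel))"
        using integral_mollified[OF _ _ loc \<eta>' s(1)[of n]] by simp
      also have "\<dots> \<le> (\<integral>\<^sup>+x. ennreal (norm (\<eta> x * ?U x)) \<partial>lborel)"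
        by (rule norm_integral_le_nn_integral)
      also have "\<dots> \<le> (\<integral>\<^sup>+x. ennreal (\<eta> x) * B x \<partial>lborel)"
      proof (intro nn_integral_mono)
        fix x
        have "ennreal (norm (\<eta> x * ?U x)) = ennreal (\<eta> x) * ennreal \<bar>?U x\<bar>"
        proof -
          have "ennreal (norm (a * b)) = ennreal a * ennreal \<bar>b\<bar>" if "0 \<le> a" for a b :: real
            using that by (simp add: abs_mult ennreal_mult)
          then show ?thesis using \<eta>(2) .
        qed
        also have "\<dots> \<le> ennreal (\<eta> x) * B x"
          by (intro mult_left_mono bound s) simp
        finally show "ennreal (norm (\<eta> x * ?U x)) \<le> ennreal (\<eta> x) * B x" .
      qed
      finally show ?thesis .
    qed
    show ?thesis
      by (rule LIMSEQ_le_const2[OF lim]) (intro exI allI impI le)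
  qed
  have signed: "AE y in lborel. ennreal (\<sigma> * bump_mass * u y) \<le> B y" if \<sigma>: "\<bar>\<sigma>\<bar> = 1" for \<sigma> :: real
  proof (rule AE_le_of_test[OF _ _ _ B])
    show "integrable lborel (\<lambda>y. indicator (ball 0 r) y *\<^sub>R (\<sigma> * bump_mass * u y))" for r
      using integrable_mult_right[OF loc[of 0 r], of "\<sigma> * bump_mass"] by (simp add: mult_ac)
    fix \<eta> :: "real ^ 3 \<Rightarrow> real" and r
    assume \<eta>: "continuous_on UNIV \<eta>" "\<And>x. 0 \<le> \<eta> x" "\<And>x. \<eta> x \<le> indicator (ball 0 r) x"
    have "(\<integral>y. \<sigma> * bump_mass * u y * \<eta> y \<partial>lborel) = (\<integral>y. \<sigma> * (u y * (bump_mass * \<eta> y)) \<partial>lborel)"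
      by (intro Bochner_Integration.integral_cong refl) simp
    also have "\<dots> = \<sigma> * (\<integral>y. u y * (bump_mass * \<eta> y) \<partial>lborel)"
      by (rule Bochner_Integration.integral_mult_right_zero)
    also have "\<dots> \<le> \<bar>\<integral>y. u y * (bump_mass * \<eta> y) \<partial>lborel\<bar>"
    proof -
      have "\<sigma> * I \<le> \<bar>I\<bar>" for I
        using abs_ge_self[of "\<sigma> * I"] unfolding abs_mult \<sigma> by simp
      then show ?thesis .
    qed
    finally show "ennreal (\<integral>y. \<sigma> * bump_mass * u y * \<eta> y \<partial>lborel) \<le> (\<integral>\<^sup>+y. ennreal (\<eta> y) * B y \<partial>lborel)"
      by (rule order_trans[OF ennreal_leI test[OF \<eta>]])
  qed measurable
  have "AE x in lborel. ennreal (1 * bump_mass * u x) \<le> B x" "AE x in lborel. ennreal (-1 * bump_mass * u x) \<le> B x"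
    by (intro signed; simp)+
  then show ?thesis
  proof eventually_elim
    case (elim x)
    then show ?case by (cases "0 \<le> u x") simp_all
  qed
qed

section \<open>From the two-scale estimate to the interpolation inequality\<close>

text \<open>
  The bound of \<open>mollification_bound\<close> at scale \<open>R\<close>.
\<close>
definition local_majorant :: "real \<Rightarrow> (real ^ 3 \<Rightarrow> real) \<Rightarrow> (real ^ 3 \<Rightarrow> real ^ 3) \<Rightarrow> real ^ 3 \<Rightarrow> ennreal" where
  "local_majorant R u g x =
     (\<integral>\<^sup>+y. ennreal (1 / R ^ 3) * (indicator (ball x R) y * ennreal \<bar>u y\<bar>) \<partial>lborel)
      + (\<integral>\<^sup>+y. indicator (ball x R) y * ennreal (1 / (norm (x - y))\<^sup>2) * ennreal (norm (g y)) \<partial>lborel)"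

lemma borel_measurable_local_majorant [measurable]:
  assumes [measurable]: "u \<in> borel_measurable borel" "g \<in> borel_measurable borel"
  shows "local_majorant R u g \<in> borel_measurable borel"
proof -
  have "indicator (ball x R) y = (if dist x y < R then 1 else 0 :: ennreal)" for x y :: "real ^ 3"
    by simp
  then show ?thesis
    unfolding local_majorant_def[abs_def] by simp measurable
qed

lemma truncated_riesz_ge:
  assumes "\<bar>t\<bar> \<le> N" "0 < N" "N < R" "0 \<le> c"
  shows "ennreal (N powr (- c)) \<le> truncated_riesz c R t"
  using assms
  by (cases "t = 0") (auto simp: truncated_riesz_def riesz_kernel_def indicator_def intro!: ennreal_leI powr_mono2')

text \<open>
  Each coordinate difference is at most \<open>norm (x - y)\<close> in absolute value, and the exponents add up to 2.
\<close>
lemma inverse_square_le_truncated_riesz: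
  assumes c: "0 \<le> c1" "0 \<le> c2" "0 \<le> c3" "c1 + c2 + c3 = 2"
  shows "indicator (ball x R) y * ennreal (1 / (norm (x - y))\<^sup>2)
    \<le> truncated_riesz c1 R (x $ 1 - y $ 1) * truncated_riesz c2 R (x $ 2 - y $ 2) * truncated_riesz c3 R (x $ 3 - y $ (3::3))"
proof (cases "x \<noteq> y \<and> y \<in> ball x R")
  case True
  define N where "N = norm (x - y)"
  have N: "0 < N" "N < R" using True by (auto simp: N_def dist_norm)
  have co: "\<bar>x $ i - y $ i\<bar> \<le> N" for i
    using component_le_norm_cart[of "x - y" i] by (simp add: N_def)
  have "1 / N\<^sup>2 = N powr (- 2)" using N by (simp add: powr_minus inverse_eq_divide)
  also have "\<dots> = N powr (- c1) * N powr (- c2) * N powr (- c3)"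
  proof -
    have "- 2 = - c1 + - c2 + - c3" using c(4) by simp
    then show ?thesis by (simp only: powr_add)
  qed
  finally have "ennreal (1 / N\<^sup>2) = ennreal (N powr (- c1)) * ennreal (N powr (- c2)) * ennreal (N powr (- c3))"
    by (simp add: ennreal_mult)
  also have "\<dots> \<le> truncated_riesz c1 R (x $ 1 - y $ 1) * truncated_riesz c2 R (x $ 2 - y $ 2) * truncated_riesz c3 R (x $ 3 - y $ 3)"
    using c N co by (intro mult_mono truncated_riesz_ge) auto
  finally show ?thesis using True by (simp add: N_def)
qed auto

lemma indicator_ball_le_truncated_riesz:
  "indicator (ball x R) y
    \<le> truncated_riesz 0 R (x $ 1 - y $ 1) * truncated_riesz 0 R (x $ 2 - y $ 2) * truncated_riesz 0 R (x $ 3 - y $ (3::3))"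
proof (cases "y \<in> ball x R")
  case True
  have "1 \<le> truncated_riesz 0 R (x $ i - y $ i)" for i
  proof -
    have "\<bar>x $ i - y $ i\<bar> < R"
      using component_le_norm_cart[of "x - y" i] True by (simp add: dist_norm)
    then show ?thesis by (auto simp: truncated_riesz_def riesz_kernel_def indicator_def)
  qed
  then have "1 * 1 * 1 \<le> truncated_riesz 0 R (x $ 1 - y $ 1) * truncated_riesz 0 R (x $ 2 - y $ 2) * truncated_riesz 0 R (x $ 3 - y $ 3)"
    by (intro mult_mono) auto
  then show ?thesis using True by simp
qed simp

lemma local_majorant_le:
  assumes c: "0 \<le> c1" "0 \<le> c2" "0 \<le> c3" "c1 + c2 + c3 = 2" and [measurable]: "u \<in> borel_measurable borel"
  shows "local_majorant R u g x
    \<le> ennreal (1 / R ^ 3) * conv3 (truncated_riesz 0 R) (truncated_riesz 0 R) (truncated_riesz 0 R) (\<lambda>y. ennreal \<bar>u y\<bar>) x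
      + conv3 (truncated_riesz c1 R) (truncated_riesz c2 R) (truncated_riesz c3 R) (\<lambda>y. ennreal (norm (g y))) x"
  unfolding local_majorant_def
proof (rule add_mono)
  have "(\<integral>\<^sup>+y. ennreal (1 / R ^ 3) * (indicator (ball x R) y * ennreal \<bar>u y\<bar>) \<partial>lborel)
      = ennreal (1 / R ^ 3) * (\<integral>\<^sup>+y. indicator (ball x R) y * ennreal \<bar>u y\<bar> \<partial>lborel)"
  proof (rule nn_integral_cmult)
    have [measurable]: "ball x R \<in> sets borel" by simp
    show "(\<lambda>y. indicator (ball x R) y * ennreal \<bar>u y\<bar>) \<in> borel_measurable lborel" by measurable
  qed
  also have "\<dots> \<le> ennreal (1 / R ^ 3) * conv3 (truncated_riesz 0 R) (truncated_riesz 0 R) (truncated_riesz 0 R) (\<lambda>y. ennreal \<bar>u y\<bar>) x"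
    unfolding conv3_def by (intro mult_left_mono nn_integral_mono mult_right_mono indicator_ball_le_truncated_riesz) auto
  finally show "(\<integral>\<^sup>+y. ennreal (1 / R ^ 3) * (indicator (ball x R) y * ennreal \<bar>u y\<bar>) \<partial>lborel) \<le> \<dots>" .
  show "(\<integral>\<^sup>+y. indicator (ball x R) y * ennreal (1 / (norm (x - y))\<^sup>2) * ennreal (norm (g y)) \<partial>lborel)
    \<le> conv3 (truncated_riesz c1 R) (truncated_riesz c2 R) (truncated_riesz c3 R) (\<lambda>y. ennreal (norm (g y))) x"
    unfolding conv3_def by (intro nn_integral_mono mult_right_mono inverse_square_le_truncated_riesz c) auto
qed

text \<open>
  The exponents \<open>c q\<^sub>i\<close> are the critical ones \<open>e q\<^sub>i = 1/2 + 1/q\<^sub>i\<close>, shrunk by a common factor so that their sum is 2. The factor is at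
  most 1 because \<open>S \<ge> 1/2\<close>. That \<open>c q\<^sub>i < 1\<close> amounts to \<open>1/q\<^sub>i < 1/2 + 1/q\<^sub>j + 1/q\<^sub>k\<close>, which holds since \<open>1/q\<^sub>i \<le> 1/2\<close> and the
  other two reciprocals are positive; here finiteness of the exponents enters.
\<close>
lemma mixed_Lp_local_majorant_le:
  fixes q1 q2 q3 :: real
  assumes q: "2 \<le> q1" "2 \<le> q2" "2 \<le> q3" and S: "1 / 2 \<le> 1 / q1 + 1 / q2 + 1 / q3"
  defines "S \<equiv> 1 / q1 + 1 / q2 + 1 / q3"
  shows "\<exists>C>0. \<forall>R>0. \<forall>u \<in> borel_measurable borel. \<forall>g \<in> borel_measurable borel.
    mixed_Lp q1 q2 q3 (local_majorant R u g)
      \<le> ennreal (C * R powr (S - 3 / 2)) * Lp_norm 2 (\<lambda>y. ennreal \<bar>u y\<bar>)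
        + ennreal (C * R powr (S - 1 / 2)) * Lp_norm 2 (\<lambda>y. ennreal (norm (g y)))"
proof -
  define e where "e q = 1 / 2 + 1 / q" for q :: real
  define c where "c q = e q * (2 / (3 / 2 + S))" for q
  have e_sum: "e q1 + e q2 + e q3 = 3 / 2 + S" by (simp add: e_def S_def)
  have S': "2 \<le> 3 / 2 + S" using S by (simp add: S_def)
  have pos: "0 < 1 / q1" "0 < 1 / q2" "0 < 1 / q3" using q by auto
  have half: "1 / q1 \<le> 1 / 2" "1 / q2 \<le> 1 / 2" "1 / q3 \<le> 1 / 2" using q by (auto simp: field_simps)
  have e_pos: "0 < e q1" "0 < e q2" "0 < e q3" using pos unfolding e_def by linarith+
  have c_le: "c q \<le> e q" "0 \<le> c q" if "0 < e q" for q
  proof -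
    have "2 / (3 / 2 + S) \<le> 1" using S' by simp
    then show "c q \<le> e q" "0 \<le> c q"
      using mult_left_mono[of "2 / (3 / 2 + S)" 1 "e q"] that S' by (simp_all add: c_def)
  qed
  have c_less: "c q < 1" if "2 * e q < 3 / 2 + S" for q
    using that S' by (simp add: c_def field_simps)
  have c_less': "c q1 < 1" "c q2 < 1" "c q3 < 1"
  proof -
    have "2 * (1 / 2 + x) < 3 / 2 + (x + y + z)" "2 * (1 / 2 + x) < 3 / 2 + (y + x + z)"
      "2 * (1 / 2 + x) < 3 / 2 + (y + z + x)" if "x \<le> 1 / 2" "0 < y" "0 < z" for x y z :: real
      using that by simp_all
    from this(1)[OF half(1) pos(2,3)] this(2)[OF half(2) pos(1,3)] this(3)[OF half(3) pos(1,2)]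
    have "2 * e q1 < 3 / 2 + S" "2 * e q2 < 3 / 2 + S" "2 * e q3 < 3 / 2 + S"
      unfolding e_def S_def .
    then show "c q1 < 1" "c q2 < 1" "c q3 < 1" by (auto intro: c_less)
  qed
  have c_sum: "c q1 + c q2 + c q3 = 2"
  proof -
    have "c q1 + c q2 + c q3 = (e q1 + e q2 + e q3) * (2 / (3 / 2 + S))"
      by (simp only: c_def distrib_right)
    also have "\<dots> = (3 / 2 + S) * (2 / (3 / 2 + S))" unfolding e_sum ..
    also have "\<dots> = 2"
    proof -
      have "t * (2 / t) = 2" if "2 \<le> t" for t :: real using that by simp
      then show ?thesis using S' .
    qed
    finally show ?thesis .
  qed
  have "\<exists>C>0. \<forall>R>0. conv_bounded q (truncated_riesz c' R) (C * R powr (e q - c'))"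
    if "2 \<le> q" "0 \<le> c'" "c' \<le> e q" "c' < 1" for q c'
    using truncated_riesz_conv_bounded[of q c'] that unfolding e_def by metis
  note ex = this
  obtain A1 where A1: "A1 > 0" "\<And>R. R > 0 \<Longrightarrow> conv_bounded q1 (truncated_riesz 0 R) (A1 * R powr (e q1 - 0))"
    using ex[of q1 0] q e_pos by auto
  obtain A2 where A2: "A2 > 0" "\<And>R. R > 0 \<Longrightarrow> conv_bounded q2 (truncated_riesz 0 R) (A2 * R powr (e q2 - 0))"
    using ex[of q2 0] q e_pos by auto
  obtain A3 where A3: "A3 > 0" "\<And>R. R > 0 \<Longrightarrow> conv_bounded q3 (truncated_riesz 0 R) (A3 * R powr (e q3 - 0))"
    using ex[of q3 0] q e_pos by auto
  obtain D1 where D1: "D1 > 0" "\<And>R. R > 0 \<Longrightarrow> conv_bounded q1 (truncated_riesz (c q1) R) (D1 * R powr (e q1 - c q1))"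
    using ex[of q1 "c q1"] q c_le e_pos c_less' by auto
  obtain D2 where D2: "D2 > 0" "\<And>R. R > 0 \<Longrightarrow> conv_bounded q2 (truncated_riesz (c q2) R) (D2 * R powr (e q2 - c q2))"
    using ex[of q2 "c q2"] q c_le e_pos c_less' by auto
  obtain D3 where D3: "D3 > 0" "\<And>R. R > 0 \<Longrightarrow> conv_bounded q3 (truncated_riesz (c q3) R) (D3 * R powr (e q3 - c q3))"
    using ex[of q3 "c q3"] q c_le e_pos c_less' by auto
  define C where "C = max (A1 * A2 * A3) (D1 * D2 * D3)"
  show ?thesis
  proof (intro exI[of _ C] conjI allI impI ballI)
    show "0 < C" using A1(1) A2(1) A3(1) by (simp add: C_def less_max_iff_disj)
    fix R :: real and u :: "real ^ 3 \<Rightarrow> real" and g :: "real ^ 3 \<Rightarrow> real ^ 3"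
    assume R: "0 < R" and [measurable]: "u \<in> borel_measurable borel" "g \<in> borel_measurable borel"
    let ?u = "\<lambda>y. ennreal \<bar>u y\<bar>" and ?g = "\<lambda>y. ennreal (norm (g y))"
    let ?U = "conv3 (truncated_riesz 0 R) (truncated_riesz 0 R) (truncated_riesz 0 R) ?u"
    let ?G = "conv3 (truncated_riesz (c q1) R) (truncated_riesz (c q2) R) (truncated_riesz (c q3) R) ?g"
    have "mixed_Lp q1 q2 q3 (local_majorant R u g) \<le> mixed_Lp q1 q2 q3 (\<lambda>x. ennreal (1 / R ^ 3) * ?U x + ?G x)"
      using q c_le e_pos c_sum by (intro mixed_Lp_mono_AE AE_I2 local_majorant_le) auto
    also have "\<dots> \<le> mixed_Lp q1 q2 q3 (\<lambda>x. ennreal (1 / R ^ 3) * ?U x) + mixed_Lp q1 q2 q3 ?G"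
      using q by (intro mixed_Lp_add_le) auto
    finally have split: "mixed_Lp q1 q2 q3 (local_majorant R u g)
      \<le> mixed_Lp q1 q2 q3 (\<lambda>x. ennreal (1 / R ^ 3) * ?U x) + mixed_Lp q1 q2 q3 ?G" .
    have "mixed_Lp q1 q2 q3 (\<lambda>x. ennreal (1 / R ^ 3) * ?U x) = ennreal (1 / R ^ 3) * mixed_Lp q1 q2 q3 ?U"
      using q by (intro mixed_Lp_cmult) auto
    also have "\<dots> \<le> ennreal (1 / R ^ 3) * (ennreal ((A1 * R powr (e q1 - 0)) * (A2 * R powr (e q2 - 0)) * (A3 * R powr (e q3 - 0))) * Lp_norm 2 ?u)"
      using q R by (intro mult_left_mono mixed_Lp_conv3_le A1 A2 A3) auto
    also have "\<dots> = ennreal (1 / R ^ 3 * ((A1 * R powr (e q1 - 0)) * (A2 * R powr (e q2 - 0)) * (A3 * R powr (e q3 - 0)))) * Lp_norm 2 ?u"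
      using R A1(1) A2(1) A3(1) by (subst ennreal_mult) (auto simp: mult.assoc)
    also have "\<dots> \<le> ennreal (C * R powr (S - 3 / 2)) * Lp_norm 2 ?u"
    proof (intro mult_right_mono ennreal_leI)
      have "1 / R ^ 3 * ((A1 * R powr (e q1 - 0)) * (A2 * R powr (e q2 - 0)) * (A3 * R powr (e q3 - 0)))
          = A1 * A2 * A3 * (R powr (- 3) * (R powr e q1 * R powr e q2 * R powr e q3))"
        using R by (simp add: powr_minus inverse_eq_divide)
      also have "R powr (- 3) * (R powr e q1 * R powr e q2 * R powr e q3) = R powr (S - 3 / 2)"
        unfolding powr_add[symmetric] e_sum by simp
      finally have eq: "1 / R ^ 3 * ((A1 * R powr (e q1 - 0)) * (A2 * R powr (e q2 - 0)) * (A3 * R powr (e q3 - 0))) = A1 * A2 * A3 * R powr (S - 3 / 2)" .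
      show "1 / R ^ 3 * ((A1 * R powr (e q1 - 0)) * (A2 * R powr (e q2 - 0)) * (A3 * R powr (e q3 - 0))) \<le> C * R powr (S - 3 / 2)"
        unfolding eq C_def by (intro mult_right_mono) auto
    qed simp
    finally have U_le: "mixed_Lp q1 q2 q3 (\<lambda>x. ennreal (1 / R ^ 3) * ?U x) \<le> ennreal (C * R powr (S - 3 / 2)) * Lp_norm 2 ?u" .
    have "mixed_Lp q1 q2 q3 ?G \<le> ennreal ((D1 * R powr (e q1 - c q1)) * (D2 * R powr (e q2 - c q2)) * (D3 * R powr (e q3 - c q3))) * Lp_norm 2 ?g"
      using q R by (intro mixed_Lp_conv3_le D1 D2 D3) auto
    also have "\<dots> \<le> ennreal (C * R powr (S - 1 / 2)) * Lp_norm 2 ?g"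
    proof (intro mult_right_mono ennreal_leI)
      have "(D1 * R powr (e q1 - c q1)) * (D2 * R powr (e q2 - c q2)) * (D3 * R powr (e q3 - c q3))
          = D1 * D2 * D3 * (R powr (e q1 - c q1) * R powr (e q2 - c q2) * R powr (e q3 - c q3))"
        by simp
      also have "R powr (e q1 - c q1) * R powr (e q2 - c q2) * R powr (e q3 - c q3) = R powr (S - 1 / 2)"
      proof -
        have "e q1 - c q1 + (e q2 - c q2) + (e q3 - c q3) = S - 1 / 2"
          using e_sum c_sum by linarith
        then show ?thesis unfolding powr_add[symmetric] by (simp only:)
      qed
      finally have eq: "(D1 * R powr (e q1 - c q1)) * (D2 * R powr (e q2 - c q2)) * (D3 * R powr (e q3 - c q3)) = D1 * D2 * D3 * R powr (S - 1 / 2)" .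
      show "(D1 * R powr (e q1 - c q1)) * (D2 * R powr (e q2 - c q2)) * (D3 * R powr (e q3 - c q3)) \<le> C * R powr (S - 1 / 2)"
        unfolding eq C_def by (intro mult_right_mono) auto
    qed simp
    finally have G_le: "mixed_Lp q1 q2 q3 ?G \<le> ennreal (C * R powr (S - 1 / 2)) * Lp_norm 2 ?g" .
    show "mixed_Lp q1 q2 q3 (local_majorant R u g)
      \<le> ennreal (C * R powr (S - 3 / 2)) * Lp_norm 2 ?u + ennreal (C * R powr (S - 1 / 2)) * Lp_norm 2 ?g"
      using split add_mono[OF U_le G_le] by (rule order_trans)
  qed
qed

text \<open>
  For the exponents \<open>(2, 2, 2)\<close> the mixed norm is the \<open>L\<^sup>2\<close> norm, so the majorant is square integrable, and \<open>B \<le> 1 + B\<^sup>2\<close>.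
\<close>
lemma local_majorant_locally_integrable:
  assumes [measurable]: "u \<in> borel_measurable borel" "g \<in> borel_measurable borel"
    and fin: "Lp_norm 2 (\<lambda>y. ennreal \<bar>u y\<bar>) < \<infinity>" "Lp_norm 2 (\<lambda>y. ennreal (norm (g y))) < \<infinity>" and R: "0 < R"
  shows "(\<integral>\<^sup>+y. indicator (ball 0 r) y * local_majorant R u g y \<partial>lborel) < \<infinity>"
proof -
  let ?B = "local_majorant R u g"
  have [measurable]: "ball 0 r \<in> sets (borel :: (real ^ 3) measure)" by simp
  obtain C where "mixed_Lp 2 2 2 ?B \<le> ennreal (C * R powr ((1/2 + 1/2 + 1/2) - 3 / 2)) * Lp_norm 2 (\<lambda>y. ennreal \<bar>u y\<bar>)
        + ennreal (C * R powr ((1/2 + 1/2 + 1/2) - 1 / 2)) * Lp_norm 2 (\<lambda>y. ennreal (norm (g y)))"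
  proof -
    have pre: "(2::real) \<le> 2" "1 / 2 \<le> 1/2 + 1/2 + (1/2 :: real)" by simp_all
    then show ?thesis
      using mixed_Lp_local_majorant_le[OF pre(1) pre(1) pre(1) pre(2)] R assms(1,2) that by blast
  qed
  also have "\<dots> < \<infinity>" using fin by (simp add: ennreal_mult_less_top)
  finally have "Lp_norm 2 ?B < \<infinity>" by (simp add: mixed_Lp_same)
  then have "ennreal_powr (Lp_norm 2 ?B) 2 \<noteq> top" by (simp add: less_top[symmetric])
  then have "(\<integral>\<^sup>+y. ennreal_powr (?B y) 2 \<partial>lborel) \<noteq> top" by (simp only: Lp_norm_powr) simp
  then have sq: "(\<integral>\<^sup>+y. ?B y * ?B y \<partial>lborel) < \<infinity>" by (simp add: ennreal_powr_two less_top)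
  have "(\<integral>\<^sup>+y. indicator (ball 0 r) y * ?B y \<partial>lborel) \<le> (\<integral>\<^sup>+y. indicator (ball 0 r) y + ?B y * ?B y \<partial>lborel)"
  proof (intro nn_integral_mono)
    fix y
    have "?B y \<le> 1 + ?B y * ?B y"
    proof (cases "?B y \<le> 1")
      case False
      then have "?B y * 1 \<le> ?B y * ?B y" by (intro mult_left_mono) auto
      then show ?thesis by (simp add: add_increasing)
    qed (simp add: add_increasing2)
    then show "indicator (ball 0 r) y * ?B y \<le> indicator (ball 0 r) y + ?B y * ?B y"
      by (simp add: indicator_def)
  qed
  also have "\<dots> = emeasure lborel (ball (0 :: real ^ 3) r) + (\<integral>\<^sup>+y. ?B y * ?B y \<partial>lborel)"
    by (subst nn_integral_add) auto
  also have "\<dots> < \<infinity>" using sq emeasure_lborel_ball_finite[of "0 :: real ^ 3" r] by simp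
  finally show ?thesis .
qed

text \<open>
  The almost everywhere bound of \<open>|u|\<close> by its majorant, combined with the mixed norm estimate for the majorant.
\<close>
lemma mixed_norm_two_scale:
  fixes q1 q2 q3 :: real
  assumes q: "2 \<le> q1" "2 \<le> q2" "2 \<le> q3" and S: "1 / 2 \<le> 1 / q1 + 1 / q2 + 1 / q3"
  defines "S \<equiv> 1 / q1 + 1 / q2 + 1 / q3"
  shows "\<exists>C>0. \<forall>u g a b R. borel_weak_gradient u g \<longrightarrow>
    Lp_norm 2 (\<lambda>y. ennreal \<bar>u y\<bar>) = ennreal a \<longrightarrow> Lp_norm 2 (\<lambda>y. ennreal (norm (g y))) = ennreal b \<longrightarrow>
    0 \<le> a \<longrightarrow> 0 \<le> b \<longrightarrow> 0 < R \<longrightarrow>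
    mixed_norm q1 q2 q3 u \<le> ennreal (C * (R powr (S - 3 / 2) * a + R powr (S - 1 / 2) * b))"
proof -
  obtain C where C: "C > 0" "\<And>R u g. R > 0 \<Longrightarrow> u \<in> borel_measurable borel \<Longrightarrow> g \<in> borel_measurable borel \<Longrightarrow>
    mixed_Lp q1 q2 q3 (local_majorant R u g)
      \<le> ennreal (C * R powr (S - 3 / 2)) * Lp_norm 2 (\<lambda>y. ennreal \<bar>u y\<bar>)
        + ennreal (C * R powr (S - 1 / 2)) * Lp_norm 2 (\<lambda>y. ennreal (norm (g y)))"
    using mixed_Lp_local_majorant_le[OF q S] unfolding S_def by blast
  show ?thesis
  proof (intro exI[of _ "C / bump_mass"] conjI allI impI)
    show "0 < C / bump_mass" using C(1) bump_mass_pos by simp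
    fix u :: "real ^ 3 \<Rightarrow> real" and g :: "real ^ 3 \<Rightarrow> real ^ 3" and a b R :: real
    assume ug: "borel_weak_gradient u g" and a: "Lp_norm 2 (\<lambda>y. ennreal \<bar>u y\<bar>) = ennreal a"
      and b: "Lp_norm 2 (\<lambda>y. ennreal (norm (g y))) = ennreal b" and ab: "0 \<le> a" "0 \<le> b" and R: "0 < R"
    have [measurable]: "u \<in> borel_measurable borel" "g \<in> borel_measurable borel"
      and loc: "\<And>a r. integrable lborel (\<lambda>y. indicator (ball a r) y *\<^sub>R u y)"
      using ug by (auto simp: borel_weak_gradient_def)
    have "AE x in lborel. ennreal (bump_mass * \<bar>u x\<bar>) \<le> local_majorant R u g x"
    proof (rule mollification_bound_imp_AE[OF _ _ loc _ R])
      show "(\<integral>\<^sup>+y. indicator (ball 0 r) y * local_majorant R u g y \<partial>lborel) < \<infinity>" for r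
        using R by (intro local_majorant_locally_integrable) (auto simp: a b)
      show "ennreal \<bar>\<integral>y. u y * (bump x s y / s ^ 3) \<partial>lborel\<bar> \<le> local_majorant R u g x"
        if "0 < s" "s \<le> R" for x s
        unfolding local_majorant_def by (rule mollification_bound[OF ug that])
    qed measurable
    then have "AE x in lborel. ennreal \<bar>u x\<bar> \<le> ennreal (1 / bump_mass) * local_majorant R u g x"
    proof eventually_elim
      case (elim x)
      then have "ennreal (1 / bump_mass) * ennreal (bump_mass * \<bar>u x\<bar>) \<le> ennreal (1 / bump_mass) * local_majorant R u g x"
        by (rule mult_left_mono) simp
      then show ?case using bump_mass_pos by (simp add: ennreal_mult[symmetric])
    qed
    then have "mixed_norm q1 q2 q3 u \<le> mixed_Lp q1 q2 q3 (\<lambda>x. ennreal (1 / bump_mass) * local_majorant R u g x)"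
      unfolding mixed_norm_eq using q by (intro mixed_Lp_mono_AE) auto
    also have "\<dots> = ennreal (1 / bump_mass) * mixed_Lp q1 q2 q3 (local_majorant R u g)"
      using q by (intro mixed_Lp_cmult) auto
    also have "\<dots> \<le> ennreal (1 / bump_mass) * (ennreal (C * R powr (S - 3 / 2)) * ennreal a + ennreal (C * R powr (S - 1 / 2)) * ennreal b)"
      using C(2)[OF R, of u g] by (intro mult_left_mono) (auto simp: a b)
    also have "\<dots> = ennreal (1 / bump_mass * (C * R powr (S - 3 / 2) * a + C * R powr (S - 1 / 2) * b))"
    proof -
      have "ennreal k * (ennreal P * ennreal a + ennreal Q * ennreal b) = ennreal (k * (P * a + Q * b))"
        if "0 \<le> k" "0 \<le> P" "0 \<le> Q" for k P Q
        using that ab by (simp add: ennreal_mult[symmetric] ennreal_plus[symmetric] del: ennreal_plus)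
      then show ?thesis using C(1) bump_mass_pos by simp
    qed
    also have "1 / bump_mass * (C * R powr (S - 3 / 2) * a + C * R powr (S - 1 / 2) * b)
        = C / bump_mass * (R powr (S - 3 / 2) * a + R powr (S - 1 / 2) * b)"
      by (simp add: distrib_left mult_ac)
    finally show "mixed_norm q1 q2 q3 u \<le> ennreal (C / bump_mass * (R powr (S - 3 / 2) * a + R powr (S - 1 / 2) * b))" .
  qed
qed

text \<open>
  For the exponents \<open>(6, 6, 6)\<close> the two-scale estimate reads \<open>\<parallel>u\<parallel>\<^sub>6 \<le> C \<parallel>u\<parallel>\<^sub>2 / R\<close>, and \<open>R\<close> is arbitrary.
\<close>
lemma weak_gradient_zero_imp_zero:
  assumes ug: "borel_weak_gradient u g" and a: "Lp_norm 2 (\<lambda>y. ennreal \<bar>u y\<bar>) = ennreal a" "0 \<le> a"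
    and g: "Lp_norm 2 (\<lambda>y. ennreal (norm (g y))) = 0"
  shows "AE x in lborel. u x = 0"
proof -
  have [measurable]: "u \<in> borel_measurable borel" using ug by (simp add: borel_weak_gradient_def)
  obtain C where C: "C > 0" "\<And>R. R > 0 \<Longrightarrow> mixed_norm 6 6 6 u \<le> ennreal (C * (R powr (- 1) * a))"
  proof -
    obtain C where C: "C > 0" "\<forall>u g a b R. borel_weak_gradient u g \<longrightarrow>
      Lp_norm 2 (\<lambda>y. ennreal \<bar>u y\<bar>) = ennreal a \<longrightarrow> Lp_norm 2 (\<lambda>y. ennreal (norm (g y))) = ennreal b \<longrightarrow>
      0 \<le> a \<longrightarrow> 0 \<le> b \<longrightarrow> 0 < R \<longrightarrow>
      mixed_norm 6 6 6 u \<le> ennreal (C * (R powr (1/6 + 1/6 + 1/6 - 3 / 2) * a + R powr (1/6 + 1/6 + 1/6 - 1 / 2) * b))"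
      using mixed_norm_two_scale[of 6 6 6] by auto
    have "mixed_norm 6 6 6 u \<le> ennreal (C * (R powr (- 1) * a))" if "R > 0" for R
      using C(2)[rule_format, OF ug a(1), of 0 R] g a(2) that by simp
    then show ?thesis using that C(1) by blast
  qed
  have "mixed_norm 6 6 6 u = 0"
  proof (rule ccontr)
    assume "mixed_norm 6 6 6 u \<noteq> 0"
    moreover have "mixed_norm 6 6 6 u \<le> ennreal (C * (1 powr (- 1) * a))" by (rule C(2)) simp
    ultimately obtain m where m: "mixed_norm 6 6 6 u = ennreal m" "0 < m"
      by (cases "mixed_norm 6 6 6 u") (auto simp: top_unique less_le)
    have le: "m \<le> C * (R powr (- 1) * a)" if "R > 0" for R
      using C(2)[OF that] C(1) a(2) that by (simp add: m(1))
    have "0 < a" using le[of 1] m(2) C(1) a(2) by (cases "a = 0") auto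
    then have "m \<le> m / 2" using le[of "2 * C * a / m"] m(2) C(1) by (simp add: powr_minus field_simps)
    then show False using m(2) by simp
  qed
  then show ?thesis
    by (simp add: mixed_norm_eq mixed_Lp_same Lp_norm_eq_0_iff)
qed

text \<open>
  The scale \<open>R = a / b\<close> makes both terms of the two-scale estimate equal.
\<close>
lemma borel_weak_gradient_interpolation:
  fixes q1 q2 q3 :: real
  assumes q: "2 \<le> q1" "2 \<le> q2" "2 \<le> q3" and S: "1 / 2 \<le> 1 / q1 + 1 / q2 + 1 / q3"
  defines "S \<equiv> 1 / q1 + 1 / q2 + 1 / q3"
  shows "\<exists>C>0. \<forall>u g a b. borel_weak_gradient u g \<longrightarrow>
    Lp_norm 2 (\<lambda>y. ennreal \<bar>u y\<bar>) = ennreal a \<longrightarrow> Lp_norm 2 (\<lambda>y. ennreal (norm (g y))) = ennreal b \<longrightarrow>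
    0 \<le> a \<longrightarrow> 0 \<le> b \<longrightarrow>
    mixed_norm q1 q2 q3 u \<le> ennreal (C * b powr (3 / 2 - S) * a powr (S - 1 / 2))"
proof -
  obtain C where C: "C > 0" "\<forall>u g a b R. borel_weak_gradient u g \<longrightarrow>
    Lp_norm 2 (\<lambda>y. ennreal \<bar>u y\<bar>) = ennreal a \<longrightarrow> Lp_norm 2 (\<lambda>y. ennreal (norm (g y))) = ennreal b \<longrightarrow>
    0 \<le> a \<longrightarrow> 0 \<le> b \<longrightarrow> 0 < R \<longrightarrow>
    mixed_norm q1 q2 q3 u \<le> ennreal (C * (R powr (S - 3 / 2) * a + R powr (S - 1 / 2) * b))"
    using mixed_norm_two_scale[OF q S] unfolding S_def by blast
  show ?thesis
  proof (intro exI[of _ "2 * C"] conjI allI impI)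
    show "0 < 2 * C" using C(1) by simp
    fix u :: "real ^ 3 \<Rightarrow> real" and g :: "real ^ 3 \<Rightarrow> real ^ 3" and a b :: real
    assume ug: "borel_weak_gradient u g" and a: "Lp_norm 2 (\<lambda>y. ennreal \<bar>u y\<bar>) = ennreal a"
      and b: "Lp_norm 2 (\<lambda>y. ennreal (norm (g y))) = ennreal b" and ab: "0 \<le> a" "0 \<le> b"
    have [measurable]: "u \<in> borel_measurable borel" using ug by (simp add: borel_weak_gradient_def)
    show "mixed_norm q1 q2 q3 u \<le> ennreal (2 * C * b powr (3 / 2 - S) * a powr (S - 1 / 2))"
    proof (cases "a = 0 \<or> b = 0")
      case True
      \<comment> \<open>The right-hand side may be \<open>0\<close> even if the exponent of the vanishing norm is \<open>0\<close>, as \<open>0 powr 0 = 0\<close>; so \<open>u = 0\<close> has to be shown.\<close>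
      have "AE x in lborel. u x = 0"
      proof (cases "a = 0")
        case True
        then show ?thesis using a by (simp add: Lp_norm_eq_0_iff)
      next
        case False
        then show ?thesis using True weak_gradient_zero_imp_zero[OF ug a ab(1)] b by simp
      qed
      then have "mixed_norm q1 q2 q3 u \<le> mixed_Lp q1 q2 q3 (\<lambda>x. 0)"
        unfolding mixed_norm_eq using q by (intro mixed_Lp_mono_AE) auto
      also have "\<dots> = 0" by (simp add: mixed_Lp_def Lp_norm_lborel)
      finally show ?thesis by simp
    next
      case False
      then have ab': "0 < a" "0 < b" using ab by auto
      define R where "R = a / b"
      have R: "0 < R" using ab' by (simp add: R_def)
      have Rz: "R powr z = a powr z * b powr (- z)" for z
        using ab' by (simp add: R_def powr_divide powr_minus_divide)
      have e1: "R powr (S - 3 / 2) * a = b powr (3 / 2 - S) * a powr (S - 1 / 2)"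
      proof -
        have "R powr (S - 3 / 2) * a = a powr (S - 3 / 2) * a powr 1 * b powr (- (S - 3 / 2))"
          using ab' unfolding Rz by simp
        also have "a powr (S - 3 / 2) * a powr 1 = a powr (S - 1 / 2)"
          unfolding powr_add[symmetric] by simp
        finally show ?thesis by simp
      qed
      have e2: "R powr (S - 1 / 2) * b = b powr (3 / 2 - S) * a powr (S - 1 / 2)"
      proof -
        have "R powr (S - 1 / 2) * b = a powr (S - 1 / 2) * (b powr (- (S - 1 / 2)) * b powr 1)"
          using ab' unfolding Rz by simp
        also have "b powr (- (S - 1 / 2)) * b powr 1 = b powr (3 / 2 - S)"
          unfolding powr_add[symmetric] by simp
        finally show ?thesis by simp
      qed
      have "C * (X + X) = 2 * C * X" for X by simp
      then show ?thesis
        using C(2)[rule_format, OF ug a b ab R] unfolding e1 e2 by (simp only: mult.assoc)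
    qed
  qed
qed

text \<open>
  Weak gradients are insensitive to null sets, so Lebesgue measurable data may be replaced by Borel functions. The sections of the latter
  in every coordinate are measurable, which Tonelli's theorem for the Borel product measure requires.
\<close>
lemma borel_representative:
  assumes u: "u \<in> borel_measurable lebesgue" and Du: "Du \<in> borel_measurable lebesgue"
    and weak: "has_weak_gradient u Du"
  shows "\<exists>u' g'. borel_weak_gradient u' g' \<and> (AE x in lborel. u x = u' x) \<and> (AE x in lborel. Du x = g' x)"
proof -
  obtain u' where u' [measurable]: "u' \<in> borel_measurable borel" and uu': "AE x in lborel. u x = u' x"
    using completion_ex_borel_measurable_real[OF u] by auto
  have "\<exists>g' \<in> borel_measurable borel. AE x in lborel. Du x $ i = g' x" for i
    using completion_ex_borel_measurable_real[OF borel_measurable_vec_nth_comp[OF Du, of i]] by auto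
  then obtain h where h [measurable]: "\<And>i. h i \<in> borel_measurable borel"
    and hD: "\<And>i. AE x in lborel. Du x $ i = h i x" by metis
  define g' :: "real ^ 3 \<Rightarrow> real ^ 3" where "g' x = vector [h 1 x, h 2 x, h 3 x]" for x
  have g' [measurable]: "g' \<in> borel_measurable borel" unfolding g'_def by (rule borel_measurable_vector_3[OF h h h])
  have gg': "AE x in lborel. Du x = g' x"
    using hD[of 1] hD[of 2] hD[of 3]
    by eventually_elim (simp only: vec_eq_iff forall_3 g'_def vector_3)
  have leb [measurable]: "u' \<in> borel_measurable lebesgue" "g' \<in> borel_measurable lebesgue"
    using u' g' by (simp_all add: measurable_completion)
  note [measurable] = u Du
  have loc: "integrable lborel (\<lambda>y. indicator (ball a r) y *\<^sub>R f' y)"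
    if "\<And>K. compact K \<Longrightarrow> f absolutely_integrable_on K" and [measurable]: "f' \<in> borel_measurable borel"
      and f [measurable]: "f \<in> borel_measurable lebesgue" and ff: "AE x in lborel. f x = f' x"
    for f f' :: "real ^ 3 \<Rightarrow> 'c::euclidean_space" and a r
  proof -
    have "set_integrable lebesgue (ball a r) f"
      by (rule set_integrable_subset[OF that(1)[OF compact_cball[of a r]]]) auto
    then have 1: "integrable lebesgue (\<lambda>y. indicator (ball a r) y *\<^sub>R f y)"
      by (simp add: set_integrable_def)
    have [measurable]: "f' \<in> borel_measurable lebesgue" by (simp add: measurable_completion)
    have [measurable]: "ball a r \<in> sets borel" "ball a r \<in> sets lebesgue" by simp_all
    have "AE y in lebesgue. indicator (ball a r) y *\<^sub>R f y = indicator (ball a r) y *\<^sub>R f' y"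
      using AE_completion[OF ff] by eventually_elim simp
    then have "integrable lebesgue (\<lambda>y. indicator (ball a r) y *\<^sub>R f' y)"
      using 1 by (subst (asm) integrable_cong_AE) auto
    then show ?thesis by (subst (asm) integrable_completion) auto
  qed
  have weak': "(\<integral>y. u' y * partial i \<phi> y \<partial>lborel) = - (\<integral>y. g' y $ i * \<phi> y \<partial>lborel)" if \<phi>: "test_function \<phi>" for \<phi> i
  proof -
    have C: "C_k 0 \<phi>" "C_k 1 \<phi>" using \<phi> unfolding test_function_def by blast+
    have [measurable]: "\<phi> \<in> borel_measurable borel"
      using C(1) by (auto intro: borel_measurable_continuous_onI)
    have [measurable]: "partial i \<phi> \<in> borel_measurable borel"
      using C(2) by (auto intro: borel_measurable_continuous_onI)
    have [measurable]: "\<phi> \<in> borel_measurable lebesgue" "partial i \<phi> \<in> borel_measurable lebesgue"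
      by (simp_all add: measurable_completion)
    have "(\<integral>y. u' y * partial i \<phi> y \<partial>lborel) = (\<integral>y. u' y * partial i \<phi> y \<partial>lebesgue)"
      by (subst integral_completion) auto
    also have "\<dots> = (\<integral>y. u y * partial i \<phi> y \<partial>lebesgue)"
    proof (rule integral_cong_AE)
      show "AE y in lebesgue. u' y * partial i \<phi> y = u y * partial i \<phi> y"
        using AE_completion[OF uu'] by eventually_elim simp
    qed measurable
    also have "\<dots> = - (\<integral>y. Du y $ i * \<phi> y \<partial>lebesgue)"
      using weak \<phi> by (simp add: has_weak_gradient_def)
    also have "(\<integral>y. Du y $ i * \<phi> y \<partial>lebesgue) = (\<integral>y. g' y $ i * \<phi> y \<partial>lebesgue)"
    proof (rule integral_cong_AE)
      show "AE y in lebesgue. Du y $ i * \<phi> y = g' y $ i * \<phi> y"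
        using AE_completion[OF gg'] by eventually_elim simp
    qed measurable
    also have "\<dots> = (\<integral>y. g' y $ i * \<phi> y \<partial>lborel)"
      by (subst integral_completion) auto
    finally show ?thesis .
  qed
  have "borel_weak_gradient u' g'"
    unfolding borel_weak_gradient_def
  proof (intro conjI allI impI)
    show "integrable lborel (\<lambda>y. indicator (ball a r) y *\<^sub>R u' y)" for a r
      by (rule loc[OF _ u' u uu']) (use weak in \<open>simp add: has_weak_gradient_def\<close>)
    show "integrable lborel (\<lambda>y. indicator (ball a r) y *\<^sub>R g' y)" for a r
      by (rule loc[OF _ g' Du gg']) (use weak in \<open>simp add: has_weak_gradient_def\<close>)
  qed (use u' g' weak' in auto)
  then show ?thesis using uu' gg' by blast
qed

theorem corollary1p2:
  fixes q1 q2 q3 :: real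
  assumes "2 \<le> q1" and "2 \<le> q2" and "2 \<le> q3"
    and "1 / 2 \<le> 1 / q1 + 1 / q2 + 1 / q3"
    and "1 / q1 + 1 / q2 + 1 / q3 \<le> 3 / 2"
  shows "\<exists>C::real. C > 0 \<and>
    (\<forall>(u :: real ^ 3 \<Rightarrow> real) (Du :: real ^ 3 \<Rightarrow> real ^ 3).
      in_L2 u \<longrightarrow> has_weak_gradient u Du \<longrightarrow> in_L2 Du \<longrightarrow>
      mixed_norm q1 q2 q3 u \<le>
        ennreal (C * L2_norm Du powr (3 / 2 - (1 / q1 + 1 / q2 + 1 / q3))
                   * L2_norm u powr ((1 / q1 + 1 / q2 + 1 / q3) - 1 / 2)))"
proof -
  let ?S = "1 / q1 + 1 / q2 + 1 / q3"
  obtain C where C: "C > 0" "\<forall>u g a b. borel_weak_gradient u g \<longrightarrow>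
    Lp_norm 2 (\<lambda>y. ennreal \<bar>u y\<bar>) = ennreal a \<longrightarrow> Lp_norm 2 (\<lambda>y. ennreal (norm (g y))) = ennreal b \<longrightarrow>
    0 \<le> a \<longrightarrow> 0 \<le> b \<longrightarrow>
    mixed_norm q1 q2 q3 u \<le> ennreal (C * b powr (3 / 2 - ?S) * a powr (?S - 1 / 2))"
    using borel_weak_gradient_interpolation[OF assms(1-4)] by blast
  show ?thesis
  proof (intro exI[of _ C] conjI allI impI C(1))
    fix u :: "real ^ 3 \<Rightarrow> real" and Du :: "real ^ 3 \<Rightarrow> real ^ 3"
    assume u: "in_L2 u" and weak: "has_weak_gradient u Du" and Du: "in_L2 Du"
    obtain u' g' where ug: "borel_weak_gradient u' g'"
      and uu': "AE x in lborel. u x = u' x" and gg': "AE x in lborel. Du x = g' x"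
      using borel_representative[OF _ _ weak] u Du by (auto simp: in_L2_def)
    have "Lp_norm 2 (\<lambda>y. ennreal (norm (u y))) = Lp_norm 2 (\<lambda>y. ennreal \<bar>u' y\<bar>)"
    proof (rule Lp_norm_cong_AE)
      show "AE y in lborel. ennreal (norm (u y)) = ennreal \<bar>u' y\<bar>"
        using uu' by eventually_elim simp
    qed
    then have a: "Lp_norm 2 (\<lambda>y. ennreal \<bar>u' y\<bar>) = ennreal (L2_norm u)"
      using u by (simp add: L2_norm_def in_L2_def less_top)
    have "Lp_norm 2 (\<lambda>y. ennreal (norm (Du y))) = Lp_norm 2 (\<lambda>y. ennreal (norm (g' y)))"
    proof (rule Lp_norm_cong_AE)
      show "AE y in lborel. ennreal (norm (Du y)) = ennreal (norm (g' y))"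
        using gg' by eventually_elim simp
    qed
    then have b: "Lp_norm 2 (\<lambda>y. ennreal (norm (g' y))) = ennreal (L2_norm Du)"
      using Du by (simp add: L2_norm_def in_L2_def less_top)
    have "mixed_norm q1 q2 q3 u \<le> mixed_norm q1 q2 q3 u'"
      unfolding mixed_norm_eq
    proof (intro mixed_Lp_mono_AE)
      show "AE x in lborel. ennreal \<bar>u x\<bar> \<le> ennreal \<bar>u' x\<bar>"
        using uu' by eventually_elim simp
    qed (use assms(1-3) in auto)
    also have "\<dots> \<le> ennreal (C * L2_norm Du powr (3 / 2 - ?S) * L2_norm u powr (?S - 1 / 2))"
      using C(2)[rule_format, OF ug a b] by (simp add: L2_norm_def)
    finally show "mixed_norm q1 q2 q3 u \<le> ennreal (C * L2_norm Du powr (3 / 2 - ?S) * L2_norm u powr (?S - 1 / 2))" .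
  qed
qed

end
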